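(* Let $r\ge1$, let $n_1,\dots,n_r$ be non-negative integers, $\mathbf n=(n_1,\dots,n_r)$, and let $a,b,c,d,x_1,\dots,x_r$ be nonzero complex parameters, generic subject to $a^2q^{2|\mathbf n|+1}=cd$. Then $$\sum_{\substack{0\le k_i\le n_i\\ i=1,\dots,r}}\frac{\Delta(\mathbf xq^{2\mathbf k};p)}{\Delta(\mathbf x;p)}\frac{\theta(aq^{3|\mathbf k|};p)}{\theta(a;p)}\frac{(a,b,q/b;q,p)_{|\mathbf k|}}{(aq^{2|\mathbf n|+1};q,p)_{|\mathbf k|}\,(aq^2/b,aqb;q^2,p)_{|\mathbf k|}}q^{|\mathbf k|-e_2(\mathbf k)}$$ $$\times\prod_{i=1}^r\frac{(cx_i;q^2,p)_{k_i}\,(d/x_i;q^2,p)_{|\mathbf k|}\,(d/ax_i;q,p)_{|\mathbf k|-k_i}}{(aq^{2|\mathbf n|-2n_i+1}/cx_i;q,p)_{|\mathbf k|}\,(d/x_i;q^2,p)_{|\mathbf k|-k_i}\,(ax_iq^{k_i-|\mathbf k|+1}/d;q,p)_{k_i}}\prod_{i,j=1}^r\frac{(q^{-2n_j}x_i/x_j;q^2,p)_{k_i}}{(q^2x_i/x_j;q^2,p)_{k_i}}$$ $$=\frac{(aq;q,p)_{2|\mathbf n|}}{(abq,aq^2/b;q^2,p)_{|\mathbf n|}}\prod_{i=1}^r\frac{(abx_iq/d,ax_iq^2/bd;q^2,p)_{n_i}}{(ax_iq/d;q,p)_{2n_i}}.$$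
   Context: $p,q$ are complex numbers with $|p|<1$, $q\ne0$, and $q^k\notin p^{\mathbb Z}$ for all integers $k>0$ (if $p=0$: $q^k\ne1$). For $x\ne0$, $\theta(x;p)=\prod_{j=0}^\infty(1-p^jx)(1-p^{j+1}/x)$. Elliptic shifted factorials: $(a;q,p)_k=\prod_{j=0}^{k-1}\theta(aq^j;p)$ for $k\in\mathbb Z_{\ge0}$ (similarly with base $q^2$), and $(a_1,\dots,a_m;q,p)_k=(a_1;q,p)_k\cdots(a_m;q,p)_k$. For $\mathbf k=(k_1,\dots,k_r)$, $|\mathbf k|=k_1+\cdots+k_r$ and $e_2(\mathbf k)=\sum_{1\le i<j\le r}k_ik_j$. For $\mathbf x=(x_1,\dots,x_r)$, $\Delta(\mathbf x;p)=\prod_{1\le i<j\le r}x_j\theta(x_i/x_j;p)$, and $\mathbf xq^{2\mathbf k}=(x_1q^{2k_1},\dots,x_rq^{2k_r})$. In expressions such as $d/ax_i$, everything after the slash is in the denominator. All parameters are assumed generic so that no denominator vanishes. *)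

theory Defs
  imports "HOL-Analysis.Analysis"
begin

definition etheta :: "complex \<Rightarrow> complex \<Rightarrow> complex" where
  "etheta x p = (\<Prod>j. (1 - p ^ j * x) * (1 - p ^ (j + 1) / x))"

definition eshift :: "complex \<Rightarrow> complex \<Rightarrow> complex \<Rightarrow> nat \<Rightarrow> complex" where
  "eshift a q p k = (\<Prod>j<k. etheta (a * q ^ j) p)"

(* (a_1,...,a_m; q,p)_k *)
definition eshifts :: "complex list \<Rightarrow> complex \<Rightarrow> complex \<Rightarrow> nat \<Rightarrow> complex" where
  "eshifts as q p k = (\<Prod>a\<leftarrow>as. eshift a q p k)"

text \<open>An \<open>r\<close>-tuple is a function on \<open>nat\<close> of which only the values at \<open>1, \<dots>, r\<close> are used.\<close>

definition wt :: "nat \<Rightarrow> (nat \<Rightarrow> nat) \<Rightarrow> nat" where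
  "wt r k = (\<Sum>i=1..r. k i)"

definition e2 :: "nat \<Rightarrow> (nat \<Rightarrow> nat) \<Rightarrow> nat" where
  "e2 r k = (\<Sum>i=1..r. \<Sum>j\<in>{i<..r}. k i * k j)"

definition eDelta :: "nat \<Rightarrow> (nat \<Rightarrow> complex) \<Rightarrow> complex \<Rightarrow> complex" where
  "eDelta r x p = (\<Prod>i=1..r. \<Prod>j\<in>{i<..r}. x j * etheta (x i / x j) p)"

(* Extensional functions, so that each tuple occurs exactly once in a sum over the box. *)
definition kbox :: "nat \<Rightarrow> (nat \<Rightarrow> nat) \<Rightarrow> (nat \<Rightarrow> nat) set" where
  "kbox r n = (\<Pi>\<^sub>E i\<in>{1..r}. {0..n i})"

end

theory Submission
  imports Defs
begin

text \<open>
  Replacing each \<open>x\<^sub>i\<close> by the string \<open>x\<^sub>i, x\<^sub>i q\<^sup>2, \<dots>, x\<^sub>i q\<^bsup>2(n\<^sub>i-1)\<^esup>\<close> reduces the identity to the case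
  in which all \<open>n\<^sub>i\<close> are \<open>1\<close>: the sum then runs over the subsets of an index set of \<open>N = |\<^bold>n|\<close> elements,
  and on strings only the initial segments contribute. As a function of one variable
  \<open>u\<^sub>t = d/(a x\<^sub>t)\<close>, the difference of both sides of this subset identity has no poles and lies in a
  two-dimensional space of theta functions. It vanishes at \<open>u\<^sub>t = a q\<^bsup>2N+1\<^esup>\<close> by induction on \<open>N\<close>, so a
  second zero suffices. Starting from a geometric string at which a single term of the sum
  survives, the variables are therefore replaced by arbitrary values one at a time, first for generic
  parameters and then in general by continuity.

  Since the poles are cleared by multiplying with a theta product, ``two-dimensional'' is an
  interpolation formula for theta products, an algebraic consequence of the addition formula. The
  latter holds because, by the Jacobi triple product, \<open>\<theta>(xy)\<theta>(x/y)/x\<close> is antisymmetric and of rank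
  two in \<open>(x, y)\<close>, so that its Pfaffians vanish.
\<close>

section \<open>The theta function and its addition formula\<close>

text \<open>The value p = 0, where \<open>etheta x p\<close> is 1 - x, is allowed, so the zero count
  cannot rest on quasi-periodicity in p; an interpolation formula that is algebraic in theta covers
  all |p| < 1. In one variable, clearing the poles at the N - 1 other variables raises the degree to
  N + 1. The residues cancel in pairs of subsets, so the cleared difference vanishes at these N - 1
  points, and two further zeros decide. The zero at a q^(2N+1) requires the identity for N - 1 with
  arbitrary remaining variables; the other one is the value replaced in the current step, which is
  why the variables leave the string one at a time. The string starts at q^(3-N) so that, whenever
  the complement of a proper subset is an initial segment, some factor of the complement is
  \<theta>(1) = 0. Interpolation needs nodes that are distinct modulo p^Z and avoid one product
  relation, conditions absent from the theorem. Scaling a by t and every u_i by t^2 keeps the ratios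
  u_i/u_j and destroys the bad relations for all but countably many t.\<close>

lemma summable_nome_power:
  fixes p x :: complex
  assumes "norm p < 1"
  shows "summable (\<lambda>j. norm (p ^ j * x))"
  using assms by (simp add: norm_mult norm_power summable_mult2 summable_geometric)

lemma convergent_prod_qpoch:
  fixes p x :: complex
  assumes "norm p < 1"
  shows "convergent_prod (\<lambda>j. 1 - p ^ j * x)"
proof -
  have "abs_convergent_prod (\<lambda>j. 1 + (- (p ^ j * x)))"
    by (rule summable_imp_abs_convergent_prod) (use summable_nome_power[OF assms, of x] in simp)
  then show ?thesis
    using abs_convergent_prod_imp_convergent_prod by fastforce
qed

definition qpoch_inf :: "complex \<Rightarrow> complex \<Rightarrow> complex" where
  "qpoch_inf x p = (\<Prod>j. 1 - p ^ j * x)"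

lemma etheta_eq_qpoch:
  assumes "norm p < 1"
  shows "etheta x p = qpoch_inf x p * qpoch_inf (p / x) p"
proof -
  have "qpoch_inf x p * qpoch_inf (p / x) p = (\<Prod>j. (1 - p ^ j * x) * (1 - p ^ j * (p / x)))"
    unfolding qpoch_inf_def by (intro prodinf_mult convergent_prod_qpoch assms)
  then show ?thesis
    by (simp add: etheta_def mult.commute)
qed

lemma qpoch_inf_rec:
  assumes "norm p < 1"
  shows "qpoch_inf x p = (1 - x) * qpoch_inf (p * x) p"
proof (cases "x = 1")
  case True
  have "(\<lambda>j. 1 - p ^ j * x) has_prod qpoch_inf x p"
    unfolding qpoch_inf_def by (rule convergent_prod_has_prod[OF convergent_prod_qpoch[OF assms]])
  moreover have "0 \<in> range (\<lambda>j. 1 - p ^ j * x)"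
    by (rule range_eqI[of _ _ 0]) (use True in simp)
  ultimately have "qpoch_inf x p = 0"
    by (simp only: has_prod_eq_0_iff)
  then show ?thesis using True by simp
next
  case False
  have "(\<Prod>j. 1 - p ^ Suc j * x) = (\<Prod>j. 1 - p ^ j * x) / (1 - p ^ 0 * x)"
    by (rule prodinf_split_head[OF convergent_prod_qpoch[OF assms]]) (use False in simp)
  moreover have "p ^ Suc j * x = p ^ j * (p * x)" for j
    by simp
  ultimately have "qpoch_inf (p * x) p = qpoch_inf x p / (1 - x)"
    unfolding qpoch_inf_def by (simp only: power_0 mult_1_left)
  then show ?thesis using False by simp
qed

lemma etheta_inverse:
  assumes "norm p < 1" and "x \<noteq> 0"
  shows "etheta (1 / x) p = - etheta x p / x"
proof -
  have "etheta (1 / x) p = (1 - 1 / x) * qpoch_inf (p / x) p * qpoch_inf (p * x) p"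
    using qpoch_inf_rec[OF assms(1), of "1 / x"] assms by (simp add: etheta_eq_qpoch)
  moreover have "etheta x p = (1 - x) * qpoch_inf (p * x) p * qpoch_inf (p / x) p"
    using qpoch_inf_rec[OF assms(1), of x] assms by (simp add: etheta_eq_qpoch)
  moreover have "(1 - 1 / x) * A * B = - ((1 - x) * B * A) / x" for A B
    using assms(2) by (simp add: divide_inverse algebra_simps)
  ultimately show ?thesis
    by (simp only: )
qed

lemma etheta_one: "norm p < 1 \<Longrightarrow> etheta 1 p = 0"
  using qpoch_inf_rec[of p 1] by (simp add: etheta_eq_qpoch)

text \<open>A product convergent in the sense of \<open>convergent_prod\<close> vanishes only if one
  of its factors does. The second alternative avoids a division by x, so that x = 0 needs no
  exclusion.\<close>

lemma etheta_eq_0D: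
  assumes "norm p < 1" and "etheta x p = 0"
  shows "\<exists>j. p ^ j * x = 1 \<or> p ^ Suc j = x"
proof (rule ccontr)
  assume *: "\<not> ?thesis"
  have "qpoch_inf x p \<noteq> 0" unfolding qpoch_inf_def
    by (rule prodinf_nonzero[OF convergent_prod_qpoch[OF assms(1)]]) (use * in force)
  moreover have "qpoch_inf (p / x) p \<noteq> 0" unfolding qpoch_inf_def
  proof (rule prodinf_nonzero[OF convergent_prod_qpoch[OF assms(1)]])
    fix j
    have "p ^ Suc j \<noteq> x" using * by blast
    then show "1 - p ^ j * (p / x) \<noteq> 0"
      by (cases "x = 0") (auto simp: field_simps)
  qed
  ultimately show False using assms by (simp add: etheta_eq_qpoch)
qed

lemma countable_etheta_zeros:
  assumes "norm p < 1"
  shows "countable {x. etheta x p = 0}"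
proof (rule countable_subset)
  show "{x. etheta x p = 0} \<subseteq> range (\<lambda>j. inverse (p ^ j)) \<union> range (\<lambda>j. p ^ Suc j)"
  proof
    fix x assume "x \<in> {x. etheta x p = 0}"
    then obtain j where "p ^ j * x = 1 \<or> p ^ Suc j = x"
      using etheta_eq_0D[OF assms] by blast
    then show "x \<in> range (\<lambda>j. inverse (p ^ j)) \<union> range (\<lambda>j. p ^ Suc j)"
      by (metis UnI1 UnI2 inverse_unique rangeI)
  qed
qed auto

text \<open>On a closed ball the deviations of the factors from 1 have a geometric majorant, so the
  partial products converge uniformly there.\<close>

lemma continuous_on_qpoch_inf:
  assumes "norm p < 1"
  shows "continuous_on UNIV (\<lambda>x. qpoch_inf x p)"
proof -
  have "isCont (\<lambda>x. qpoch_inf x p) x" for x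
  proof -
    define A where "A = cball (0::complex) (norm x + 1)"
    have "uniformly_convergent_on A (\<lambda>N x. \<Prod>n<N. 1 - p ^ n * x)"
    proof (rule uniformly_convergent_on_prod')
      show "uniformly_convergent_on A (\<lambda>N y. \<Sum>n<N. norm (1 - p ^ n * y - 1))"
      proof (rule Weierstrass_m_test')
        show "norm (norm (1 - p ^ n * y - 1)) \<le> norm (p ^ n * of_real (norm x + 1))" if "y \<in> A" for n y
          using that by (auto simp: A_def norm_mult mult_left_mono)
        show "summable (\<lambda>n. norm (p ^ n * of_real (norm x + 1)))"
          by (rule summable_nome_power[OF assms])
      qed
    qed (auto simp: A_def intro!: continuous_intros)
    then obtain l where l: "uniform_limit A (\<lambda>N x. \<Prod>n<N. 1 - p ^ n * x) l sequentially"
      by (auto simp: uniformly_convergent_on_def)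
    have "continuous_on A l"
      by (rule uniform_limit_theorem[OF _ l]) (auto intro!: continuous_intros always_eventually)
    moreover have "l y = qpoch_inf y p" if "y \<in> A" for y
    proof -
      have "(\<lambda>N. \<Prod>n<N. 1 - p ^ n * y) \<longlonglongrightarrow> l y"
        using tendsto_uniform_limitI[OF l that] .
      moreover have "(\<lambda>N. \<Prod>n<N. 1 - p ^ n * y) \<longlonglongrightarrow> qpoch_inf y p"
        unfolding qpoch_inf_def using convergent_prod_LIMSEQ[OF convergent_prod_qpoch[OF assms]]
          LIMSEQ_lessThan_iff_atMost by blast
      ultimately show ?thesis by (rule LIMSEQ_unique)
    qed
    ultimately have "continuous_on A (\<lambda>x. qpoch_inf x p)"
      by simp
    then show ?thesis
      by (rule continuous_on_interior) (auto simp: A_def)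
  qed
  then show ?thesis
    by (simp add: continuous_on_eq_continuous_at)
qed

lemma continuous_on_etheta:
  assumes "norm p < 1" and "continuous_on S f" and "\<And>t. t \<in> S \<Longrightarrow> f t \<noteq> 0"
  shows "continuous_on S (\<lambda>t. etheta (f t) p)"
proof -
  have 1: "continuous_on S (\<lambda>t. qpoch_inf (g t) p)" if "continuous_on S g" for g
    by (rule continuous_on_compose2[OF continuous_on_qpoch_inf[OF assms(1)] that]) auto
  show ?thesis
    unfolding etheta_eq_qpoch[OF assms(1)] by (intro continuous_intros 1 assms) (use assms in auto)
qed

section \<open>The Jacobi triple product as a limit of its finite form\<close>

definition qfact :: "complex \<Rightarrow> nat \<Rightarrow> complex" where
  "qfact p m = (\<Prod>i<m. 1 - p ^ Suc i)"

text \<open>Extending \<open>1/(p;p)\<^sub>m\<close> by zero to negative \<open>m\<close> keeps its recurrence valid at the boundary.\<close>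

definition inv_qfact :: "complex \<Rightarrow> int \<Rightarrow> complex" where
  "inv_qfact p m = (if m < 0 then 0 else 1 / qfact p (nat m))"

text \<open>The exponent of p is never negative and is kept in \<open>nat\<close>, so that the term
  has its usual meaning at p = 0, where only k = 0 and k = 1 survive.\<close>

definition jterm :: "complex \<Rightarrow> complex \<Rightarrow> int \<Rightarrow> complex" where
  "jterm p x k = (-1) powi k * p ^ nat (k * (k - 1) div 2) * x powi k"

lemma one_minus_nome_power_nz:
  fixes p :: complex
  assumes "norm p < 1" shows "1 - p ^ Suc i \<noteq> 0"
proof
  assume "1 - p ^ Suc i = 0"
  then have "p ^ Suc i = 1" by simp
  then have "norm p ^ Suc i = 1" by (metis norm_one norm_power)
  moreover have "norm p ^ Suc i \<le> norm p"
    using assms by (simp add: mult_left_le power_le_one)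
  ultimately show False using assms by simp
qed

lemma qfact_nz: "norm p < 1 \<Longrightarrow> qfact p m \<noteq> 0"
  using one_minus_nome_power_nz by (simp add: qfact_def)

lemma qfact_0 [simp]: "qfact p 0 = 1"
  by (simp add: qfact_def)

lemma inv_qfact_rec:
  assumes "norm p < 1" and "s \<ge> -1"
  shows "inv_qfact p s = (1 - p ^ nat (s + 1)) * inv_qfact p (s + 1)"
proof (cases "s = -1")
  case False
  then have "nat (s + 1) = Suc (nat s)" using assms by simp
  then show ?thesis
    using assms False one_minus_nome_power_nz[OF assms(1), of "nat s"] qfact_nz[OF assms(1)]
    by (simp add: inv_qfact_def qfact_def)
qed (simp add: inv_qfact_def)

lemma inv_qfact_rec2:
  assumes "norm p < 1" and "s \<ge> -1"
  shows "inv_qfact p (s - 1) = (1 - p ^ nat s) * (1 - p ^ nat (s + 1)) * inv_qfact p (s + 1)"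
proof (cases "s = -1")
  case True
  then show ?thesis by (simp add: inv_qfact_def)
next
  case False
  then show ?thesis
    using inv_qfact_rec[OF assms(1), of "s - 1"] inv_qfact_rec[OF assms(1), of s] assms by simp
qed

text \<open>These are the shifts of k caused by the terms p^n x and p^(n+1)/x of the next factor of
  the finite product. The bounds on k are those that keep the exponent of p on the right
  nonnegative; they admit the new end points k = n + 1 and k = -n - 1.\<close>

lemma jterm_step:
  assumes "x \<noteq> 0"
  shows "k \<le> int n + 1 \<Longrightarrow> p ^ n * x * jterm p x (k - 1) = - (p ^ nat (int n - k + 1)) * jterm p x k"
    and "k \<ge> - int n - 1 \<Longrightarrow> p ^ Suc n / x * jterm p x (k + 1) = - (p ^ nat (int n + 1 + k)) * jterm p x k"
proof -
  have e: "k * (k - 1) div 2 = (k - 1) * (k - 2) div 2 + (k - 1)" for k :: int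
  proof -
    have "k * (k - 1) = (k - 1) * (k - 2) + 2 * (k - 1)" by (simp add: algebra_simps)
    then show ?thesis by simp
  qed
  have nn: "k * (k - 1) div 2 \<ge> 0" for k :: int
  proof -
    have "k * (k - 1) \<ge> 0" by (cases "k \<ge> 1") (auto simp: mult_nonpos_nonpos)
    then show ?thesis by simp
  qed
  have sg: "(-1 :: complex) powi (k + 1) = - ((-1) powi k)" for k
    by (simp add: power_int_add)
  show "p ^ n * x * jterm p x (k - 1) = - (p ^ nat (int n - k + 1)) * jterm p x k" if "k \<le> int n + 1"
  proof -
    have "n + nat ((k - 1) * (k - 2) div 2) = nat (int n - k + 1) + nat (k * (k - 1) div 2)"
      using that e[of k] nn[of k] nn[of "k - 1"] by simp
    then have "p ^ n * p ^ nat ((k - 1) * (k - 2) div 2) = p ^ nat (int n - k + 1) * p ^ nat (k * (k - 1) div 2)"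
      by (simp flip: power_add)
    moreover have "x * x powi (k - 1) = x powi k"
      using assms by (simp add: power_int_diff)
    moreover have "p ^ n * x * jterm p x (k - 1) =
        (-1) powi (k - 1) * (p ^ n * p ^ nat ((k - 1) * (k - 2) div 2)) * (x * x powi (k - 1))"
      by (simp add: jterm_def)
    ultimately show ?thesis
      using sg[of "k - 1"] by (simp add: jterm_def)
  qed
  show "p ^ Suc n / x * jterm p x (k + 1) = - (p ^ nat (int n + 1 + k)) * jterm p x k" if "k \<ge> - int n - 1"
  proof -
    have "Suc n + nat ((k + 1) * k div 2) = nat (int n + 1 + k) + nat (k * (k - 1) div 2)"
      using that e[of "k + 1"] nn[of k] nn[of "k + 1"] by (simp add: mult.commute)
    then have "p ^ Suc n * p ^ nat ((k + 1) * k div 2) = p ^ nat (int n + 1 + k) * p ^ nat (k * (k - 1) div 2)"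
      by (simp only: power_add[symmetric])
    moreover have "x powi (k + 1) / x = x powi k"
      using assms by (simp add: power_int_add)
    moreover have "p ^ Suc n / x * jterm p x (k + 1) =
        (-1) powi (k + 1) * (p ^ Suc n * p ^ nat ((k + 1) * k div 2)) * (x powi (k + 1) / x)"
      by (simp add: jterm_def)
    ultimately show ?thesis
      using sg[of k] by (simp add: jterm_def)
  qed
qed

text \<open>With s = n + k and t = n - k this is the recurrence in n for the Gaussian binomial of 2n
  over n + k that comes from multiplying by (1 - p^n x)(1 - p^(n+1)/x). In the interior it is the
  polynomial identity \<open>poly\<close> in S = p^s and T = p^t; at s = -1 or t = -1 a single term
  on the right survives.\<close>

lemma jcoeff_step:
  assumes p: "norm p < 1" and "s \<ge> -1" "t \<ge> -1" "s + t = int (2 * n)"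
  shows "qfact p (2 * Suc n) * inv_qfact p (s + 1) * inv_qfact p (t + 1)
     = qfact p (2 * n) * ((1 + p ^ (2 * n + 1)) * inv_qfact p s * inv_qfact p t
        + p ^ nat (t + 1) * inv_qfact p (s - 1) * inv_qfact p (t + 1)
        + p ^ nat (s + 1) * inv_qfact p (s + 1) * inv_qfact p (t - 1))"
proof -
  have Q: "qfact p (2 * Suc n) = qfact p (2 * n) * (1 - p ^ (2 * n + 1)) * (1 - p ^ (2 * n + 2))"
    by (simp add: qfact_def)
  have edge: "qfact p (2 * Suc n) * inv_qfact p (int (2 * n) + 2) = qfact p (2 * n) * inv_qfact p (int (2 * n))"
    using qfact_nz[OF p] by (simp add: inv_qfact_def nat_add_distrib nat_mult_distrib)
  have poly: "Q * (1 - S * T * p) * (1 - S * T * (p * p)) * A * B =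
      Q * ((1 + S * T * p) * ((1 - p * S) * A) * ((1 - p * T) * B)
        + p * T * ((1 - S) * (1 - p * S) * A) * B
        + p * S * A * ((1 - T) * (1 - p * T) * B))" for Q S T A B
    by algebra
  consider "s = -1" | "t = -1" | "s \<ge> 0" "t \<ge> 0" using assms by linarith
  then show ?thesis
  proof cases
    case 1
    then have "t = int (2 * n) + 1" using assms by simp
    then show ?thesis using 1 edge by (simp add: inv_qfact_def add.commute)
  next
    case 2
    then have "s = int (2 * n) + 1" using assms by simp
    then show ?thesis using 2 edge by (simp add: inv_qfact_def add.commute)
  next
    case 3
    define S T where "S = p ^ nat s" and "T = p ^ nat t"
    have "nat s + nat t = 2 * n" using 3 assms by linarith
    then have ST: "p ^ (2 * n) = S * T" by (simp add: S_def T_def flip: power_add)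
    have "p ^ nat (s + 1) = p * S" "p ^ nat (t + 1) = p * T"
      using 3 by (auto simp: S_def T_def nat_add_distrib)
    then show ?thesis
      unfolding Q inv_qfact_rec[OF p assms(2)] inv_qfact_rec[OF p assms(3)]
        inv_qfact_rec2[OF p assms(2)] inv_qfact_rec2[OF p assms(3)] power_add ST
        S_def[symmetric] T_def[symmetric]
      by (simp only: power_one_right power2_eq_square) (rule poly)
  qed
qed

text \<open>Passing from n to n + 1 multiplies the product by 1 + p^(2n+1) - p^n x - p^(n+1)/x, and
  the coefficients of the two sums are matched one by one by \<open>jcoeff_step\<close>.\<close>

lemma finite_jacobi:
  assumes p: "norm p < 1" and x: "x \<noteq> 0"
  shows "(\<Prod>j<n. (1 - p ^ j * x) * (1 - p ^ (j + 1) / x)) =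
    (\<Sum>k\<in>{- int n..int n}. qfact p (2 * n) * inv_qfact p (int n + k) * inv_qfact p (int n - k) * jterm p x k)"
proof (induction n)
  case 0
  show ?case by (simp add: qfact_def inv_qfact_def jterm_def)
next
  case (Suc n)
  define g where "g = (\<lambda>n k. qfact p (2 * n) * inv_qfact p (int n + k) * inv_qfact p (int n - k) * jterm p x k)"
  \<comment> \<open>The zero convention in \<open>inv_qfact\<close> makes \<open>g n\<close> vanish
    outside its range, so the shifted sums can all be brought to the same index set.\<close>
  have g0: "g n k = 0" if "k \<notin> {- int n..int n}" for k
    using that by (auto simp: g_def inv_qfact_def)
  let ?I = "{- int n..int n}" and ?J = "{- int (Suc n)..int (Suc n)}"
  have "g (Suc n) k = (1 + p ^ (2 * n + 1)) * g n k - p ^ n * x * g n (k - 1) - p ^ Suc n / x * g n (k + 1)"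
    if k: "k \<in> ?J" for k
  proof -
    have a: "p ^ n * x * g n (k - 1) = - (p ^ nat (int n - k + 1)) *
        (qfact p (2 * n) * inv_qfact p (int n + k - 1) * inv_qfact p (int n - k + 1)) * jterm p x k"
    proof -
      have "p ^ n * x * g n (k - 1) = (p ^ n * x * jterm p x (k - 1)) *
        (qfact p (2 * n) * inv_qfact p (int n + (k - 1)) * inv_qfact p (int n - (k - 1)))"
        unfolding g_def by (simp only: mult_ac)
      also have "p ^ n * x * jterm p x (k - 1) = - (p ^ nat (int n - k + 1)) * jterm p x k"
        by (rule jterm_step(1)[OF x]) (use k in auto)
      finally show ?thesis by (simp add: algebra_simps)
    qed
    have b: "p ^ Suc n / x * g n (k + 1) = - (p ^ nat (int n + k + 1)) *
        (qfact p (2 * n) * inv_qfact p (int n + k + 1) * inv_qfact p (int n - k - 1)) * jterm p x k"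
    proof -
      have "p ^ Suc n / x * g n (k + 1) = (p ^ Suc n / x * jterm p x (k + 1)) *
        (qfact p (2 * n) * inv_qfact p (int n + (k + 1)) * inv_qfact p (int n - (k + 1)))"
        unfolding g_def by (simp only: mult_ac)
      also have "p ^ Suc n / x * jterm p x (k + 1) = - (p ^ nat (int n + 1 + k)) * jterm p x k"
        by (rule jterm_step(2)[OF x]) (use k in auto)
      finally show ?thesis by (simp add: algebra_simps)
    qed
    have "g (Suc n) k = qfact p (2 * Suc n) * inv_qfact p (int n + k + 1) * inv_qfact p (int n - k + 1) * jterm p x k"
      by (simp add: g_def algebra_simps)
    also have "qfact p (2 * Suc n) * inv_qfact p (int n + k + 1) * inv_qfact p (int n - k + 1) =
      qfact p (2 * n) * ((1 + p ^ (2 * n + 1)) * inv_qfact p (int n + k) * inv_qfact p (int n - k)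
        + p ^ nat (int n - k + 1) * inv_qfact p (int n + k - 1) * inv_qfact p (int n - k + 1)
        + p ^ nat (int n + k + 1) * inv_qfact p (int n + k + 1) * inv_qfact p (int n - k - 1))"
      by (rule jcoeff_step[OF p]) (use k in auto)
    finally show ?thesis
      unfolding a b by (simp only: g_def distrib_left distrib_right mult.assoc mult.commute mult.left_commute
          mult_minus_left mult_minus_right minus_minus diff_conv_add_uminus mult_1_left)
  qed
  then have "sum (g (Suc n)) ?J = (1 + p ^ (2 * n + 1)) * sum (g n) ?J
      - p ^ n * x * (\<Sum>k\<in>?J. g n (k - 1)) - p ^ Suc n / x * (\<Sum>k\<in>?J. g n (k + 1))"
    by (simp add: sum_subtractf sum_distrib_left)
  also have "sum (g n) ?J = sum (g n) ?I"
    by (rule sum.mono_neutral_right) (use g0 in auto)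
  also have "(\<Sum>k\<in>?J. g n (k - 1)) = sum (g n) {- int n - 2..int n}"
    by (rule sum.reindex_bij_witness[of _ "\<lambda>k. k + 1" "\<lambda>k. k - 1"]) auto
  also have "\<dots> = sum (g n) ?I"
    by (rule sum.mono_neutral_right) (use g0 in auto)
  also have "(\<Sum>k\<in>?J. g n (k + 1)) = sum (g n) {- int n..int n + 2}"
    by (rule sum.reindex_bij_witness[of _ "\<lambda>k. k - 1" "\<lambda>k. k + 1"]) auto
  also have "\<dots> = sum (g n) ?I"
    by (rule sum.mono_neutral_right) (use g0 in auto)
  also have "(1 + p ^ (2 * n + 1)) * sum (g n) ?I - p ^ n * x * sum (g n) ?I - p ^ Suc n / x * sum (g n) ?I
      = ((1 + p ^ (2 * n + 1)) - p ^ n * x - p ^ Suc n / x) * sum (g n) ?I"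
    by (simp only: left_diff_distrib)
  also have "(1 + p ^ (2 * n + 1)) - p ^ n * x - p ^ Suc n / x = (1 - p ^ n * x) * (1 - p ^ (n + 1) / x)"
  proof -
    have "p ^ (2 * n + 1) = p ^ n * p ^ Suc n"
      by (simp flip: power_add add: mult_2)
    then show ?thesis using x by (simp add: field_simps)
  qed
  finally have "sum (g (Suc n)) ?J = (1 - p ^ n * x) * (1 - p ^ (n + 1) / x) * sum (g n) ?I" .
  note step = this
  have IH: "(\<Prod>j<n. (1 - p ^ j * x) * (1 - p ^ (j + 1) / x)) = sum (g n) ?I"
    using Suc.IH by (simp only: g_def)
  have "(\<Prod>j<Suc n. (1 - p ^ j * x) * (1 - p ^ (j + 1) / x)) =
      sum (g n) ?I * ((1 - p ^ n * x) * (1 - p ^ (n + 1) / x))"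
    by (simp only: prod.lessThan_Suc IH)
  also have "\<dots> = sum (g (Suc n)) ?J"
    by (simp only: step mult.commute)
  finally show ?case by (simp only: g_def)
qed

abbreviation asum :: "('a \<Rightarrow> complex) \<Rightarrow> 'a set \<Rightarrow> bool" where
  "asum \<equiv> Infinite_Set_Sum.abs_summable_on"

lemma summable_ratio_null:
  fixes f c :: "nat \<Rightarrow> complex"
  assumes "\<And>n. f (Suc n) = c n * f n" and "c \<longlonglongrightarrow> 0"
  shows "summable (\<lambda>n. norm (f n))"
proof -
  have "eventually (\<lambda>n. norm (c n) < 1 / 2) sequentially"
    using order_tendstoD(2)[OF tendsto_norm[OF assms(2)], of "1 / 2"] by simp
  then obtain N where N: "\<And>n. n \<ge> N \<Longrightarrow> norm (c n) < 1 / 2"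
    by (auto simp: eventually_sequentially)
  show ?thesis
  proof (rule summable_ratio_test[of "1 / 2" N])
    fix n assume "n \<ge> N"
    then have "norm (c n) * norm (f n) \<le> 1 / 2 * norm (f n)"
      using N[of n] by (intro mult_right_mono) auto
    then show "norm (norm (f (Suc n))) \<le> 1 / 2 * norm (norm (f n))"
      by (simp add: assms(1) norm_mult)
  qed simp
qed

text \<open>Successive terms have ratio -p^n x upwards and -p^(n+1)/x downwards, and both ratios
  tend to 0.\<close>

lemma abs_summable_jterm:
  assumes p: "norm p < 1" and x: "x \<noteq> 0"
  shows "asum (jterm p x) UNIV"
proof -
  have lim: "(\<lambda>n. p ^ n) \<longlonglongrightarrow> 0"
    using p by (rule LIMSEQ_power_zero)
  have "summable (\<lambda>n. norm (jterm p x (int n)))"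
  proof (rule summable_ratio_null)
    show "jterm p x (int (Suc n)) = - (p ^ n * x) * jterm p x (int n)" for n
      using jterm_step(1)[OF x, of "int n + 1" n p] by (simp add: add.commute)
    show "(\<lambda>n. - (p ^ n * x)) \<longlonglongrightarrow> 0"
      using tendsto_minus[OF tendsto_mult[OF lim tendsto_const[of x]]] by simp
  qed
  moreover have "summable (\<lambda>n. norm (jterm p x (- int n)))"
  proof (rule summable_ratio_null)
    show "jterm p x (- int (Suc n)) = - (p ^ Suc n / x) * jterm p x (- int n)" for n
    proof -
      have "p ^ Suc n / x * jterm p x (- int (Suc n) + 1) =
          - (p ^ nat (int n + 1 + - int (Suc n))) * jterm p x (- int (Suc n))"
        by (rule jterm_step(2)[OF x]) simp
      moreover have "- int (Suc n) + 1 = - int n" "nat (int n + 1 + - int (Suc n)) = 0" by simp_all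
      ultimately show ?thesis
        by (simp only: power_0 mult_minus_left mult_1_left minus_minus)
    qed
    show "(\<lambda>n. - (p ^ Suc n / x)) \<longlonglongrightarrow> 0"
      using tendsto_minus[OF tendsto_mult[OF LIMSEQ_Suc[OF lim] tendsto_const[of "1 / x"]]] by simp
  qed
  ultimately have "asum (jterm p x) (range int \<union> range (\<lambda>n. - int n))"
    by (intro Infinite_Set_Sum.abs_summable_on_union Infinite_Set_Sum.abs_summable_on_reindex)
       (auto simp: abs_summable_on_nat_iff')
  moreover have "range int \<union> range (\<lambda>n. - int n) = UNIV"
  proof -
    have "k \<in> range int \<union> range (\<lambda>n. - int n)" for k
      by (cases k rule: int_cases2) auto
    then show ?thesis by blast
  qed
  ultimately show ?thesis by simp
qed

lemma qpoch_inf_nome_nz: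
  assumes p: "norm p < 1"
  shows "qpoch_inf p p \<noteq> 0"
  unfolding qpoch_inf_def
  by (rule prodinf_nonzero[OF convergent_prod_qpoch[OF p]])
     (use one_minus_nome_power_nz[OF p] in \<open>simp add: mult.commute\<close>)

text \<open>Dominated convergence in the finite form: \<open>qfact\<close> and its reciprocals are
  bounded, which gives a majorant proportional to the norm of \<open>jterm\<close>, and the
  coefficient of each fixed \<open>jterm\<close> tends to 1/L.\<close>

theorem jacobi_triple_product:
  assumes p: "norm p < 1" and x: "x \<noteq> 0"
  shows "qpoch_inf p p * etheta x p = infsetsum (jterm p x) UNIV"
proof -
  define L where "L = qpoch_inf p p"
  have L: "L \<noteq> 0"
    unfolding L_def by (rule qpoch_inf_nome_nz[OF p])
  have lim: "qfact p \<longlonglongrightarrow> L"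
  proof -
    have "(\<lambda>n. \<Prod>i\<le>n. 1 - p ^ i * p) \<longlonglongrightarrow> L"
      unfolding L_def qpoch_inf_def by (rule convergent_prod_LIMSEQ[OF convergent_prod_qpoch[OF p]])
    then have "(\<lambda>n. \<Prod>i<n. 1 - p ^ i * p) \<longlonglongrightarrow> L"
      using LIMSEQ_lessThan_iff_atMost by blast
    then show ?thesis by (simp add: qfact_def[abs_def] mult.commute)
  qed
  have lim': "(\<lambda>m. 1 / qfact p m) \<longlonglongrightarrow> 1 / L"
    by (rule tendsto_divide[OF tendsto_const lim L])
  obtain A where A: "\<And>m. norm (qfact p m) \<le> A" and "A > 0"
    using convergent_imp_Bseq[OF convergentI[OF lim]] by (auto simp: Bseq_def)
  obtain B where B: "\<And>m. norm (1 / qfact p m) \<le> B" and "B > 0"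
    using convergent_imp_Bseq[OF convergentI[OF lim']] unfolding Bseq_def by auto
  have B': "norm (inv_qfact p k) \<le> B" for k
    using B[of "nat k"] \<open>B > 0\<close> by (simp add: inv_qfact_def)
  define F where "F = (\<lambda>n k. qfact p (2 * n) * inv_qfact p (int n + k) * inv_qfact p (int n - k) * jterm p x k)"
  have shift: "filterlim (\<lambda>n. nat (int n + k)) at_top sequentially" for k
  proof (subst filterlim_at_top, intro allI)
    fix Z show "\<forall>\<^sub>F n in sequentially. Z \<le> nat (int n + k)"
      using eventually_ge_at_top[of "nat (int Z - k)"] by eventually_elim linarith
  qed
  have inv_lim: "(\<lambda>n. inv_qfact p (int n + k)) \<longlonglongrightarrow> 1 / L" for k
  proof (rule Lim_transform_eventually)
    show "(\<lambda>n. 1 / qfact p (nat (int n + k))) \<longlonglongrightarrow> 1 / L"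
      by (rule filterlim_compose[OF lim' shift])
    show "\<forall>\<^sub>F n in sequentially. 1 / qfact p (nat (int n + k)) = inv_qfact p (int n + k)"
      using eventually_ge_at_top[of "nat (- k)"] by eventually_elim (simp add: inv_qfact_def)
  qed
  have F_lim: "(\<lambda>n. F n k) \<longlonglongrightarrow> jterm p x k / L" for k
  proof -
    have "(\<lambda>n. qfact p (2 * n)) \<longlonglongrightarrow> L"
      by (rule filterlim_compose[OF lim]) (simp add: filterlim_subseq strict_mono_def)
    then have "(\<lambda>n. F n k) \<longlonglongrightarrow> L * (1 / L) * (1 / L) * jterm p x k"
      unfolding F_def using inv_lim[of k] inv_lim[of "- k"]
      by (intro tendsto_mult tendsto_const) simp_all
    then show ?thesis using L by simp
  qed
  have "(\<lambda>n. infsetsum (F n) UNIV) \<longlonglongrightarrow> infsetsum (\<lambda>k. jterm p x k / L) UNIV"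
    unfolding infsetsum_def
  proof (rule integral_dominated_convergence)
    show "integrable (count_space UNIV) (\<lambda>k. A * B * B * norm (jterm p x k))"
      using abs_summable_jterm[OF p x]
      by (intro integrable_mult_right integrable_norm) (simp add: Infinite_Set_Sum.abs_summable_on_def)
    have "norm (F n k) \<le> A * B * B * norm (jterm p x k)" for n k
      unfolding F_def norm_mult using A B' \<open>A > 0\<close> \<open>B > 0\<close>
      by (intro mult_mono mult_nonneg_nonneg) auto
    then show "AE k in count_space UNIV. norm (F n k) \<le> A * B * B * norm (jterm p x k)" for n
      by simp
  qed (use F_lim in simp_all)
  moreover have "infsetsum (F n) UNIV = (\<Prod>j<n. (1 - p ^ j * x) * (1 - p ^ (j + 1) / x))" for n
  proof -
    have "infsetsum (F n) UNIV = infsetsum (F n) {- int n..int n}"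
      by (rule infsetsum_cong_neutral) (auto simp: F_def inv_qfact_def)
    then show ?thesis using finite_jacobi[OF p x, of n] by (simp add: F_def)
  qed
  moreover have "(\<lambda>n. \<Prod>j<n. (1 - p ^ j * x) * (1 - p ^ (j + 1) / x)) \<longlonglongrightarrow> etheta x p"
  proof -
    have "convergent_prod (\<lambda>j. (1 - p ^ j * x) * (1 - p ^ (j + 1) / x))"
      using convergent_prod_mult[OF convergent_prod_qpoch[OF p, of x] convergent_prod_qpoch[OF p, of "p / x"]]
      by (simp add: mult.commute)
    then show ?thesis
      unfolding etheta_def using convergent_prod_LIMSEQ LIMSEQ_lessThan_iff_atMost by blast
  qed
  ultimately have "etheta x p = infsetsum (\<lambda>k. jterm p x k / L) UNIV"
    using LIMSEQ_unique by auto
  also have "\<dots> = infsetsum (jterm p x) UNIV / L"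
    using abs_summable_jterm[OF p x] by (intro infsetsum_cdiv)
  finally show ?thesis using L by (simp add: L_def)
qed

section \<open>Rank two of theta products and the addition formula\<close>

lemma infsetsum_separable:
  fixes f :: "'a::countable \<Rightarrow> complex" and g :: "'b::countable \<Rightarrow> complex"
  assumes "asum (\<lambda>(i, j). f i * g j) (UNIV \<times> UNIV)" and "f a \<noteq> 0" and "g b \<noteq> 0"
  shows "infsetsum (\<lambda>(i, j). f i * g j) (UNIV \<times> UNIV) = infsetsum f UNIV * infsetsum g UNIV"
proof (rule infsetsum_product)
  \<comment> \<open>Summability of the two factors is extracted from the double family: its row
    through a is a nonzero multiple of \<open>g\<close>, and its column through b one of
    \<open>f\<close>.\<close>
  have "asum (\<lambda>j. f a * g j) UNIV"
    using Infinite_Set_Sum.abs_summable_on_Sigma_project2[OF assms(1), of a] by simp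
  then have "asum (\<lambda>j. 1 / f a * (f a * g j)) UNIV"
    by (rule Infinite_Set_Sum.abs_summable_on_cmult_right)
  then show "asum g UNIV" using assms(2) by simp
  have "asum (\<lambda>(j, i). f i * g j) (UNIV \<times> UNIV)"
    using assms(1) by (subst (asm) Infinite_Set_Sum.abs_summable_on_Times_swap) simp
  then have "asum (\<lambda>i. f i * g b) UNIV"
    using Infinite_Set_Sum.abs_summable_on_Sigma_project2[of "\<lambda>(j, i). f i * g j" UNIV "\<lambda>_. UNIV" b] by simp
  then have "asum (\<lambda>i. f i * g b * (1 / g b)) UNIV"
    by (rule Infinite_Set_Sum.abs_summable_on_cmult_left)
  then show "asum f UNIV" using assms(3) by simp
qed auto

text \<open>Splitting the double series for \<open>\<theta>(xy)\<theta>(x/y)\<close> by the parity of the exponent of \<open>x\<close>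
  separates the variables.\<close>

lemma etheta_product_rank2:
  assumes p: "norm p < 1"
  obtains A B C D where
    "\<And>x y. x \<noteq> 0 \<Longrightarrow> y \<noteq> 0 \<Longrightarrow> etheta (x * y) p * etheta (x / y) p = A x * B y + C x * D y"
proof
  \<comment> \<open>In the double series x carries the exponent m + n and y the exponent m - n.
    Writing (m, n) as (i + j, i - j) or (i + j + 1, i - j) turns these into 2i, 2j or 2i + 1, 2j +
    1, and the exponent of p into i^2 - i + j^2 or i^2 + j^2 + j. The sign of the odd part is put
    into \<open>D\<close>.\<close>
  define A where "A x i = p ^ nat (i * i - i) * x powi (2 * i)" for x i
  define B where "B y j = p ^ nat (j * j) * y powi (2 * j)" for y :: complex and j
  define C where "C x i = p ^ nat (i * i) * x powi (2 * i + 1)" for x i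
  define D where "D y j = - (p ^ nat (j * j + j) * y powi (2 * j + 1))" for y :: complex and j
  define L where "L = qpoch_inf p p"
  have L: "L \<noteq> 0"
    unfolding L_def by (rule qpoch_inf_nome_nz[OF p])
  fix x y :: complex
  assume x: "x \<noteq> 0" and y: "y \<noteq> 0"
  define f where "f = (\<lambda>(m, n). jterm p (x * y) m * jterm p (x / y) n)"
  define ev od :: "int \<times> int \<Rightarrow> int \<times> int" where
    "ev = (\<lambda>(i, j). (i + j, i - j))" and "od = (\<lambda>(i, j). (i + j + 1, i - j))"
  have f_sum: "asum f (UNIV \<times> UNIV)"
    unfolding f_def by (intro abs_summable_on_product abs_summable_jterm p) (use x y in auto)
  then have f_sub: "asum f Z" for Z
    by (rule Infinite_Set_Sum.abs_summable_on_subset) auto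
  have inj: "inj ev" "inj od"
    by (auto simp: inj_def ev_def od_def)
  have nn: "i * i - i \<ge> 0" "i * i + i \<ge> 0" for i :: int
  proof -
    have "i * (i - 1) \<ge> 0" by (cases "i \<ge> 1") (auto simp: mult_nonpos_nonpos)
    then show "i * i - i \<ge> 0" by (simp add: algebra_simps)
    have "i * (i + 1) \<ge> 0" by (cases "i \<ge> 0") (auto simp: mult_nonpos_nonpos)
    then show "i * i + i \<ge> 0" by (simp add: algebra_simps)
  qed
  have jt: "f (m, n) = (-1) powi (m + n) * p ^ nat (m * (m - 1) div 2 + n * (n - 1) div 2)
      * x powi (m + n) * y powi (m - n)" for m n
  proof -
    have "m * (m - 1) div 2 \<ge> 0" "n * (n - 1) div 2 \<ge> 0"
      using nn(1)[of m] nn(1)[of n] by (simp_all add: algebra_simps)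
    then have "p ^ nat (m * (m - 1) div 2 + n * (n - 1) div 2) =
        p ^ nat (m * (m - 1) div 2) * p ^ nat (n * (n - 1) div 2)"
      by (simp add: nat_add_distrib power_add)
    then show ?thesis
      using x y by (simp add: f_def jterm_def power_int_add power_int_diff power_int_mult_distrib
          power_int_divide_distrib)
  qed
  have e2: "k * (k - 1) div 2 + l * (l - 1) div 2 = (k * (k - 1) + l * (l - 1)) div 2" for k l :: int
    by (rule div_plus_div_distrib_dvd_left[symmetric]) simp
  have fev: "f (ev (i, j)) = A x i * B y j" for i j
  proof -
    have "(i + j) * (i + j - 1) + (i - j) * (i - j - 1) = 2 * ((i * i - i) + j * j)"
      by (simp add: algebra_simps)
    then have "p ^ nat ((i + j) * (i + j - 1) div 2 + (i - j) * (i - j - 1) div 2) =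
        p ^ nat (i * i - i) * p ^ nat (j * j)"
      unfolding e2 using nn[of i] by (simp add: nat_add_distrib power_add)
    moreover have "(-1 :: complex) powi (i + i) = 1"
      by (simp add: power_int_add flip: power_int_mult_distrib)
    ultimately show ?thesis
      unfolding ev_def A_def B_def jt prod.case by simp
  qed
  have fod: "f (od (i, j)) = C x i * D y j" for i j
  proof -
    have "(i + j + 1) * (i + j + 1 - 1) + (i - j) * (i - j - 1) = 2 * (i * i + (j * j + j))"
      by (simp add: algebra_simps)
    then have "p ^ nat ((i + j + 1) * (i + j + 1 - 1) div 2 + (i - j) * (i - j - 1) div 2) =
        p ^ nat (i * i) * p ^ nat (j * j + j)"
      unfolding e2 using nn[of j] by (simp add: nat_add_distrib power_add)
    moreover have "(-1 :: complex) powi (i + j + 1 + (i - j)) = -1"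
    proof -
      have "i + j + 1 + (i - j) = i + i + 1" by simp
      then show ?thesis by (simp only: power_int_add) (simp add: power_int_add flip: power_int_mult_distrib)
    qed
    moreover have "i + j + 1 + (i - j) = 2 * i + 1" "i + j + 1 - (i - j) = 2 * j + 1" by simp_all
    ultimately show ?thesis
      unfolding od_def C_def D_def jt prod.case by simp
  qed
  have "range ev \<inter> range od = {}"
  proof -
    have "ev (i, j) \<noteq> od (k, l)" for i j k l
    proof
      assume "ev (i, j) = od (k, l)"
      then have "2 * i = 2 * k + 1" by (auto simp: ev_def od_def)
      then show False by presburger
    qed
    then show ?thesis by (metis (no_types, lifting) disjoint_iff imageE prod.exhaust)
  qed
  moreover have "range ev \<union> range od = UNIV \<times> UNIV"
  proof -
    have "(m, n) \<in> range ev \<union> range od" for m n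
    proof (cases "even (m + n)")
      case True
      then have "(m, n) = ev ((m + n) div 2, (m - n) div 2)"
        unfolding ev_def by simp presburger
      then show ?thesis by blast
    next
      case False
      then have "(m, n) = od ((m + n) div 2, (m - n) div 2)"
        unfolding od_def by simp presburger
      then show ?thesis by blast
    qed
    then show ?thesis by auto
  qed
  ultimately have "infsetsum f (UNIV \<times> UNIV) = infsetsum f (range ev) + infsetsum f (range od)"
    using infsetsum_Un_disjoint[OF f_sub f_sub, of "range ev" "range od"] by simp
  also have "infsetsum f (range ev) = infsetsum (A x) UNIV * infsetsum (B y) UNIV"
  proof -
    have eq: "(\<lambda>z. f (ev z)) = (\<lambda>(i, j). A x i * B y j)" using fev by (auto simp: fun_eq_iff)
    have "asum (\<lambda>(i, j). A x i * B y j) UNIV"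
      unfolding eq[symmetric] by (subst Infinite_Set_Sum.abs_summable_on_reindex_iff[OF inj(1)]) (rule f_sub)
    then have "infsetsum (\<lambda>(i, j). A x i * B y j) UNIV = infsetsum (A x) UNIV * infsetsum (B y) UNIV"
      using infsetsum_separable[of "A x" "B y" 0 0] by (simp add: A_def B_def)
    then show ?thesis unfolding infsetsum_reindex[OF inj(1), of f] eq .
  qed
  also have "infsetsum f (range od) = infsetsum (C x) UNIV * infsetsum (D y) UNIV"
  proof -
    have eq: "(\<lambda>z. f (od z)) = (\<lambda>(i, j). C x i * D y j)" using fod by (auto simp: fun_eq_iff)
    have "asum (\<lambda>(i, j). C x i * D y j) UNIV"
      unfolding eq[symmetric] by (subst Infinite_Set_Sum.abs_summable_on_reindex_iff[OF inj(2)]) (rule f_sub)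
    then have "infsetsum (\<lambda>(i, j). C x i * D y j) UNIV = infsetsum (C x) UNIV * infsetsum (D y) UNIV"
      using infsetsum_separable[of "C x" "D y" 0 0] x y by (simp add: C_def D_def)
    then show ?thesis unfolding infsetsum_reindex[OF inj(2), of f] eq .
  qed
  also have "infsetsum f (UNIV \<times> UNIV) = (L * etheta (x * y) p) * (L * etheta (x / y) p)"
    unfolding f_def L_def using x y p
    by (subst infsetsum_product) (auto simp: jacobi_triple_product abs_summable_jterm)
  finally have *: "(L * etheta (x * y) p) * (L * etheta (x / y) p) =
      infsetsum (A x) UNIV * infsetsum (B y) UNIV + infsetsum (C x) UNIV * infsetsum (D y) UNIV" .
  show "etheta (x * y) p * etheta (x / y) p =
      (infsetsum (A x) UNIV / L\<^sup>2) * infsetsum (B y) UNIV + (infsetsum (C x) UNIV / L\<^sup>2) * infsetsum (D y) UNIV"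
  proof -
    have "etheta (x * y) p * etheta (x / y) p = ((L * etheta (x * y) p) * (L * etheta (x / y) p)) / L\<^sup>2"
      using L by (simp add: power2_eq_square)
    then show ?thesis unfolding * by (simp add: add_divide_distrib)
  qed
qed

text \<open>In an alternating 4 by 4 matrix a 3 by 3 minor that omits row i and column j, with i and
  j distinct, is up to sign the Pfaffian times the entry at the other two indices. Rank two kills
  these minors, so M 0 1, M 0 2 and M 0 3 all annihilate the Pfaffian; if all three entries are 0,
  each summand of the Pfaffian is 0.\<close>

lemma pfaffian_rank2:
  fixes M :: "nat \<Rightarrow> nat \<Rightarrow> complex"
  assumes rank: "\<And>i j. M i j = a i * b j + c i * d j" and alt: "\<And>i j. M j i = - M i j"
  shows "M 0 1 * M 2 3 - M 0 2 * M 1 3 + M 0 3 * M 1 2 = 0"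
proof -
  have diag: "M i i = 0" for i
    using alt[of i i] by simp
  have minor: "M i k * (M j l * M m n - M j n * M m l) - M i l * (M j k * M m n - M j n * M m k)
      + M i n * (M j k * M m l - M j l * M m k) = 0" for i j k l m n
    unfolding rank by algebra
  let ?P = "M 0 1 * M 2 3 - M 0 2 * M 1 3 + M 0 3 * M 1 2"
  have "M 0 1 * ?P = 0"
    using minor[of 0 0 1 1 2 3] alt[of 0 1] alt[of 0 2] alt[of 1 2] diag[of 0] diag[of 1] by algebra
  moreover have "M 0 2 * ?P = 0"
    using minor[of 0 0 1 2 2 3] alt[of 0 1] alt[of 0 2] alt[of 1 2] diag[of 0] diag[of 2] by algebra
  moreover have "M 0 3 * ?P = 0"
    using minor[of 0 0 1 2 3 3] alt[of 0 1] alt[of 0 3] alt[of 1 3] alt[of 2 3] diag[of 0] diag[of 3] by algebra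
  ultimately show ?thesis by auto
qed

lemma etheta_swap:
  assumes "norm p < 1" and "x \<noteq> 0" and "y \<noteq> 0"
  shows "etheta (y / x) p = - (y / x) * etheta (x / y) p"
  using etheta_inverse[OF assms(1), of "x / y"] assms by simp

text \<open>The Pfaffian of \<open>M\<close> at the four points x, y, u, v. The division by z i in
  \<open>M\<close> is what turns \<theta>(z_i z_j)\<theta>(z_i/z_j) into an alternating matrix
  without affecting its rank.\<close>

lemma etheta_addition:
  assumes p: "norm p < 1" and nz: "x \<noteq> 0" "y \<noteq> 0" "u \<noteq> 0" "v \<noteq> 0"
  shows "etheta (x * u) p * etheta (x / u) p * (etheta (y * v) p * etheta (y / v) p) =
    etheta (y * u) p * etheta (y / u) p * (etheta (x * v) p * etheta (x / v) p)
    - (y / v) * (etheta (v * u) p * etheta (v / u) p * (etheta (x * y) p * etheta (x / y) p))"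
proof -
  obtain A B C D where rank: "\<And>x y. x \<noteq> 0 \<Longrightarrow> y \<noteq> 0 \<Longrightarrow>
      etheta (x * y) p * etheta (x / y) p = A x * B y + C x * D y"
    using etheta_product_rank2[OF p] by blast
  define z :: "nat \<Rightarrow> complex" where "z i = (if i = 0 then x else if i = 1 then y else if i = 2 then u else v)" for i
  have z: "z i \<noteq> 0" for i using nz by (simp add: z_def)
  define M where "M i j = etheta (z i * z j) p * etheta (z i / z j) p / z i" for i j
  have "M 0 1 * M 2 3 - M 0 2 * M 1 3 + M 0 3 * M 1 2 = 0"
  proof (rule pfaffian_rank2)
    show "M i j = A (z i) / z i * B (z j) + C (z i) / z i * D (z j)" for i j
      unfolding M_def rank[OF z z] by (simp add: add_divide_distrib)
    show "M j i = - M i j" for i j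
      using etheta_swap[OF p z z, of i j] z[of i] z[of j] by (simp add: M_def mult.commute)
  qed
  moreover have "M 2 3 = - etheta (v * u) p * etheta (v / u) p / v"
    using etheta_swap[OF p, of v u] nz by (simp add: M_def z_def mult.commute)
  moreover have "M 1 2 = etheta (y * u) p * etheta (y / u) p / y" "M 0 3 = etheta (x * v) p * etheta (x / v) p / x"
    "M 0 1 = etheta (x * y) p * etheta (x / y) p / x" "M 0 2 = etheta (x * u) p * etheta (x / u) p / x"
    "M 1 3 = etheta (y * v) p * etheta (y / v) p / y"
    by (simp_all add: M_def z_def)
  ultimately have "etheta (x * y) p * etheta (x / y) p / x * (- etheta (v * u) p * etheta (v / u) p / v)
      - etheta (x * u) p * etheta (x / u) p / x * (etheta (y * v) p * etheta (y / v) p / y)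
      + etheta (x * v) p * etheta (x / v) p / x * (etheta (y * u) p * etheta (y / u) p / y) = 0"
    by (simp only: )
  moreover have "a / x * (- b / v) - c / x * (d / y) + e / x * (f / y) = 0 \<Longrightarrow> c * d = f * e - (y / v) * (b * a)"
    for a b c d e f
    using nz by (simp add: field_simps)
  ultimately show ?thesis
    by (metis (no_types, lifting) mult.assoc mult_minus_left)
qed

text \<open>The addition formula at u/s, y/s, z1/s, w/s, where s is a square root of z1 z2: then
  (u/s)(z1/s) = u/z2 and (u/s)/(z1/s) = u/z1. In this form the factors are theta functions of u with
  prescribed zeros, as interpolation requires.\<close>

lemma etheta_three_term:
  assumes p: "norm p < 1" and nz: "u \<noteq> 0" "y \<noteq> 0" "w \<noteq> 0" "z1 \<noteq> 0" "z2 \<noteq> 0"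
  shows "etheta (u / z1) p * etheta (u / z2) p * (etheta (y / w) p * etheta (y * w / (z1 * z2)) p) =
    etheta (y / z1) p * etheta (y / z2) p * (etheta (u / w) p * etheta (u * w / (z1 * z2)) p)
    - (y / w) * (etheta (w / z1) p * etheta (w / z2) p * (etheta (u / y) p * etheta (u * y / (z1 * z2)) p))"
proof -
  define s where "s = csqrt (z1 * z2)"
  have s2: "z1 * z2 = s * s" by (simp add: s_def flip: power2_eq_square)
  then have s: "s \<noteq> 0" using nz by auto
  have *: "a / s * (z1 / s) = a / z2" for a
    using s nz by (simp add: divide_simps) (metis mult.commute mult.left_commute s2)
  have **: "a / s / (z1 / s) = a / z1" "a / s * (b / s) = a * b / (z1 * z2)" "a / s / (b / s) = a / b" for a b
    using s nz by (simp_all add: s2)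
  have "y / s / (w / s) = y / w" using s by simp
  then show ?thesis
    using etheta_addition[OF p, of "u / s" "y / s" "z1 / s" "w / s"] s nz
    unfolding * ** by (simp add: mult_ac)
qed

section \<open>The zeros of the theta function\<close>

lemma etheta_shift_nome:
  assumes "norm p < 1" and "p \<noteq> 0" and "x \<noteq> 0"
  shows "etheta (p * x) p = - etheta x p / x"
proof -
  have "p / (p * x) = 1 / x" using assms(2) by simp
  moreover have "qpoch_inf (1 / x) p = (1 - 1 / x) * qpoch_inf (p / x) p"
    using qpoch_inf_rec[OF assms(1), of "1 / x"] by simp
  ultimately have "etheta (p * x) p = qpoch_inf (p * x) p * ((1 - 1 / x) * qpoch_inf (p / x) p)"
    by (simp only: etheta_eq_qpoch[OF assms(1)])
  moreover have "etheta x p = (1 - x) * qpoch_inf (p * x) p * qpoch_inf (p / x) p"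
    using qpoch_inf_rec[OF assms(1), of x] by (simp add: etheta_eq_qpoch[OF assms(1)])
  moreover have "A * ((1 - 1 / x) * B) = - ((1 - x) * A * B) / x" for A B
    using assms(3) by (simp add: divide_inverse algebra_simps)
  ultimately show ?thesis by (simp only: )
qed

lemma etheta_eq_0_iff:
  assumes p: "norm p < 1" and x: "x \<noteq> 0"
  shows "etheta x p = 0 \<longleftrightarrow> (if p = 0 then x = 1 else \<exists>k::int. x = p powi k)"
proof (cases "p = 0")
  case True
  then show ?thesis
    using etheta_eq_0D[OF p, of x] etheta_one[OF p] x by (auto simp: power_0_left split: if_splits)
next
  case False
  have "etheta (p powi k) p = 0" for k :: int
  proof (induction k rule: int_induct[of _ 0])
    case base
    then show ?case by (simp add: etheta_one p)
  next
    case (step1 i)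
    then show ?case
      using etheta_shift_nome[OF p False, of "p powi i"] False by (simp add: power_int_add mult.commute)
  next
    case (step2 i)
    have "p * p powi (i - 1) = p powi i" using False by (simp add: power_int_diff)
    then show ?case
      using etheta_shift_nome[OF p False, of "p powi (i - 1)"] False step2 by simp
  qed
  moreover have "\<exists>k::int. x = p powi k" if "etheta x p = 0"
  proof -
    obtain j where "p ^ j * x = 1 \<or> p ^ Suc j = x"
      using etheta_eq_0D[OF p \<open>etheta x p = 0\<close>] by blast
    then show ?thesis
    proof
      assume "p ^ j * x = 1"
      then have "x = p powi (- int j)" using False by (simp add: power_int_minus field_simps)
      then show ?thesis by blast
    next
      assume "p ^ Suc j = x"
      then have "x = p powi int (Suc j)" by (simp only: power_int_of_nat)
      then show ?thesis by blast
    qed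
  qed
  ultimately show ?thesis using False by auto
qed

text \<open>The zeros form the multiplicative group p^Z, or the trivial group if p = 0, and a group
  is closed under quotients.\<close>

lemma etheta_zero_divide:
  assumes "norm p < 1" "a \<noteq> 0" "b \<noteq> 0" "etheta a p = 0" "etheta b p = 0"
  shows "etheta (a / b) p = 0"
proof -
  have "a / b \<noteq> 0" using assms by simp
  moreover have "if p = 0 then a / b = 1 else \<exists>k::int. a / b = p powi k"
    using assms etheta_eq_0_iff[OF assms(1,2)] etheta_eq_0_iff[OF assms(1,3)]
    by (auto split: if_splits) (metis power_int_diff)
  ultimately show ?thesis
    using etheta_eq_0_iff[OF assms(1)] by blast
qed

section \<open>Interpolation by theta products\<close>

text \<open>The span of the products \<open>\<theta>(u/z\<^sub>1) \<cdots> \<theta>(u/z\<^sub>m)\<close> with \<open>z\<^sub>1 \<cdots> z\<^sub>m = C\<close>.\<close>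

inductive tspan :: "complex \<Rightarrow> nat \<Rightarrow> complex \<Rightarrow> (complex \<Rightarrow> complex) \<Rightarrow> bool" for p where
  tspan_one: "z \<noteq> 0 \<Longrightarrow> tspan p 1 z (\<lambda>u. etheta (u / z) p)"
| tspan_mult: "tspan p m C f \<Longrightarrow> z \<noteq> 0 \<Longrightarrow> tspan p (Suc m) (z * C) (\<lambda>u. etheta (u / z) p * f u)"
| tspan_add: "tspan p m C f \<Longrightarrow> tspan p m C g \<Longrightarrow> tspan p m C (\<lambda>u. f u + g u)"
| tspan_scale: "tspan p m C f \<Longrightarrow> tspan p m C (\<lambda>u. c * f u)"
| tspan_ext: "tspan p m C f \<Longrightarrow> (\<And>u. u \<noteq> 0 \<Longrightarrow> f u = g u) \<Longrightarrow> tspan p m C g"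

lemma tspan_nz: "tspan p m C f \<Longrightarrow> C \<noteq> 0 \<and> m \<ge> 1"
  by (induction rule: tspan.induct) auto

text \<open>The Lagrange kernel for theta products. The factor with argument u times the other nodes
  over C is there to make the zeros in u multiply to C; its value at u = y explains why the product
  of all nodes over C must not be a zero of \<theta>.\<close>

definition lagrange :: "complex \<Rightarrow> complex \<Rightarrow> complex set \<Rightarrow> complex \<Rightarrow> complex \<Rightarrow> complex" where
  "lagrange p C Y y u = etheta (u * \<Prod>(Y - {y}) / C) p / etheta (\<Prod>Y / C) p
     * (\<Prod>y'\<in>Y - {y}. etheta (u / y') p / etheta (y / y') p)"

text \<open>Induction over the generation of the span; only multiplication by \<theta>(u/z) needs
  work. One node \<open>y0\<close> is dropped to apply the hypothesis to f, and the three-term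
  relation writes \<theta>(u/z) times an old kernel as a combination of the new kernels of y and
  \<open>y0\<close>. The contributions of \<open>y0\<close> then sum to f y0, again by the
  hypothesis, at u = y0.\<close>

lemma tspan_interpolation:
  assumes "tspan p m C f" and p: "norm p < 1"
    and "finite Y" "card Y = m" "0 \<notin> Y"
    and "\<And>y y'. y \<in> Y \<Longrightarrow> y' \<in> Y \<Longrightarrow> y \<noteq> y' \<Longrightarrow> etheta (y / y') p \<noteq> 0"
    and "etheta (\<Prod>Y / C) p \<noteq> 0" and "u \<noteq> 0"
  shows "f u = (\<Sum>y\<in>Y. f y * lagrange p C Y y u)"
  using assms(1,3-)
proof (induction arbitrary: Y u rule: tspan.induct)
  case (tspan_one z)
  then obtain y where "Y = {y}" by (auto simp: card_1_singleton_iff)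
  then show ?case using tspan_one by (simp add: lagrange_def)
next
  case (tspan_mult m C f z)
  have C: "C \<noteq> 0" "m \<ge> 1" using tspan_nz[OF tspan_mult.hyps(1)] by auto
  have Ynz: "y \<noteq> 0" if "y \<in> Y" for y using that tspan_mult.prems(3) by metis
  have PY: "\<Prod>Y \<noteq> 0" using tspan_mult.prems(1,3) by simp
  \<comment> \<open>The remaining nodes must again satisfy the product condition. Of any two
    candidates one works: otherwise the quotient y2/y1 of two distinct nodes would be a zero of
    \<theta>.\<close>
  obtain y0 where y0: "y0 \<in> Y" "etheta (\<Prod>(Y - {y0}) / C) p \<noteq> 0"
  proof -
    have "card Y \<ge> 2" using tspan_mult.prems(2) C by simp
    then obtain y1 y2 where y: "y1 \<in> Y" "y2 \<in> Y" "y1 \<noteq> y2"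
      by (meson card_2_iff' obtain_subset_with_card_n subsetD)
    have P: "\<Prod>(Y - {y}) = \<Prod>Y / y" if "y \<in> Y" for y
      using that tspan_mult.prems(1) Ynz[OF that] by (simp add: prod_diff1)
    have "\<not> (etheta (\<Prod>(Y - {y1}) / C) p = 0 \<and> etheta (\<Prod>(Y - {y2}) / C) p = 0)"
    proof
      assume "etheta (\<Prod>(Y - {y1}) / C) p = 0 \<and> etheta (\<Prod>(Y - {y2}) / C) p = 0"
      then have e: "etheta (\<Prod>Y / y1 / C) p = 0" "etheta (\<Prod>Y / y2 / C) p = 0"
        using P[OF y(1)] P[OF y(2)] by simp_all
      have "\<Prod>Y / y1 / C \<noteq> 0" "\<Prod>Y / y2 / C \<noteq> 0"
        using y C PY Ynz[OF y(1)] Ynz[OF y(2)] by simp_all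
      then have "etheta (\<Prod>Y / y1 / C / (\<Prod>Y / y2 / C)) p = 0"
        by (rule etheta_zero_divide[OF p _ _ e])
      moreover have "\<Prod>Y / y1 / C / (\<Prod>Y / y2 / C) = y2 / y1"
        using C PY by simp
      ultimately show False using tspan_mult.prems(4)[OF y(2) y(1)] y(3) by metis
    qed
    then show ?thesis using that[OF y(1)] that[OF y(2)] by argo
  qed
  define Y' where "Y' = Y - {y0}"
  have Y': "finite Y'" "card Y' = m" "0 \<notin> Y'" "y0 \<notin> Y'" "Y = insert y0 Y'"
    using tspan_mult.prems(1-3) y0(1) by (auto simp: Y'_def)
  have IH: "f v = (\<Sum>y\<in>Y'. f y * lagrange p C Y' y v)" if "v \<noteq> 0" for v
  proof (rule tspan_mult.IH[OF Y'(1-3) _ _ that])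
    show "etheta (y / y') p \<noteq> 0" if "y \<in> Y'" "y' \<in> Y'" "y \<noteq> y'" for y y'
      using tspan_mult.prems(4)[of y y'] that Y'(5) by simp
    show "etheta (\<Prod>Y' / C) p \<noteq> 0" using y0(2) by (simp add: Y'_def)
  qed
  define K where "K = \<Prod>Y'"
  have K: "K \<noteq> 0" "\<Prod>Y = y0 * K" using Y' by (auto simp: K_def prod_zero_iff)
  have y0nz: "y0 \<noteq> 0" using Ynz[OF y0(1)] .
  have dC': "etheta (y0 * K / (z * C)) p \<noteq> 0" using tspan_mult.prems(5) K(2) by simp
  have dC: "etheta (K / C) p \<noteq> 0" using y0(2) by (simp add: K_def Y'_def)
  let ?R = "\<lambda>v. \<Prod>y'\<in>Y'. etheta (v / y') p"
  have R0: "?R y0 \<noteq> 0"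
  proof -
    have "etheta (y0 / y') p \<noteq> 0" if "y' \<in> Y'" for y'
      using tspan_mult.prems(4)[OF y0(1), of y'] that Y' by auto
    then show ?thesis using Y'(1) by simp
  qed
  have L0: "lagrange p (z * C) Y y0 u = etheta (u * K / (z * C)) p / etheta (y0 * K / (z * C)) p * (?R u / ?R y0)"
    unfolding lagrange_def K(2) using Y' by (simp add: K_def prod_dividef)
  have main: "etheta (u / z) p * lagrange p C Y' y u =
      etheta (y / z) p * lagrange p (z * C) Y y u
      + etheta (y0 / z) p * lagrange p C Y' y y0 * lagrange p (z * C) Y y0 u" if y: "y \<in> Y'" for y
  proof -
    have yn: "y \<noteq> 0" "y \<noteq> y0" using y Y' by auto
    define k where "k = \<Prod>(Y' - {y})"
    have k: "k \<noteq> 0" "K = y * k"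
      using Y' y by (auto simp: k_def K_def prod_zero_iff prod.remove)
    have Yy: "Y - {y} = insert y0 (Y' - {y})" using Y' yn by auto
    have PYy: "\<Prod>(Y - {y}) = y0 * k"
      unfolding Yy using Y' by (simp add: k_def)
    let ?r = "\<lambda>v. \<Prod>y'\<in>Y' - {y}. etheta (v / y') p"
    have r: "?R v = etheta (v / y) p * ?r v" for v
      using Y' y by (simp add: prod.remove)
    have ry: "?r y \<noteq> 0"
    proof -
      have "etheta (y / y') p \<noteq> 0" if "y' \<in> Y' - {y}" for y'
        using tspan_mult.prems(4)[of y y'] that y Y' by auto
      then show ?thesis using Y'(1) by simp
    qed
    have r0: "?r y0 \<noteq> 0" "etheta (y0 / y) p \<noteq> 0" using R0 unfolding r by auto
    have yy0: "etheta (y / y0) p \<noteq> 0" using tspan_mult.prems(4)[of y y0] y y0(1) yn(2) Y'(5) by simp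
    have sw: "etheta (y0 / y) p = - (y0 / y) * etheta (y / y0) p"
      by (rule etheta_swap[OF p]) (use yn y0nz in auto)
    have La: "lagrange p C Y' y v = etheta (v * k / C) p / etheta (K / C) p * (?r v / ?r y)" for v
      unfolding lagrange_def by (simp add: k_def K_def prod_dividef)
    have Lb: "lagrange p (z * C) Y y u = etheta (u * (y0 * k) / (z * C)) p / etheta (y0 * K / (z * C)) p
        * (etheta (u / y0) p / etheta (y / y0) p * (?r u / ?r y))"
      unfolding lagrange_def K(2) PYy unfolding Yy using Y' by (simp add: prod_dividef)
    \<comment> \<open>The auxiliary factor of the old kernel of y has its zero at C/k. This zero is
      taken as z2, with z as z1 and \<open>y0\<close> as w.\<close>
    have T: "etheta (u / z) p * etheta (u / (C / k)) p * (etheta (y / y0) p * etheta (y * y0 / (z * (C / k))) p) =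
      etheta (y / z) p * etheta (y / (C / k)) p * (etheta (u / y0) p * etheta (u * y0 / (z * (C / k))) p)
      - (y / y0) * (etheta (y0 / z) p * etheta (y0 / (C / k)) p * (etheta (u / y) p * etheta (u * y / (z * (C / k))) p))"
      by (rule etheta_three_term[OF p]) (use tspan_mult.prems(6) yn(1) y0nz tspan_mult.hyps(2) C(1) k(1) in auto)
    have simps: "u / (C / k) = u * k / C" "y / (C / k) = K / C" "y0 / (C / k) = y0 * k / C"
      "y * y0 / (z * (C / k)) = y0 * K / (z * C)" "u * y0 / (z * (C / k)) = u * (y0 * k) / (z * C)"
      "u * y / (z * (C / k)) = u * K / (z * C)"
      using k by (simp_all add: mult_ac)
    have alg: "tz * (tu / tK * (ru / ry)) = tyz * (tuy / tC' * (tu0 / t0 * (ru / ry)))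
        + t0z * (t0k / tK * (r0 / ry)) * (tuK / tC' * (tu1 * ru / (t1 * r0)))"
      if T: "tz * tu * (t0 * tC') = tyz * tK * (tu0 * tuy) - (y / y0) * (t0z * t0k * (tu1 * tuK))"
       and t1: "t1 = - (y0 / y) * t0" and nz: "t0 \<noteq> 0" "tC' \<noteq> 0" "tK \<noteq> 0" "ry \<noteq> 0" "r0 \<noteq> 0"
      for tz tu tK ru ry tyz tuy tC' tu0 t0 t0z t0k r0 tuK tu1 t1 :: complex
    proof -
      have "tz * tu = (tyz * tK * (tu0 * tuy) - (y / y0) * (t0z * t0k * (tu1 * tuK))) / (t0 * tC')"
        using T nz by (simp add: field_simps)
      then have "tz * (tu / tK * (ru / ry)) =
          (tyz * tK * (tu0 * tuy) - (y / y0) * (t0z * t0k * (tu1 * tuK))) / (t0 * tC') / tK * (ru / ry)"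
        by (metis mult.assoc times_divide_eq_right)
      also have "\<dots> = tyz * (tuy / tC' * (tu0 / t0 * (ru / ry))) + (- (y / y0)) / t0 * (t0z * t0k * (tu1 * tuK)) / (tC' * tK) * (ru / ry)"
        using nz by (simp add: divide_simps) (simp add: algebra_simps)
      also have "(- (y / y0)) / t0 = 1 / t1"
        using nz yn y0nz by (simp add: t1 field_simps)
      finally show ?thesis using nz by (simp add: field_simps)
    qed
    show ?thesis
      unfolding La Lb L0 r[of u] r[of y0]
      by (rule alg[OF T[unfolded simps] sw yy0 dC' dC ry r0(1)])
  qed
  have "etheta (u / z) p * f u = (\<Sum>y\<in>Y'. f y * (etheta (u / z) p * lagrange p C Y' y u))"
    by (subst IH[OF tspan_mult.prems(6)]) (simp add: sum_distrib_left mult_ac)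
  also have "\<dots> = (\<Sum>y\<in>Y'. f y * (etheta (y / z) p * lagrange p (z * C) Y y u)
      + etheta (y0 / z) p * lagrange p (z * C) Y y0 u * (f y * lagrange p C Y' y y0))"
    by (rule sum.cong[OF refl], subst main) (simp_all add: algebra_simps)
  also have "\<dots> = (\<Sum>y\<in>Y'. etheta (y / z) p * f y * lagrange p (z * C) Y y u)
      + etheta (y0 / z) p * lagrange p (z * C) Y y0 u * f y0"
    unfolding IH[OF y0nz] by (simp add: sum.distrib sum_distrib_left mult_ac)
  also have "\<dots> = (\<Sum>y\<in>Y. etheta (y / z) p * f y * lagrange p (z * C) Y y u)"
    using Y' by (simp add: mult_ac)
  finally show ?case .
next
  case (tspan_add m C f g)
  then show ?case by (simp add: distrib_right sum.distrib)
next
  case (tspan_scale m C f c)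
  then show ?case by (simp add: sum_distrib_left mult.assoc)
next
  case (tspan_ext m C f g)
  then have "f y = g y" if "y \<in> Y" for y using that by metis
  then show ?case using tspan_ext.IH[OF tspan_ext.prems] tspan_ext.hyps(2)[OF tspan_ext.prems(6)] by simp
qed

corollary tspan_eq_0:
  assumes "tspan p m C f" and "norm p < 1" and "finite Y" "card Y = m" "0 \<notin> Y"
    and "\<And>y y'. y \<in> Y \<Longrightarrow> y' \<in> Y \<Longrightarrow> y \<noteq> y' \<Longrightarrow> etheta (y / y') p \<noteq> 0"
    and "etheta (\<Prod>Y / C) p \<noteq> 0" and "u \<noteq> 0" and "\<And>y. y \<in> Y \<Longrightarrow> f y = 0"
  shows "f u = 0"
  by (subst tspan_interpolation[OF assms(1-8)]) (auto simp: assms(9))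

lemma tspan_sum:
  assumes "finite A" "A \<noteq> {}" "\<And>i. i \<in> A \<Longrightarrow> tspan p m C (f i)"
  shows "tspan p m C (\<lambda>u. \<Sum>i\<in>A. f i u)"
  using assms by (induction rule: finite_ne_induct) (auto intro: tspan_add)

lemma tspan_prod:
  assumes "finite A" "tspan p m C f" "\<And>i. i \<in> A \<Longrightarrow> z i \<noteq> 0"
  shows "tspan p (card A + m) ((\<Prod>i\<in>A. z i) * C) (\<lambda>u. (\<Prod>i\<in>A. etheta (u / z i) p) * f u)"
  using assms
proof (induction rule: finite_induct)
  case (insert i A)
  then show ?case
    using tspan_mult[OF insert.IH, of "z i"] by (simp add: mult.assoc)
qed simp

section \<open>The identity for sums over subsets\<close>

text \<open>The common shape of every term after clearing poles: two separate zeros and two families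
  of zeros, one for each side of the subset.\<close>

lemma tspan_prod2:
  assumes "z1 \<noteq> 0" "z2 \<noteq> 0" "finite A" "finite B" "\<And>i. i \<in> A \<Longrightarrow> z i \<noteq> 0" "\<And>i. i \<in> B \<Longrightarrow> w i \<noteq> 0"
  shows "tspan p (card A + card B + 2) ((\<Prod>i\<in>A. z i) * (\<Prod>i\<in>B. w i) * (z1 * z2))
    (\<lambda>v. c * (etheta (v / z1) p * etheta (v / z2) p * (\<Prod>i\<in>A. etheta (v / z i) p) * (\<Prod>i\<in>B. etheta (v / w i) p)))"
proof -
  have "tspan p (Suc 1) (z1 * z2) (\<lambda>v. etheta (v / z1) p * etheta (v / z2) p)"
    by (intro tspan_mult tspan_one assms)
  then have "tspan p (card A + (card B + Suc 1)) ((\<Prod>i\<in>A. z i) * ((\<Prod>i\<in>B. w i) * (z1 * z2)))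
     (\<lambda>v. (\<Prod>i\<in>A. etheta (v / z i) p) * ((\<Prod>i\<in>B. etheta (v / w i) p) * (etheta (v / z1) p * etheta (v / z2) p)))"
    by (intro tspan_prod assms)
  from tspan_scale[OF this, of c] show ?thesis
    by (simp add: mult_ac)
qed

lemma prod_even_odd:
  fixes f :: "nat \<Rightarrow> 'a::comm_monoid_mult"
  shows "(\<Prod>e<2 * N. f e) = (\<Prod>j<N. f (2 * j) * f (2 * j + 1))"
  by (induction N) (simp_all add: mult_ac)

lemma two_choose_2: "2 * int (n choose 2) = int n * int n - int n"
  by (induction n) (simp_all add: numeral_2_eq_2 algebra_simps)

lemma down_closed_eq_lessThan:
  fixes A :: "nat set"
  assumes "finite A" "\<And>n. Suc n \<in> A \<Longrightarrow> n \<in> A"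
  shows "A = {..<card A}"
proof -
  obtain k where k: "k \<notin> A" using ex_new_if_finite[OF infinite_UNIV_nat assms(1)] by auto
  define l where "l = (LEAST k. k \<notin> A)"
  have l: "l \<notin> A" unfolding l_def by (rule LeastI[of _ k]) (rule k)
  have "n \<in> A" if "n < l" for n using not_less_Least[of n "\<lambda>k. k \<notin> A"] that l_def by auto
  moreover have "n \<notin> A" if "n \<ge> l" for n
    using that
  proof (induction n rule: dec_induct)
    case (step n)
    then show ?case using assms(2) by blast
  qed (rule l)
  ultimately have "A = {..<l}" by (meson lessThan_iff linorder_not_less subsetI subset_antisym)
  then show ?thesis by simp
qed

text \<open>A nonzero value would persist on a ball, and a countable set contains no ball, even if
  it is dense.\<close>

lemma continuous_eq_0_off_countable:
  fixes f :: "complex \<Rightarrow> complex"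
  assumes cont: "continuous_on (- {0}) f" and B: "countable B"
    and zero: "\<And>t. t \<noteq> 0 \<Longrightarrow> t \<notin> B \<Longrightarrow> f t = 0" and w: "w \<noteq> 0"
  shows "f w = 0"
proof (rule ccontr)
  assume fw: "f w \<noteq> 0"
  have "open ((- {0}) \<inter> f -` (- {0}))"
    by (rule continuous_open_preimage[OF cont]) auto
  moreover have "w \<in> (- {0}) \<inter> f -` (- {0})" using fw w by simp
  ultimately obtain e where e: "e > 0" "ball w e \<subseteq> (- {0}) \<inter> f -` (- {0})"
    by (meson open_contains_ball)
  have "ball w e \<subseteq> B" using e(2) zero by (auto simp: subset_iff)
  then have "countable (ball w e)" using B countable_subset by blast
  then show False using uncountable_ball[OF e(1)] by blast
qed

lemma continuous_on_eshift:
  assumes "norm p < 1" and "continuous_on X f" and "\<And>t. t \<in> X \<Longrightarrow> f t \<noteq> 0" and "Q \<noteq> 0"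
  shows "continuous_on X (\<lambda>t. eshift (f t) Q p k)"
  unfolding eshift_def
  by (intro continuous_on_prod continuous_on_etheta assms continuous_intros) (use assms in auto)

lemma prod_square_pairs:
  fixes f :: "nat \<Rightarrow> nat \<Rightarrow> 'a::comm_monoid_mult"
  shows "(\<Prod>i=1..r. \<Prod>j=1..r. f i j) = (\<Prod>i=1..r. f i i) * (\<Prod>i=1..r. \<Prod>j\<in>{i<..r}. f i j * f j i)"
proof (induction r)
  case (Suc r)
  have "(\<Prod>i=1..Suc r. \<Prod>j=1..Suc r. f i j) =
      (\<Prod>i=1..r. (\<Prod>j=1..r. f i j) * f i (Suc r)) * ((\<Prod>j=1..r. f (Suc r) j) * f (Suc r) (Suc r))"
    by simp
  also have "\<dots> = (\<Prod>i=1..r. f i i) * f (Suc r) (Suc r) *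
      ((\<Prod>i=1..r. \<Prod>j\<in>{i<..r}. f i j * f j i) * (\<Prod>i=1..r. f i (Suc r) * f (Suc r) i))"
    using Suc by (simp add: prod.distrib mult_ac)
  also have "(\<Prod>i=1..r. \<Prod>j\<in>{i<..r}. f i j * f j i) * (\<Prod>i=1..r. f i (Suc r) * f (Suc r) i)
      = (\<Prod>i=1..r. \<Prod>j\<in>{i<..Suc r}. f i j * f j i)"
    unfolding prod.distrib[symmetric]
  proof (rule prod.cong[OF refl])
    fix i assume "i \<in> {1..r}"
    then have "{i<..Suc r} = insert (Suc r) {i<..r}" by auto
    then show "(\<Prod>j\<in>{i<..r}. f i j * f j i) * (f i (Suc r) * f (Suc r) i) = (\<Prod>j\<in>{i<..Suc r}. f i j * f j i)"
      by (simp add: mult.commute)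
  qed
  finally show ?case by simp
qed simp

lemma sum_square_pairs:
  fixes k :: "nat \<Rightarrow> nat"
  shows "(wt r k)\<^sup>2 = (\<Sum>i=1..r. (k i)\<^sup>2) + 2 * e2 r k"
proof (induction r)
  case (Suc r)
  have "e2 (Suc r) k = (\<Sum>i=1..r. \<Sum>j\<in>{i<..Suc r}. k i * k j)" by (simp add: e2_def)
  also have "\<dots> = (\<Sum>i=1..r. (\<Sum>j\<in>{i<..r}. k i * k j) + k i * k (Suc r))"
  proof (rule sum.cong[OF refl])
    fix i assume "i \<in> {1..r}"
    then have "{i<..Suc r} = insert (Suc r) {i<..r}" by auto
    then show "(\<Sum>j\<in>{i<..Suc r}. k i * k j) = (\<Sum>j\<in>{i<..r}. k i * k j) + k i * k (Suc r)"
      by simp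
  qed
  also have "\<dots> = e2 r k + wt r k * k (Suc r)"
    by (simp add: e2_def wt_def sum.distrib sum_distrib_right)
  finally have "e2 (Suc r) k = e2 r k + wt r k * k (Suc r)" .
  moreover have "wt (Suc r) k = wt r k + k (Suc r)" by (simp add: wt_def)
  ultimately show ?case using Suc by (simp add: power2_eq_square algebra_simps)
qed (simp add: wt_def e2_def)

lemma prod_telescope_interval:
  fixes g :: "nat \<Rightarrow> complex"
  assumes "k \<le> n" "\<And>m. k \<le> m \<Longrightarrow> m \<le> n \<Longrightarrow> g m \<noteq> 0"
  shows "(\<Prod>m\<in>{k..<n}. g (Suc m) / g m) = g n / g k"
  using assms
proof (induction n rule: dec_induct)
  case (step n)
  then have "g n \<noteq> 0" by simp
  then show ?case using step by simp
qed simp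

lemma prod_SigmaI: "finite A \<Longrightarrow> (\<And>x. x \<in> A \<Longrightarrow> finite (B x)) \<Longrightarrow> (\<Prod>z\<in>Sigma A B. F z) = (\<Prod>x\<in>A. \<Prod>y\<in>B x. F (x, y))"
  by (simp add: prod.Sigma)

lemma eshift_0 [simp]: "eshift a q p 0 = 1"
  by (simp add: eshift_def)

lemma eshift_Suc: "eshift a q p (Suc k) = eshift a q p k * etheta (a * q ^ k) p"
  by (simp add: eshift_def)

lemma eshift_add: "eshift a q p (m + n) = eshift a q p m * eshift (a * q ^ m) q p n"
  by (induction n) (simp_all add: eshift_Suc power_add mult.assoc)

text \<open>Genericity of q is phrased through theta, which treats p = 0 and the other values of p
  alike, and for exponents of both signs.\<close>

locale elliptic_nome =
  fixes p q :: complex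
  assumes norm_p: "norm p < 1" and q_nz: "q \<noteq> 0"
    and q_generic: "\<And>k::int. k \<noteq> 0 \<Longrightarrow> etheta (q powi k) p \<noteq> 0"
begin

abbreviation th :: "complex \<Rightarrow> complex" ("\<theta>") where
  "\<theta> x \<equiv> etheta x p"

text \<open>The case \<open>n\<^sub>i = 1\<close> of the sum, with \<open>u\<^sub>i = d/(a x\<^sub>i)\<close>, is a sum over the subsets \<open>S\<close> of
  the index set \<open>I\<close>. Its summand, cleared of the denominators that do not depend on \<open>S\<close>, is
  \<open>subset_term\<close>.\<close>

definition vfac :: "complex \<Rightarrow> complex \<Rightarrow> complex" where
  "vfac x y = \<theta> (q\<^sup>2 * x / y) / \<theta> (x / y)"

text \<open>What an index with k_i = 0 contributes once its denominator is cleared;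
  \<open>in_fac\<close> is the counterpart for k_i = 1. There a q^(2N+1)/x stands for c x_i by the
  balancing condition, so c and d occur only through the u_i.\<close>

definition out_fac :: "nat \<Rightarrow> complex \<Rightarrow> complex" where
  "out_fac K x = \<theta> (x * q ^ K / q) * \<theta> (x * q ^ K / q\<^sup>2)"

definition in_fac :: "complex \<Rightarrow> nat \<Rightarrow> nat \<Rightarrow> complex \<Rightarrow> complex" where
  "in_fac a N K x = x * \<theta> (a * q ^ (2 * N + 1) / x) * \<theta> (a * x * q ^ (2 * K) / q\<^sup>2)"

text \<open>The part of the summand that depends on S only through its size. A denominator of length
  K, multiplied by the same shifted factorial of length N, leaves a tail of N - K factors. The power
  of q collects q^(|k| - e2) and the monomials from reflections and Vandermonde factors.\<close>

definition subset_coeff :: "complex \<Rightarrow> complex \<Rightarrow> nat \<Rightarrow> nat \<Rightarrow> complex" where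
  "subset_coeff a b N K = q powi (3 * int (K choose 2) - 2 * int N * int K)
     * eshift a q p K * eshift (a * q ^ (2 * N + 1 + K)) q p (N - K) * \<theta> (a * q ^ (3 * K))
     * eshift b q p K * eshift (q / b) q p K
     * eshift (a * q ^ (2 + 2 * K) / b) (q\<^sup>2) p (N - K) * eshift (a * b * q ^ (1 + 2 * K)) (q\<^sup>2) p (N - K)"

definition subset_term :: "complex \<Rightarrow> complex \<Rightarrow> ('i \<Rightarrow> complex) \<Rightarrow> 'i set \<Rightarrow> 'i set \<Rightarrow> complex" where
  "subset_term a b u I S = subset_coeff a b (card I) (card S) * (\<Prod>i\<in>S. \<Prod>j\<in>I - S. vfac (u i) (u j))
     * (\<Prod>j\<in>I - S. out_fac (card S) (u j)) * (\<Prod>i\<in>S. in_fac a (card I) (card S) (u i))"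

definition subset_rhs :: "complex \<Rightarrow> complex \<Rightarrow> ('i \<Rightarrow> complex) \<Rightarrow> 'i set \<Rightarrow> complex" where
  "subset_rhs a b u I = eshift a q p (3 * card I + 1) * (\<Prod>i\<in>I. \<theta> (u i / (b * q)) * \<theta> (b * u i / q\<^sup>2))"

definition subset_diff :: "complex \<Rightarrow> complex \<Rightarrow> ('i \<Rightarrow> complex) \<Rightarrow> 'i set \<Rightarrow> complex" where
  "subset_diff a b u I = (\<Sum>S\<in>Pow I. subset_term a b u I S) - subset_rhs a b u I"

lemma th_swap: "x \<noteq> 0 \<Longrightarrow> y \<noteq> 0 \<Longrightarrow> \<theta> (y / x) = - (y / x) * \<theta> (x / y)"
  by (rule etheta_swap[OF norm_p])

lemma th_inverse: "x \<noteq> 0 \<Longrightarrow> \<theta> (1 / x) = - \<theta> x / x"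
  by (rule etheta_inverse[OF norm_p])

lemma th_swap_nz: "x \<noteq> 0 \<Longrightarrow> y \<noteq> 0 \<Longrightarrow> \<theta> (y / x) \<noteq> 0 \<longleftrightarrow> \<theta> (x / y) \<noteq> 0"
  using th_swap[of x y] by simp

lemma th_1 [simp]: "\<theta> 1 = 0"
  by (rule etheta_one[OF norm_p])

lemma q_square_power: "(q\<^sup>2) ^ m = q ^ (2 * m)"
  by (simp add: power_mult)

lemma vfac_swap:
  assumes "x \<noteq> 0" "y \<noteq> 0"
  shows "vfac x y = q\<^sup>2 * \<theta> (y / (q\<^sup>2 * x)) / \<theta> (y / x)"
proof -
  have "\<theta> (q\<^sup>2 * x / y) = - (q\<^sup>2 * x / y) * \<theta> (y / (q\<^sup>2 * x))"
    using assms q_nz by (intro th_swap) auto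
  moreover have "\<theta> (x / y) = - (x / y) * \<theta> (y / x)"
    using assms by (intro th_swap) auto
  ultimately show ?thesis
    using assms by (simp add: vfac_def)
qed

text \<open>At u_t = a q^(2N+3) the outside factor of t supplies the two theta factors just before
  the tail starting at a q^(2N+3+K). Regrouped as N - K plus 3 factors, these give the tail for N
  and a constant. That constant and the last factors of the two tails of base q^2 are independent of
  K and can leave the sum.\<close>

lemma subset_coeff_Suc:
  assumes "K \<le> N"
  shows "subset_coeff a b (Suc N) K * q ^ (2 * K) * out_fac K (a * q ^ (2 * Suc N + 1)) =
    eshift (a * q ^ (3 * N + 1)) q p 3 * \<theta> (a * q ^ (2 * N + 2) / b) * \<theta> (a * b * q ^ (2 * N + 1))
    * subset_coeff a b N K"
proof -
  have s: "Suc N - K = Suc (N - K)" using assms by simp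
  have 1: "q powi (3 * int (K choose 2) - 2 * int (Suc N) * int K) * q ^ (2 * K) =
      q powi (3 * int (K choose 2) - 2 * int N * int K)"
  proof -
    have "3 * int (K choose 2) - 2 * int N * int K = (3 * int (K choose 2) - 2 * int (Suc N) * int K) + int (2 * K)"
      by (simp add: algebra_simps)
    then show ?thesis by (simp only: power_int_add[OF disjI1[OF q_nz]] power_int_of_nat)
  qed
  have 2: "out_fac K (a * q ^ (2 * Suc N + 1)) = \<theta> (a * q ^ (2 * N + 1 + K)) * \<theta> (a * q ^ (2 * N + 1 + K) * q)"
    using q_nz by (simp add: out_fac_def power_add power2_eq_square mult_ac)
  have 3: "\<theta> (a * q ^ (2 * N + 1 + K)) * \<theta> (a * q ^ (2 * N + 1 + K) * q)
      * eshift (a * q ^ (2 * Suc N + 1 + K)) q p (Suc N - K)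
      = eshift (a * q ^ (2 * N + 1 + K)) q p (N - K) * eshift (a * q ^ (3 * N + 1)) q p 3"
  proof -
    have "a * q ^ (2 * N + 1 + K) * q ^ 2 = a * q ^ (2 * Suc N + 1 + K)"
      by (simp add: power_add power2_eq_square)
    then have "eshift (a * q ^ (2 * N + 1 + K)) q p (2 + (Suc N - K)) =
       \<theta> (a * q ^ (2 * N + 1 + K)) * \<theta> (a * q ^ (2 * N + 1 + K) * q) * eshift (a * q ^ (2 * Suc N + 1 + K)) q p (Suc N - K)"
      by (simp only: eshift_add) (simp add: eshift_Suc numeral_2_eq_2)
    moreover have "2 + (Suc N - K) = (N - K) + 3" using assms by simp
    moreover have "a * q ^ (2 * N + 1 + K) * q ^ (N - K) = a * q ^ (3 * N + 1)"
    proof -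
      have "2 * N + 1 + K + (N - K) = 3 * N + 1" using assms by simp
      then show ?thesis by (simp only: mult.assoc power_add[symmetric])
    qed
    ultimately show ?thesis by (simp only: eshift_add)
  qed
  have e: "2 + 2 * K + 2 * (N - K) = 2 * N + 2" "1 + 2 * K + 2 * (N - K) = 2 * N + 1" using assms by simp_all
  have 4: "eshift (a * q ^ (2 + 2 * K) / b) (q\<^sup>2) p (Suc N - K) =
      eshift (a * q ^ (2 + 2 * K) / b) (q\<^sup>2) p (N - K) * \<theta> (a * q ^ (2 * N + 2) / b)"
    unfolding s eshift_Suc q_square_power e(1)[symmetric] by (simp add: power_add mult_ac)
  have 5: "eshift (a * b * q ^ (1 + 2 * K)) (q\<^sup>2) p (Suc N - K) =
      eshift (a * b * q ^ (1 + 2 * K)) (q\<^sup>2) p (N - K) * \<theta> (a * b * q ^ (2 * N + 1))"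
    unfolding s eshift_Suc q_square_power e(2)[symmetric] by (simp add: power_add mult_ac)
  have "subset_coeff a b (Suc N) K * q ^ (2 * K) * out_fac K (a * q ^ (2 * Suc N + 1)) =
     (q powi (3 * int (K choose 2) - 2 * int (Suc N) * int K) * q ^ (2 * K)) * eshift a q p K
     * (\<theta> (a * q ^ (2 * N + 1 + K)) * \<theta> (a * q ^ (2 * N + 1 + K) * q)
        * eshift (a * q ^ (2 * Suc N + 1 + K)) q p (Suc N - K)) * \<theta> (a * q ^ (3 * K))
     * eshift b q p K * eshift (q / b) q p K
     * eshift (a * q ^ (2 + 2 * K) / b) (q\<^sup>2) p (Suc N - K) * eshift (a * b * q ^ (1 + 2 * K)) (q\<^sup>2) p (Suc N - K)"
    unfolding 2 subset_coeff_def by (simp only: mult_ac)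
  also have "\<dots> = eshift (a * q ^ (3 * N + 1)) q p 3 * \<theta> (a * q ^ (2 * N + 2) / b) * \<theta> (a * b * q ^ (2 * N + 1))
    * subset_coeff a b N K"
    unfolding 1 3 4 5 subset_coeff_def by (simp only: mult_ac)
  finally show ?thesis .
qed

lemma Pow_remove: "t \<in> I \<Longrightarrow> Pow I = Pow (I - {t}) \<union> insert t ` Pow (I - {t})"
  by (metis Pow_insert insert_Diff)

lemma sum_Pow_remove:
  assumes "finite I" "t \<in> I"
  shows "(\<Sum>S\<in>Pow I. f S) = (\<Sum>S\<in>Pow (I - {t}). f S + f (insert t S))"
proof -
  have "inj_on (insert t) (Pow (I - {t}))"
    by (auto simp: inj_on_def)
  moreover have "Pow (I - {t}) \<inter> insert t ` Pow (I - {t}) = {}" by auto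
  ultimately show ?thesis
    unfolding Pow_remove[OF assms(2)] using assms(1)
    by (subst sum.union_disjoint) (auto simp: sum.reindex sum.distrib)
qed

text \<open>The factor \<theta>(1) in \<open>in_fac\<close> removes every subset containing t. In
  the other terms \<open>vfac (u i) (u t)\<close> cancels the first theta of \<open>in_fac\<close>
  and puts in the one belonging to one index fewer; all these terms, and the right-hand side,
  acquire the same constant \<open>c\<close>.\<close>

lemma subset_diff_special:
  assumes I: "finite I" "t \<in> I" and a: "a \<noteq> 0" and u: "\<And>i. i \<in> I \<Longrightarrow> u i \<noteq> 0"
    and ut: "u t = a * q ^ (2 * card I + 1)"
    and ne: "\<And>i. i \<in> I - {t} \<Longrightarrow> \<theta> (u t / u i) \<noteq> 0"
    and IH: "subset_diff a b u (I - {t}) = 0"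
  shows "subset_diff a b u I = 0"
proof -
  define N where "N = card (I - {t})"
  have cI: "card I = Suc N" using card_Suc_Diff1[OF I] by (simp only: N_def)
  define c where "c = eshift (a * q ^ (3 * N + 1)) q p 3 * \<theta> (a * q ^ (2 * N + 2) / b) * \<theta> (a * b * q ^ (2 * N + 1))"
  have utnz: "u t \<noteq> 0" using u I by auto
  have "subset_term a b u I S + subset_term a b u I (insert t S) = c * subset_term a b u (I - {t}) S"
    if S: "S \<in> Pow (I - {t})" for S
  proof -
    let ?K = "card S"
    have fS: "finite S" "t \<notin> S" "S \<subseteq> I" using S I finite_subset by auto
    have K: "?K \<le> N" unfolding N_def using S I by (intro card_mono) auto
    have ins: "subset_term a b u I (insert t S) = 0"
      using fS utnz ut[symmetric] by (simp add: subset_term_def in_fac_def)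
    have IS: "I - S = insert t (I - {t} - S)" using fS I by auto
    have V: "vfac (u i) (u t) * in_fac a (Suc N) ?K (u i) = q\<^sup>2 * in_fac a N ?K (u i)" if "i \<in> S" for i
    proof -
      have i: "u i \<noteq> 0" "\<theta> (u t / u i) \<noteq> 0" using that S u ne by auto
      have "u t / (q\<^sup>2 * u i) = a * q ^ (2 * N + 1) / u i"
        unfolding ut cI using q_nz by (simp add: power_add power2_eq_square)
      then show ?thesis
        unfolding vfac_swap[OF i(1) utnz] in_fac_def cI[symmetric] ut[symmetric] using i(2) by simp
    qed
    have "subset_term a b u I S = subset_coeff a b (Suc N) ?K
        * ((\<Prod>i\<in>S. \<Prod>j\<in>I - {t} - S. vfac (u i) (u j)) * (\<Prod>i\<in>S. vfac (u i) (u t)))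
        * (out_fac ?K (u t) * (\<Prod>j\<in>I - {t} - S. out_fac ?K (u j))) * (\<Prod>i\<in>S. in_fac a (Suc N) ?K (u i))"
      unfolding subset_term_def cI IS using I by (simp add: prod.distrib mult_ac)
    also have "\<dots> = subset_coeff a b (Suc N) ?K * out_fac ?K (u t) * (\<Prod>i\<in>S. \<Prod>j\<in>I - {t} - S. vfac (u i) (u j))
        * (\<Prod>j\<in>I - {t} - S. out_fac ?K (u j)) * (\<Prod>i\<in>S. vfac (u i) (u t) * in_fac a (Suc N) ?K (u i))"
      by (simp add: prod.distrib mult_ac)
    also have "(\<Prod>i\<in>S. vfac (u i) (u t) * in_fac a (Suc N) ?K (u i)) = q ^ (2 * ?K) * (\<Prod>i\<in>S. in_fac a N ?K (u i))"
      using V by (simp add: prod.distrib power_mult)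
    finally have "subset_term a b u I S = (subset_coeff a b (Suc N) ?K * q ^ (2 * ?K) * out_fac ?K (u t))
       * (\<Prod>i\<in>S. \<Prod>j\<in>I - {t} - S. vfac (u i) (u j))
        * (\<Prod>j\<in>I - {t} - S. out_fac ?K (u j)) * (\<Prod>i\<in>S. in_fac a N ?K (u i))"
      by (simp only: mult_ac)
    also have "subset_coeff a b (Suc N) ?K * q ^ (2 * ?K) * out_fac ?K (u t) = c * subset_coeff a b N ?K"
      unfolding ut cI c_def by (rule subset_coeff_Suc[OF K])
    finally have "subset_term a b u I S = c * subset_term a b u (I - {t}) S"
      unfolding subset_term_def N_def[symmetric] by (simp only: mult_ac)
    then show ?thesis by (simp add: ins)
  qed
  then have "(\<Sum>S\<in>Pow I. subset_term a b u I S) = c * (\<Sum>S\<in>Pow (I - {t}). subset_term a b u (I - {t}) S)"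
    unfolding sum_Pow_remove[OF I] by (simp add: sum_distrib_left)
  moreover have "subset_rhs a b u I = c * subset_rhs a b u (I - {t})"
  proof -
    have e: "3 * Suc N + 1 = (3 * N + 1) + 3" by simp
    have 1: "u t / (b * q) = a * q ^ (2 * N + 2) / b" "b * u t / q\<^sup>2 = a * b * q ^ (2 * N + 1)"
      unfolding ut cI using q_nz by (simp_all add: power_add power2_eq_square)
    show ?thesis
      unfolding subset_rhs_def cI N_def[symmetric] e eshift_add c_def prod.remove[OF I] 1
      by (simp only: mult_ac)
  qed
  ultimately show ?thesis
    using IH by (simp add: subset_diff_def flip: right_diff_distrib)
qed

text \<open>For \<open>I = insert t J\<close> the terms with \<open>t \<notin> S\<close> and with \<open>t \<in> S\<close>, as functions of \<open>v = u\<^sub>t\<close>, after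
  multiplication by \<open>\<Prod>j\<in>J. \<theta>(v/u\<^sub>j)\<close>, which removes their poles.\<close>

definition cleared_out :: "complex \<Rightarrow> complex \<Rightarrow> ('i \<Rightarrow> complex) \<Rightarrow> 'i set \<Rightarrow> 'i set \<Rightarrow> complex \<Rightarrow> complex" where
  "cleared_out a b u J S v = subset_coeff a b (Suc (card J)) (card S) * (\<Prod>i\<in>S. \<Prod>j\<in>J - S. vfac (u i) (u j))
     * (\<Prod>j\<in>J - S. out_fac (card S) (u j)) * (\<Prod>i\<in>S. in_fac a (Suc (card J)) (card S) (u i))
     * (out_fac (card S) v * (\<Prod>i\<in>S. q\<^sup>2 * \<theta> (v / (q\<^sup>2 * u i))) * (\<Prod>j\<in>J - S. \<theta> (v / u j)))"

definition cleared_in :: "complex \<Rightarrow> complex \<Rightarrow> ('i \<Rightarrow> complex) \<Rightarrow> 'i set \<Rightarrow> 'i set \<Rightarrow> complex \<Rightarrow> complex" where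
  "cleared_in a b u J S v = subset_coeff a b (Suc (card J)) (Suc (card S)) * (\<Prod>i\<in>S. \<Prod>j\<in>J - S. vfac (u i) (u j))
     * (\<Prod>j\<in>J - S. out_fac (Suc (card S)) (u j)) * (\<Prod>i\<in>S. in_fac a (Suc (card J)) (Suc (card S)) (u i))
     * (in_fac a (Suc (card J)) (Suc (card S)) v * (\<Prod>j\<in>J - S. \<theta> (q\<^sup>2 * v / u j)) * (\<Prod>i\<in>S. \<theta> (v / u i)))"

definition cleared :: "complex \<Rightarrow> complex \<Rightarrow> ('i \<Rightarrow> complex) \<Rightarrow> 'i set \<Rightarrow> complex \<Rightarrow> complex" where
  "cleared a b u J v = (\<Sum>S\<in>Pow J. cleared_out a b u J S v + cleared_in a b u J S v)
     - eshift a q p (3 * Suc (card J) + 1) * (\<Prod>i\<in>J. \<theta> (u i / (b * q)) * \<theta> (b * u i / q\<^sup>2))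
       * (\<theta> (v / (b * q)) * \<theta> (b * v / q\<^sup>2) * (\<Prod>j\<in>J. \<theta> (v / u j)))"

lemma subset_diff_cleared:
  assumes J: "finite J" "t \<notin> J" and u: "\<And>i. i \<in> J \<Longrightarrow> u i \<noteq> 0" and v: "v \<noteq> 0"
    and ne: "\<And>i. i \<in> J \<Longrightarrow> \<theta> (v / u i) \<noteq> 0"
  shows "subset_diff a b (u(t := v)) (insert t J) * (\<Prod>j\<in>J. \<theta> (v / u j)) = cleared a b u J v"
proof -
  let ?I = "insert t J" and ?u = "u(t := v)"
  have eq: "?u i = u i" if "i \<in> J" for i using that J by auto
  have "(subset_term a b ?u ?I S + subset_term a b ?u ?I (insert t S)) * (\<Prod>j\<in>J. \<theta> (v / u j))
      = cleared_out a b u J S v + cleared_in a b u J S v" if "S \<in> Pow J" for S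
  proof -
    have S: "S \<subseteq> J" "finite S" "t \<notin> S" using that J finite_subset by auto
    have IS: "?I - S = insert t (J - S)" "?I - insert t S = J - S" using S J by auto
    have split: "(\<Prod>j\<in>J. \<theta> (v / u j)) = (\<Prod>j\<in>J - S. \<theta> (v / u j)) * (\<Prod>i\<in>S. \<theta> (v / u i))"
      by (rule prod.subset_diff[OF S(1) J(1)])
    have vv: "(\<Prod>i\<in>S. \<Prod>j\<in>J - S. vfac (?u i) (?u j)) = (\<Prod>i\<in>S. \<Prod>j\<in>J - S. vfac (u i) (u j))"
      using S J by (intro prod.cong refl) auto
    have oo: "(\<Prod>j\<in>J - S. out_fac K (?u j)) = (\<Prod>j\<in>J - S. out_fac K (u j))" for K
      using J by (intro prod.cong refl) auto
    have ii: "(\<Prod>i\<in>S. in_fac a N K (?u i)) = (\<Prod>i\<in>S. in_fac a N K (u i))" for N K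
      using S J by (intro prod.cong refl) auto
    have c1: "(\<Prod>i\<in>S. vfac (?u i) v) * (\<Prod>i\<in>S. \<theta> (v / u i)) = (\<Prod>i\<in>S. q\<^sup>2 * \<theta> (v / (q\<^sup>2 * u i)))"
      unfolding prod.distrib[symmetric]
    proof (rule prod.cong[OF refl])
      fix i assume "i \<in> S"
      then have i: "i \<in> J" "?u i = u i" using S eq by auto
      show "vfac (?u i) v * \<theta> (v / u i) = q\<^sup>2 * \<theta> (v / (q\<^sup>2 * u i))"
        unfolding i(2) vfac_swap[OF u[OF i(1)] v] using ne[OF i(1)] by simp
    qed
    have c2: "(\<Prod>j\<in>J - S. vfac v (?u j)) * (\<Prod>j\<in>J - S. \<theta> (v / u j)) = (\<Prod>j\<in>J - S. \<theta> (q\<^sup>2 * v / u j))"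
      unfolding prod.distrib[symmetric]
    proof (rule prod.cong[OF refl])
      fix i assume "i \<in> J - S"
      then have i: "i \<in> J" "?u i = u i" using eq by auto
      show "vfac v (?u i) * \<theta> (v / u i) = \<theta> (q\<^sup>2 * v / u i)"
        unfolding i(2) vfac_def using ne[OF i(1)] by simp
    qed
    have "subset_term a b ?u ?I S = subset_coeff a b (Suc (card J)) (card S)
        * ((\<Prod>i\<in>S. vfac (?u i) v) * (\<Prod>i\<in>S. \<Prod>j\<in>J - S. vfac (u i) (u j)))
        * (out_fac (card S) v * (\<Prod>j\<in>J - S. out_fac (card S) (u j)))
        * (\<Prod>i\<in>S. in_fac a (Suc (card J)) (card S) (u i))"
      unfolding subset_term_def IS(1) vv[symmetric] oo[symmetric] ii[symmetric] using J by (simp add: prod.distrib)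
    then have 1: "subset_term a b ?u ?I S * (\<Prod>j\<in>J. \<theta> (v / u j)) = cleared_out a b u J S v"
      unfolding split cleared_out_def c1[symmetric] by (simp only: mult_ac)
    have "subset_term a b ?u ?I (insert t S) = subset_coeff a b (Suc (card J)) (Suc (card S))
        * ((\<Prod>j\<in>J - S. vfac v (?u j)) * (\<Prod>i\<in>S. \<Prod>j\<in>J - S. vfac (u i) (u j)))
        * (\<Prod>j\<in>J - S. out_fac (Suc (card S)) (u j))
        * (in_fac a (Suc (card J)) (Suc (card S)) v * (\<Prod>i\<in>S. in_fac a (Suc (card J)) (Suc (card S)) (u i)))"
      unfolding subset_term_def IS(2) vv[symmetric] oo[symmetric] ii[symmetric] using J S by simp
    then have 2: "subset_term a b ?u ?I (insert t S) * (\<Prod>j\<in>J. \<theta> (v / u j)) = cleared_in a b u J S v"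
      unfolding split cleared_in_def c2[symmetric] by (simp only: mult_ac)
    show ?thesis using 1 2 by (simp add: distrib_right)
  qed
  moreover have "?I - {t} = J" using J by auto
  ultimately have "(\<Sum>S\<in>Pow ?I. subset_term a b ?u ?I S) * (\<Prod>j\<in>J. \<theta> (v / u j)) =
      (\<Sum>S\<in>Pow J. cleared_out a b u J S v + cleared_in a b u J S v)"
    using J by (simp add: sum_Pow_remove[of ?I t] sum_distrib_right)
  moreover have "subset_rhs a b ?u ?I = eshift a q p (3 * Suc (card J) + 1)
      * (\<Prod>i\<in>J. \<theta> (u i / (b * q)) * \<theta> (b * u i / q\<^sup>2)) * (\<theta> (v / (b * q)) * \<theta> (b * v / q\<^sup>2))"
  proof -
    have "(\<Prod>i\<in>J. \<theta> (?u i / (b * q)) * \<theta> (b * ?u i / q\<^sup>2)) = (\<Prod>i\<in>J. \<theta> (u i / (b * q)) * \<theta> (b * u i / q\<^sup>2))"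
      by (rule prod.cong[OF refl]) (simp only: eq)
    then show ?thesis
      unfolding subset_rhs_def card_insert_disjoint[OF J] prod.insert[OF J] fun_upd_same by (simp only: mult_ac)
  qed
  ultimately show ?thesis
    unfolding subset_diff_def cleared_def left_diff_distrib by (simp only: mult.assoc)
qed

text \<open>The zeros multiply to the same constant for every subset. In \<open>cleared_out\<close>
  each index of S has its zero multiplied by q^2, and the zeros of \<open>out_fac\<close> multiply
  to q^(3 - 2 |S|). In \<open>cleared_in\<close> each index of J - S has its zero divided by q^2,
  and the zeros of \<open>in_fac\<close> multiply to q^(3 + 2 |J - S|).\<close>

lemma tspan_cleared:
  assumes J: "finite J" and u: "\<And>i. i \<in> J \<Longrightarrow> u i \<noteq> 0" and a: "a \<noteq> 0" and b: "b \<noteq> 0"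
  shows "tspan p (card J + 2) (q ^ 3 * (\<Prod>j\<in>J. u j)) (cleared a b u J)"
proof -
  let ?N = "Suc (card J)" and ?C = "q ^ 3 * (\<Prod>j\<in>J. u j)"
  have out: "tspan p (card J + 2) ?C (cleared_out a b u J S)" if "S \<in> Pow J" for S
  proof -
    have S: "S \<subseteq> J" "finite S" "finite (J - S)" using that J finite_subset by auto
    let ?K = "card S"
    let ?f = "(\<lambda>v. subset_coeff a b ?N ?K * (\<Prod>i\<in>S. \<Prod>j\<in>J - S. vfac (u i) (u j))
       * (\<Prod>j\<in>J - S. out_fac ?K (u j)) * (\<Prod>i\<in>S. in_fac a ?N ?K (u i)) * (q\<^sup>2) ^ ?K *
       (\<theta> (v / (q / q ^ ?K)) * \<theta> (v / (q\<^sup>2 / q ^ ?K)) * (\<Prod>i\<in>S. \<theta> (v / (q\<^sup>2 * u i))) * (\<Prod>j\<in>J - S. \<theta> (v / u j))))"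
    have "tspan p (card S + card (J - S) + 2) ((\<Prod>i\<in>S. q\<^sup>2 * u i) * (\<Prod>j\<in>J - S. u j) * (q / q ^ ?K * (q\<^sup>2 / q ^ ?K)))
      ?f"
      by (rule tspan_prod2) (use S u q_nz in auto)
    moreover have "card S + card (J - S) + 2 = card J + 2"
      using S J by (simp add: card_Diff_subset card_mono)
    moreover have "(\<Prod>i\<in>S. q\<^sup>2 * u i) * (\<Prod>j\<in>J - S. u j) * (q / q ^ ?K * (q\<^sup>2 / q ^ ?K)) = ?C"
    proof -
      have "(\<Prod>i\<in>S. q\<^sup>2 * u i) = (q ^ ?K * q ^ ?K) * (\<Prod>i\<in>S. u i)"
        by (simp add: prod.distrib power2_eq_square power_mult_distrib)
      moreover have "(\<Prod>j\<in>J. u j) = (\<Prod>j\<in>J - S. u j) * (\<Prod>i\<in>S. u i)"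
        by (rule prod.subset_diff[OF S(1) J])
      ultimately show ?thesis using q_nz by (simp add: power2_eq_square power3_eq_cube)
    qed
    moreover have "?f = cleared_out a b u J S"
    proof (rule ext)
      fix v
      have "v / (q / q ^ ?K) = v * q ^ ?K / q" "v / (q\<^sup>2 / q ^ ?K) = v * q ^ ?K / q\<^sup>2" by simp_all
      moreover have "(\<Prod>i\<in>S. q\<^sup>2 * \<theta> (v / (q\<^sup>2 * u i))) = (q\<^sup>2) ^ ?K * (\<Prod>i\<in>S. \<theta> (v / (q\<^sup>2 * u i)))"
        by (simp only: prod.distrib prod_constant)
      ultimately show "?f v = cleared_out a b u J S v"
        unfolding cleared_out_def out_fac_def by (simp only: mult_ac)
    qed
    ultimately show ?thesis by (simp only:)
  qed
  have inn: "tspan p (card J + 2) ?C (cleared_in a b u J S)" if "S \<in> Pow J" for S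
  proof -
    have S: "S \<subseteq> J" "finite S" "finite (J - S)" using that J finite_subset by auto
    let ?K = "Suc (card S)" and ?\<alpha> = "a * q ^ (2 * Suc (card J) + 1)"
    have card: "card S + card (J - S) = card J"
      using S J by (simp add: card_Diff_subset card_mono)
    let ?c = "subset_coeff a b ?N ?K * (\<Prod>i\<in>S. \<Prod>j\<in>J - S. vfac (u i) (u j))
       * (\<Prod>j\<in>J - S. out_fac ?K (u j)) * (\<Prod>i\<in>S. in_fac a ?N ?K (u i)) * (- ?\<alpha>)"
    let ?f = "(\<lambda>v. ?c * (\<theta> (v / ?\<alpha>) * \<theta> (v / (q\<^sup>2 / (a * q ^ (2 * ?K)))) * (\<Prod>i\<in>S. \<theta> (v / u i)) * (\<Prod>j\<in>J - S. \<theta> (v / (u j / q\<^sup>2)))))"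
    have ts: "tspan p (card S + card (J - S) + 2) ((\<Prod>i\<in>S. u i) * (\<Prod>j\<in>J - S. u j / q\<^sup>2) * (?\<alpha> * (q\<^sup>2 / (a * q ^ (2 * ?K)))))
      ?f"
      by (rule tspan_prod2) (use S u a q_nz in auto)
    have C: "(\<Prod>i\<in>S. u i) * (\<Prod>j\<in>J - S. u j / q\<^sup>2) * (?\<alpha> * (q\<^sup>2 / (a * q ^ (2 * ?K)))) = ?C"
    proof -
      have "q ^ (2 * Suc (card J) + 1) * q\<^sup>2 = q ^ 3 * q ^ (2 * ?K) * q ^ (2 * card (J - S))"
        unfolding power_add[symmetric] using card by (intro arg_cong[of _ _ "\<lambda>k. q ^ k"]) simp
      moreover have "a * x * (y / (a * z)) / w = (x * y) / (z * w)" for x y z w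
        using a by simp
      ultimately have "?\<alpha> * (q\<^sup>2 / (a * q ^ (2 * ?K))) / q ^ (2 * card (J - S)) = q ^ 3"
        using q_nz by simp
      moreover have "P * (X / Q) * A = (A / Q) * (X * P)" for P X Q A :: complex
        by simp
      moreover have "(\<Prod>j\<in>J. u j) = (\<Prod>j\<in>J - S. u j) * (\<Prod>i\<in>S. u i)"
        by (rule prod.subset_diff[OF S(1) J])
      moreover have "(\<Prod>j\<in>J - S. u j / q\<^sup>2) = (\<Prod>j\<in>J - S. u j) / q ^ (2 * card (J - S))"
        by (simp add: prod_dividef power_mult)
      ultimately show ?thesis by (simp only: )
    qed
    have eq: "?f v = cleared_in a b u J S v" if v: "v \<noteq> 0" for v
    proof -
      have "\<theta> (?\<alpha> / v) = - (?\<alpha> / v) * \<theta> (v / ?\<alpha>)"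
        using v a q_nz by (intro th_swap) auto
      then have "in_fac a ?N ?K v = - ?\<alpha> * (\<theta> (v / ?\<alpha>) * \<theta> (a * v * q ^ (2 * ?K) / q\<^sup>2))"
        using v by (simp add: in_fac_def)
      moreover have "v / (q\<^sup>2 / (a * q ^ (2 * ?K))) = a * v * q ^ (2 * ?K) / q\<^sup>2" "v / (u j / q\<^sup>2) = q\<^sup>2 * v / u j" for j
        by (simp_all add: mult_ac)
      ultimately show ?thesis
        unfolding cleared_in_def by (simp only: mult_ac)
    qed
    show ?thesis
      by (rule tspan_ext[OF ts[unfolded C card] eq])
  qed
  let ?R = "\<lambda>v. eshift a q p (3 * ?N + 1) * (\<Prod>i\<in>J. \<theta> (u i / (b * q)) * \<theta> (b * u i / q\<^sup>2))
       * (\<theta> (v / (b * q)) * \<theta> (b * v / q\<^sup>2) * (\<Prod>j\<in>J. \<theta> (v / u j)))"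
  have rhs: "tspan p (card J + 2) ?C ?R"
  proof -
    have "tspan p (card (J - J) + card J + 2) ((\<Prod>i\<in>(J - J). u i) * (\<Prod>j\<in>J. u j) * (b * q * (q\<^sup>2 / b)))
      (\<lambda>v. eshift a q p (3 * ?N + 1) * (\<Prod>i\<in>J. \<theta> (u i / (b * q)) * \<theta> (b * u i / q\<^sup>2))
       * (\<theta> (v / (b * q)) * \<theta> (v / (q\<^sup>2 / b)) * (\<Prod>i\<in>(J - J). \<theta> (v / u i)) * (\<Prod>j\<in>J. \<theta> (v / u j))))"
      by (rule tspan_prod2) (use J u b q_nz in auto)
    moreover have "b * q * (q\<^sup>2 / b) = q ^ 3" using b by (simp add: power2_eq_square power3_eq_cube)
    ultimately show ?thesis by (simp add: mult.commute)
  qed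
  have "tspan p (card J + 2) ?C (\<lambda>v. (\<Sum>S\<in>Pow J. cleared_out a b u J S v + cleared_in a b u J S v)
     + (-1) * ?R v)"
    by (intro tspan_add tspan_scale[OF rhs] tspan_sum out inn) (use J in auto)
  then show ?thesis
    by (rule tspan_ext) (simp add: cleared_def)
qed

text \<open>This is the cancellation of residues at v = u l. Terms with l and t on the same side
  contain \<theta>(u l / u l) = 0. The remaining terms pair up and differ only in the factor of the
  pair {l, t}, which is q^2 \<theta>(q^(-2)) in one and \<theta>(q^2) in the other; these are
  opposite.\<close>

lemma cleared_eq_0:
  assumes J: "finite J" "l \<in> J" and u: "\<And>i. i \<in> J \<Longrightarrow> u i \<noteq> 0"
    and ne: "\<And>i. i \<in> J \<Longrightarrow> i \<noteq> l \<Longrightarrow> \<theta> (u l / u i) \<noteq> 0"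
  shows "cleared a b u J (u l) = 0"
proof -
  let ?v = "u l" and ?N = "Suc (card J)"
  have l0: "?v \<noteq> 0" using u J by auto
  have out0: "cleared_out a b u J S ?v = 0" if "l \<notin> S" for S
  proof -
    have "(\<Prod>j\<in>J - S. \<theta> (?v / u j)) = 0" using that J l0 by (auto simp: prod_zero_iff intro!: bexI[of _ l])
    then show ?thesis by (simp add: cleared_out_def)
  qed
  have in0: "cleared_in a b u J S ?v = 0" if "l \<in> S" "S \<subseteq> J" for S
  proof -
    have "(\<Prod>j\<in>S. \<theta> (?v / u j)) = 0" using that J l0 finite_subset[OF that(2) J(1)] by (auto simp: prod_zero_iff intro!: bexI[of _ l])
    then show ?thesis by (simp add: cleared_in_def)
  qed
  \<comment> \<open>the poles of the subsets with \<open>l\<close> but not \<open>t\<close> cancel those of the subsets with \<open>t\<close> but not \<open>l\<close>\<close>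
  have "cleared_out a b u J (insert l T) ?v + cleared_in a b u J T ?v = 0" if T: "T \<in> Pow (J - {l})" for T
  proof -
    have fT: "finite T" "l \<notin> T" "T \<subseteq> J" "finite (J - {l} - T)" using T J finite_subset by auto
    let ?O = "J - {l} - T" and ?K = "Suc (card T)"
    have sets: "J - insert l T = ?O" "J - T = insert l ?O" using J fT by auto
    have lO: "l \<notin> ?O" by simp
    have q2: "q\<^sup>2 * \<theta> (?v / (q\<^sup>2 * ?v)) = - \<theta> (q\<^sup>2)"
      using l0 q_nz th_inverse[of "q\<^sup>2"] by simp
    have A: "(\<Prod>j\<in>?O. vfac ?v (u j)) * (\<Prod>j\<in>?O. \<theta> (?v / u j)) = (\<Prod>j\<in>?O. \<theta> (q\<^sup>2 * ?v / u j))"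
      unfolding prod.distrib[symmetric]
      by (rule prod.cong[OF refl]) (use ne in \<open>auto simp: vfac_def\<close>)
    have B: "(\<Prod>i\<in>T. vfac (u i) ?v) * (\<Prod>i\<in>T. \<theta> (?v / u i)) = (\<Prod>i\<in>T. q\<^sup>2 * \<theta> (?v / (q\<^sup>2 * u i)))"
      unfolding prod.distrib[symmetric]
    proof (rule prod.cong[OF refl])
      fix i assume "i \<in> T"
      then have "i \<in> J" "i \<noteq> l" using fT by auto
      then show "vfac (u i) ?v * \<theta> (?v / u i) = q\<^sup>2 * \<theta> (?v / (q\<^sup>2 * u i))"
        using ne[of i] by (simp add: vfac_swap[OF u l0])
    qed
    define c where "c = subset_coeff a b ?N ?K * (\<Prod>i\<in>T. \<Prod>j\<in>?O. vfac (u i) (u j))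
       * (\<Prod>j\<in>?O. out_fac ?K (u j)) * (\<Prod>i\<in>T. in_fac a ?N ?K (u i)) * in_fac a ?N ?K ?v * out_fac ?K ?v
       * (\<Prod>i\<in>T. q\<^sup>2 * \<theta> (?v / (q\<^sup>2 * u i))) * (\<Prod>j\<in>?O. \<theta> (q\<^sup>2 * ?v / u j))"
    have "cleared_out a b u J (insert l T) ?v = c * (q\<^sup>2 * \<theta> (?v / (q\<^sup>2 * ?v)))"
      unfolding cleared_out_def sets(1) card_insert_disjoint[OF fT(1,2)] prod.insert[OF fT(1,2)] c_def A[symmetric]
      by (simp only: mult_ac)
    moreover have "cleared_in a b u J T ?v = c * \<theta> (q\<^sup>2)"
    proof -
      have "(\<Prod>i\<in>T. \<Prod>j\<in>J - T. vfac (u i) (u j)) = (\<Prod>i\<in>T. vfac (u i) ?v) * (\<Prod>i\<in>T. \<Prod>j\<in>?O. vfac (u i) (u j))"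
        unfolding sets(2) prod.insert[OF fT(4) lO] by (rule prod.distrib)
      moreover have "q\<^sup>2 * ?v / ?v = q\<^sup>2" using l0 by simp
      ultimately show ?thesis
        unfolding cleared_in_def c_def B[symmetric] unfolding sets(2) prod.insert[OF fT(4) lO]
        by (simp only: mult_ac)
    qed
    ultimately show ?thesis unfolding q2 by simp
  qed
  moreover have "(\<Sum>S\<in>Pow J. cleared_out a b u J S ?v + cleared_in a b u J S ?v) =
     (\<Sum>T\<in>Pow (J - {l}). cleared_out a b u J (insert l T) ?v + cleared_in a b u J T ?v)"
    unfolding sum_Pow_remove[OF J]
  proof (rule sum.cong[OF refl])
    fix T assume "T \<in> Pow (J - {l})"
    then have "l \<notin> T" "insert l T \<subseteq> J" using J by auto
    then show "cleared_out a b u J T ?v + cleared_in a b u J T ?v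
       + (cleared_out a b u J (insert l T) ?v + cleared_in a b u J (insert l T) ?v)
       = cleared_out a b u J (insert l T) ?v + cleared_in a b u J T ?v"
      using out0[of T] in0[of "insert l T"] by simp
  qed
  moreover have "(\<Prod>j\<in>J. \<theta> (?v / u j)) = 0"
    using J l0 by (auto simp: prod_zero_iff intro!: bexI[of _ l])
  ultimately show ?thesis by (simp add: cleared_def)
qed

text \<open>\<open>cleared\<close> has degree \<open>card J + 2\<close>; the u j supply
  \<open>card J\<close> zeros, and s1 and s2 are the two that are missing. In the product of the
  nodes over the constant of \<open>tspan_cleared\<close> the u j cancel, which leaves the condition
  on \<open>s1 * s2 / q ^ 3\<close>.\<close>

lemma subset_diff_vary:
  assumes J: "finite J" "t \<notin> J" and u: "\<And>i. i \<in> J \<Longrightarrow> u i \<noteq> 0" and a: "a \<noteq> 0" and b: "b \<noteq> 0"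
    and dist: "\<And>i j. i \<in> J \<Longrightarrow> j \<in> J \<Longrightarrow> i \<noteq> j \<Longrightarrow> \<theta> (u i / u j) \<noteq> 0"
    and s: "s1 \<noteq> 0" "s2 \<noteq> 0" "\<theta> (s1 / s2) \<noteq> 0" "\<theta> (s1 * s2 / q ^ 3) \<noteq> 0"
    and su: "\<And>i. i \<in> J \<Longrightarrow> \<theta> (s1 / u i) \<noteq> 0" "\<And>i. i \<in> J \<Longrightarrow> \<theta> (s2 / u i) \<noteq> 0"
    and zero: "subset_diff a b (u(t := s1)) (insert t J) = 0" "subset_diff a b (u(t := s2)) (insert t J) = 0"
    and v: "v \<noteq> 0" "\<And>i. i \<in> J \<Longrightarrow> \<theta> (v / u i) \<noteq> 0"
  shows "subset_diff a b (u(t := v)) (insert t J) = 0"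
proof -
  let ?Y = "insert s1 (insert s2 (u ` J))"
  have inj: "inj_on u J"
  proof (rule inj_onI, rule ccontr)
    fix i j assume "i \<in> J" "j \<in> J" "u i = u j" "i \<noteq> j"
    then show False using dist[of i j] u[of j] by simp
  qed
  have s12: "s1 \<noteq> s2" using s by auto
  have n2: "s2 \<notin> u ` J" using su(2) s by force
  have n1: "s1 \<notin> insert s2 (u ` J)" using su(1) s s12 by force
  have "cleared a b u J v = 0"
  proof (rule tspan_eq_0[OF tspan_cleared[OF J(1) u a b] norm_p, where Y = ?Y])
    show "card ?Y = card J + 2"
      using n1 n2 J inj by (simp add: card_image)
    show "0 \<notin> ?Y" using s u by auto
    have "\<Prod>?Y = s1 * (s2 * (\<Prod>j\<in>J. u j))"
      using n1 n2 J inj by (simp add: prod.reindex)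
    moreover have "(\<Prod>j\<in>J. u j) \<noteq> 0" using u J by simp
    ultimately show "\<theta> (\<Prod>?Y / (q ^ 3 * (\<Prod>j\<in>J. u j))) \<noteq> 0"
      using s(4) by (simp add: mult.assoc[symmetric])
    have s': "\<theta> (s2 / s1) \<noteq> 0"
      using th_swap_nz[OF s(1,2)] s(3) by blast
    have su': "\<theta> (u i / s1) \<noteq> 0" "\<theta> (u i / s2) \<noteq> 0" if "i \<in> J" for i
      using th_swap_nz[OF s(1) u[OF that]] th_swap_nz[OF s(2) u[OF that]] su[OF that] by blast+
    show "\<theta> (y / y') \<noteq> 0" if "y \<in> ?Y" "y' \<in> ?Y" "y \<noteq> y'" for y y'
    proof -
      consider "y = s1" "y' = s2" | "y = s2" "y' = s1" | i where "i \<in> J" "y = s1" "y' = u i"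
        | i where "i \<in> J" "y' = s1" "y = u i" | i where "i \<in> J" "y = s2" "y' = u i"
        | i where "i \<in> J" "y' = s2" "y = u i" | i j where "i \<in> J" "j \<in> J" "y = u i" "y' = u j" "i \<noteq> j"
        using \<open>y \<in> ?Y\<close> \<open>y' \<in> ?Y\<close> \<open>y \<noteq> y'\<close> by blast
      then show ?thesis
        by cases (simp_all only: s(3) s' su su' dist not_False_eq_True)
    qed
    have clr: "cleared a b u J y = 0" if "subset_diff a b (u(t := y)) (insert t J) = 0" "y \<noteq> 0"
      "\<And>i. i \<in> J \<Longrightarrow> \<theta> (y / u i) \<noteq> 0" for y
      using subset_diff_cleared[where u = u and a = a and b = b, OF J u that(2,3)] that(1) by simp
    show "cleared a b u J y = 0" if "y \<in> ?Y" for y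
    proof -
      have "cleared a b u J (u l) = 0" if "l \<in> J" for l
        by (rule cleared_eq_0[OF J(1) that u]) (use dist that in auto)
      then show ?thesis
        using \<open>y \<in> ?Y\<close> clr[OF zero(1) s(1) su(1)] clr[OF zero(2) s(2) su(2)] by auto
    qed
  qed (use J v in auto)
  moreover have "(\<Prod>j\<in>J. \<theta> (v / u j)) \<noteq> 0" using v J by simp
  ultimately show ?thesis
    using subset_diff_cleared[where u = u and a = a and b = b, OF J u v] by simp
qed

section \<open>Evaluation on a geometric string\<close>

lemma powi_mult: "q powi k * q powi l = q powi (k + l)"
  using power_int_add[OF disjI1[OF q_nz]] by simp

lemma powi_div: "q powi k / q powi l = q powi (k - l)"
  using power_int_diff[OF disjI1[OF q_nz]] by simp

text \<open>\<open>vfac\<close> vanishes when some s lies inside S and q^2 s outside. Otherwise the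
  complement occupies the first m > 0 positions, and the outside factors at position h have
  arguments q^(2h + 1 - m) and q^(2h + 2 - m). One of these is 1 at h = (m - 1)/2 or h = (m - 2)/2,
  according to the parity of m; the exponent 3 - N of the first entry is chosen for this.\<close>

lemma subset_term_string_proper:
  assumes I: "finite I" and h: "bij_betw h I {..<card I}" and S: "S \<subset> I"
    and s: "\<And>i. i \<in> I \<Longrightarrow> s i = q powi (3 - int (card I) + 2 * int (h i))"
  shows "subset_term a b s I S = 0"
proof -
  define m where "m = card (I - S)"
  have fin: "finite S" "finite (I - S)" using I S finite_subset by auto
  have cS: "card I = card S + m"
    unfolding m_def using S I fin by (metis card_Un_disjoint Diff_disjoint Un_Diff_cancel sup.absorb2 psubset_imp_subset)
  have "m > 0" unfolding m_def using S fin by (metis Diff_eq_empty_iff card_gt_0_iff psubset_eq subset_antisym)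
  show ?thesis
  proof (cases "\<exists>i\<in>S. \<exists>j\<in>I - S. h j = Suc (h i)")
    case True
    then obtain i j where ij: "i \<in> S" "j \<in> I - S" "h j = Suc (h i)" by blast
    have "s j = q powi ((3 - int (card I) + 2 * int (h i)) + 2)"
      using ij s[of j] by (simp add: algebra_simps)
    also have "\<dots> = q powi (3 - int (card I) + 2 * int (h i)) * q powi 2"
      by (simp only: powi_mult)
    also have "\<dots> = s i * q\<^sup>2"
      using ij(1) S s[of i] by auto
    finally have "s j = s i * q\<^sup>2" .
    moreover have "s i \<noteq> 0" using ij S s[of i] q_nz by auto
    ultimately have "vfac (s i) (s j) = 0"
      using q_nz by (simp add: vfac_def mult.commute)
    then have "(\<Prod>j\<in>I - S. vfac (s i) (s j)) = 0" using ij fin by (meson prod_zero)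
    then have "(\<Prod>i\<in>S. \<Prod>j\<in>I - S. vfac (s i) (s j)) = 0" using ij fin by (meson prod_zero)
    then show ?thesis by (simp add: subset_term_def)
  next
    case False
    have inj: "inj_on h I" and img: "h ` I = {..<card I}" using h by (auto simp: bij_betw_def)
    have "h ` (I - S) = {..<card (h ` (I - S))}"
    proof (rule down_closed_eq_lessThan)
      fix n assume "Suc n \<in> h ` (I - S)"
      then obtain j where j: "j \<in> I - S" "h j = Suc n" by auto
      then have "Suc n < card I" using img by (metis DiffD1 imageI lessThan_iff)
      then have "n \<in> h ` I" unfolding img by simp
      then obtain i where i: "i \<in> I" "h i = n" by auto
      then have "i \<notin> S" using False j by metis
      then show "n \<in> h ` (I - S)" using i by auto
    qed (use fin in auto)
    then have img': "h ` (I - S) = {..<m}"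
      using card_image[OF inj_on_subset[OF inj, of "I - S"]] by (simp add: m_def)
    have "\<exists>j\<in>I - S. out_fac (card S) (s j) = 0"
    proof (cases "odd m")
      case True
      then have "(m - 1) div 2 < m" using \<open>m > 0\<close> by auto
      then have "(m - 1) div 2 \<in> h ` (I - S)" using img' by simp
      then obtain j where j: "j \<in> I - S" "h j = (m - 1) div 2" by auto
      have "2 * int (h j) = int m - 1" using j(2) True by presburger
      then have e: "3 - int (card I) + 2 * int (h j) + int (card S) - 2 = 0" using cS by simp
      have "s j * q ^ card S / q\<^sup>2 = q powi (3 - int (card I) + 2 * int (h j) + int (card S) - 2)"
        using s[of j] j powi_mult[of _ "int (card S)"] powi_div[of _ 2] by simp
      then have "s j * q ^ card S / q\<^sup>2 = 1" unfolding e by simp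
      then have "out_fac (card S) (s j) = 0" by (simp add: out_fac_def)
      then show ?thesis using j by blast
    next
      case False
      then have "(m - 2) div 2 < m" using \<open>m > 0\<close> by auto
      then have "(m - 2) div 2 \<in> h ` (I - S)" using img' by simp
      then obtain j where j: "j \<in> I - S" "h j = (m - 2) div 2" by auto
      have "2 * int (h j) = int m - 2" using j(2) False \<open>m > 0\<close> by presburger
      then have e: "3 - int (card I) + 2 * int (h j) + int (card S) - 1 = 0" using cS by simp
      have "s j * q ^ card S / q = q powi (3 - int (card I) + 2 * int (h j) + int (card S) - 1)"
        using s[of j] j powi_mult[of _ "int (card S)"] powi_div[of _ 1] by simp
      then have "s j * q ^ card S / q = 1" unfolding e by simp
      then have "out_fac (card S) (s j) = 0" by (simp add: out_fac_def)
      then show ?thesis using j by blast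
    qed
    then have "(\<Prod>j\<in>I - S. out_fac (card S) (s j)) = 0" using fin by (meson prod_zero)
    then show ?thesis by (simp add: subset_term_def)
  qed
qed

lemma th_mult_reflect:
  assumes "b \<noteq> 0"
  shows "\<theta> (b * q powi k) = - (b * q powi k) * \<theta> (q powi (- k) / b)"
proof -
  have "1 / (q powi (- k) / b) = b * q powi k"
    by (simp add: power_int_minus field_simps)
  then show ?thesis
    using th_inverse[of "q powi (- k) / b"] assms q_nz by (simp add: power_int_minus field_simps)
qed

text \<open>The inside factors interleave by parity to one shifted factorial of base q and length
  2N, which extends (a)_N up to (a)_(3N+1). The factors with b, reflected to
  \<open>\<phi> k\<close>, run on both sides over the exponents from 1 - N to N, once consecutively
  and once split by parity. The powers of q cancel because 2 (N choose 2) = N^2 - N.\<close>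

lemma subset_term_string_full:
  assumes a: "a \<noteq> 0" and b: "b \<noteq> 0"
  shows "subset_coeff a b N N * (\<Prod>j<N. in_fac a N N (q powi (3 - int N + 2 * int j)))
    = eshift a q p (3 * N + 1) * (\<Prod>j<N. \<theta> (q powi (3 - int N + 2 * int j) / (b * q)) * \<theta> (b * q powi (3 - int N + 2 * int j) / q\<^sup>2))"
proof -
  define w where "w j = q powi (3 - int N + 2 * int j)" for j
  define \<phi> where "\<phi> k = \<theta> (q powi k / b)" for k
  have qn: "q ^ k = q powi int k" for k by simp
  have q1: "q = q powi 1" and q2: "q\<^sup>2 = q powi 2" by simp_all
  have in1: "(\<Prod>j<N. \<theta> (a * q ^ (2 * N + 1) / w j)) = (\<Prod>j<N. \<theta> (a * q ^ N * q ^ (2 * j)))"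
  proof (rule prod.reindex_bij_witness[of _ "\<lambda>j. N - Suc j" "\<lambda>j. N - Suc j"])
    fix j assume "j \<in> {..<N}"
    then have e: "int (2 * N + 1) - (3 - int N + 2 * int j) = int N + int (2 * (N - Suc j))" by simp
    have "q ^ (2 * N + 1) / w j = q ^ N * q ^ (2 * (N - Suc j))"
      unfolding w_def qn powi_div powi_mult e ..
    then show "\<theta> (a * q ^ N * q ^ (2 * (N - Suc j))) = \<theta> (a * q ^ (2 * N + 1) / w j)"
      by (metis mult.assoc times_divide_eq_right)
  qed auto
  have in2: "a * w j * q ^ (2 * N) / q\<^sup>2 = a * q ^ N * q ^ (2 * j + 1)" for j
  proof -
    have "w j * q ^ (2 * N) / q\<^sup>2 = q ^ N * q ^ (2 * j + 1)"
      unfolding w_def qn q2 powi_div powi_mult by (rule arg_cong[of _ _ "\<lambda>k. q powi k"]) simp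
    then show ?thesis by (metis mult.assoc times_divide_eq_right)
  qed
  have "(\<Prod>j<N. in_fac a N N (w j)) = (\<Prod>j<N. w j) * (\<Prod>j<N. \<theta> (a * q ^ (2 * N + 1) / w j)) * (\<Prod>j<N. \<theta> (a * w j * q ^ (2 * N) / q\<^sup>2))"
    by (simp only: in_fac_def prod.distrib)
  also have "\<dots> = (\<Prod>j<N. w j) * (\<Prod>j<N. \<theta> (a * q ^ N * q ^ (2 * j)) * \<theta> (a * q ^ N * q ^ (2 * j + 1)))"
    unfolding in1 in2 by (simp only: prod.distrib mult.assoc)
  also have "\<dots> = (\<Prod>j<N. w j) * eshift (a * q ^ N) q p (2 * N)"
    unfolding eshift_def prod_even_odd ..
  finally have inn: "(\<Prod>j<N. in_fac a N N (w j)) = (\<Prod>j<N. w j) * eshift (a * q ^ N) q p (2 * N)" .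
  have ea: "eshift a q p N * eshift (a * q ^ N) q p (2 * N) * \<theta> (a * q ^ (3 * N)) = eshift a q p (3 * N + 1)"
    using eshift_add[of a q p N "2 * N"] by (simp add: eshift_Suc)
  have rev: "(\<Prod>j<N. f (N - Suc j)) = (\<Prod>j<N. f j)" for f :: "nat \<Rightarrow> complex"
    by (rule prod.nat_diff_reindex)
  have eb: "eshift b q p N = (\<Prod>f<N. - (b * q ^ f)) * (\<Prod>f<N. \<phi> (- int f))"
    unfolding eshift_def prod.distrib[symmetric]
    by (rule prod.cong[OF refl]) (use th_mult_reflect[OF b] in \<open>simp only: qn \<phi>_def\<close>)
  have eqb: "eshift (q / b) q p N = (\<Prod>f<N. \<phi> (1 + int f))"
    unfolding eshift_def
  proof (rule prod.cong[OF refl])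
    fix f
    have "q / b * q ^ f = q powi (1 + int f) / b" unfolding powi_mult[symmetric] by simp
    then show "\<theta> (q / b * q ^ f) = \<phi> (1 + int f)" by (simp only: \<phi>_def)
  qed
  have \<Phi>: "(\<Prod>f<N. \<phi> (- int f)) * (\<Prod>f<N. \<phi> (1 + int f)) =
      (\<Prod>j<N. \<phi> (1 - int N + 2 * int j)) * (\<Prod>j<N. \<phi> (2 - int N + 2 * int j))"
  proof -
    have "(\<Prod>e<2 * N. \<phi> (1 - int N + int e)) = (\<Prod>j<N. \<phi> (1 - int N + 2 * int j)) * (\<Prod>j<N. \<phi> (2 - int N + 2 * int j))"
      unfolding prod_even_odd prod.distrib by (simp add: algebra_simps)
    moreover have "(\<Prod>e<2 * N. \<phi> (1 - int N + int e)) = (\<Prod>e<N. \<phi> (1 - int N + int e)) * (\<Prod>f<N. \<phi> (1 + int f))"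
    proof -
      have "(\<Prod>e<N + m. \<phi> (1 - int N + int e)) = (\<Prod>e<N. \<phi> (1 - int N + int e)) * (\<Prod>f<m. \<phi> (1 + int f))" for m
        by (induction m) (simp_all add: mult_ac)
      from this[of N] show ?thesis by (simp add: mult_2)
    qed
    moreover have "(\<Prod>e<N. \<phi> (1 - int N + int e)) = (\<Prod>f<N. \<phi> (- int f))"
    proof -
      have "(\<Prod>f<N. \<phi> (- int (N - Suc f))) = (\<Prod>f<N. \<phi> (- int f))"
        by (rule rev)
      moreover have "(\<Prod>f<N. \<phi> (- int (N - Suc f))) = (\<Prod>e<N. \<phi> (1 - int N + int e))"
        by (rule prod.cong[OF refl], rule arg_cong[of _ _ \<phi>]) auto
      ultimately show ?thesis by simp
    qed
    ultimately show ?thesis by simp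
  qed
  have r1: "\<theta> (w j / (b * q)) = \<phi> (2 - int N + 2 * int j)" for j
  proof -
    have "w j / (b * q) = (w j / q) / b" by simp
    also have "w j / q = q powi (3 - int N + 2 * int j - 1)"
      unfolding w_def powi_div[of _ 1, symmetric] by simp
    finally show ?thesis by (simp add: \<phi>_def algebra_simps)
  qed
  have r2: "(\<Prod>j<N. \<theta> (b * w j / q\<^sup>2)) = (\<Prod>j<N. - (b * q powi (1 - int N + 2 * int j))) * (\<Prod>j<N. \<phi> (1 - int N + 2 * int j))"
  proof -
    have "\<theta> (b * w j / q\<^sup>2) = - (b * q powi (1 - int N + 2 * int j)) * \<phi> (- (1 - int N + 2 * int j))" for j
    proof -
      have "w j / q\<^sup>2 = q powi (3 - int N + 2 * int j - 2)"
        unfolding w_def powi_div[of _ 2, symmetric] by simp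
      also have "3 - int N + 2 * int j - 2 = 1 - int N + 2 * int j" by simp
      finally have "b * w j / q\<^sup>2 = b * q powi (1 - int N + 2 * int j)"
        by (metis times_divide_eq_right)
      then show ?thesis unfolding \<phi>_def by (simp only: th_mult_reflect[OF b])
    qed
    then have "(\<Prod>j<N. \<theta> (b * w j / q\<^sup>2)) = (\<Prod>j<N. - (b * q powi (1 - int N + 2 * int j))) * (\<Prod>j<N. \<phi> (- (1 - int N + 2 * int j)))"
      by (simp only: prod.distrib)
    also have "(\<Prod>j<N. \<phi> (- (1 - int N + 2 * int j))) = (\<Prod>j<N. \<phi> (1 - int N + 2 * int j))"
    proof -
      have "(\<Prod>j<N. \<phi> (1 - int N + 2 * int (N - Suc j))) = (\<Prod>j<N. \<phi> (1 - int N + 2 * int j))"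
        by (rule rev)
      moreover have "(\<Prod>j<N. \<phi> (1 - int N + 2 * int (N - Suc j))) = (\<Prod>j<N. \<phi> (- (1 - int N + 2 * int j)))"
        by (rule prod.cong[OF refl], rule arg_cong[of _ _ \<phi>]) auto
      ultimately show ?thesis by simp
    qed
    finally show ?thesis .
  qed
  have mon: "q powi (3 * int (N choose 2) - 2 * int N * int N) * (\<Prod>j<N. w j) * (\<Prod>j<N. - (b * q ^ j))
      = (\<Prod>j<N. - (b * q powi (1 - int N + 2 * int j)))"
  proof -
    have "w j * - (b * q ^ j) = q ^ (j + 2) * - (b * q powi (1 - int N + 2 * int j))" for j
    proof -
      have "w j * q ^ j = q ^ (j + 2) * q powi (1 - int N + 2 * int j)"
        unfolding w_def qn powi_mult by (rule arg_cong[of _ _ "\<lambda>k. q powi k"]) simp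
      then show ?thesis by simp
    qed
    then have "(\<Prod>j<N. w j) * (\<Prod>j<N. - (b * q ^ j)) = (\<Prod>j<N. q ^ (j + 2)) * (\<Prod>j<N. - (b * q powi (1 - int N + 2 * int j)))"
      unfolding prod.distrib[symmetric] by (rule prod.cong[OF refl])
    moreover have "(\<Prod>j<N. q ^ (j + 2)) = q powi (int (N choose 2) + 2 * int N)"
    proof (induction N)
      case (Suc n)
      have "int (Suc n choose 2) + 2 * int (Suc n) = (int (n choose 2) + 2 * int n) + int (n + 2)"
        by (simp add: numeral_2_eq_2)
      then show ?case using Suc by (simp only: prod.lessThan_Suc qn powi_mult)
    qed (simp add: numeral_2_eq_2)
    moreover have "3 * int (N choose 2) - 2 * int N * int N + (int (N choose 2) + 2 * int N) = 0"
      using two_choose_2[of N] by simp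
    ultimately show ?thesis
      by (simp only: mult.assoc) (simp only: mult.assoc[symmetric] powi_mult power_int_0_right mult_1_left)
  qed
  have "subset_coeff a b N N * (\<Prod>j<N. in_fac a N N (w j)) =
     (eshift a q p N * eshift (a * q ^ N) q p (2 * N) * \<theta> (a * q ^ (3 * N)))
     * (q powi (3 * int (N choose 2) - 2 * int N * int N) * (\<Prod>j<N. w j) * (\<Prod>j<N. - (b * q ^ j)))
     * ((\<Prod>f<N. \<phi> (- int f)) * (\<Prod>f<N. \<phi> (1 + int f)))"
    unfolding subset_coeff_def inn eb eqb diff_self_eq_0 eshift_0 by (simp only: mult_ac mult_1_left)
  also have "\<dots> = eshift a q p (3 * N + 1) * ((\<Prod>j<N. \<theta> (w j / (b * q))) * (\<Prod>j<N. \<theta> (b * w j / q\<^sup>2)))"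
    unfolding ea mon \<Phi> r1 r2 by (simp only: mult_ac)
  finally show ?thesis by (simp only: w_def prod.distrib)
qed

lemma subset_diff_string:
  assumes I: "finite I" and h: "bij_betw h I {..<card I}"
    and s: "\<And>i. i \<in> I \<Longrightarrow> s i = q powi (3 - int (card I) + 2 * int (h i))" and a: "a \<noteq> 0" and b: "b \<noteq> 0"
  shows "subset_diff a b s I = 0"
proof -
  let ?w = "\<lambda>j. q powi (3 - int (card I) + 2 * int j)"
  have re: "(\<Prod>i\<in>I. f (s i)) = (\<Prod>j<card I. f (?w j))" for f :: "complex \<Rightarrow> complex"
    using prod.reindex_bij_betw[OF h, of "\<lambda>j. f (?w j)"] s by simp
  have "(\<Sum>S\<in>Pow I. subset_term a b s I S) = (\<Sum>S\<in>{I}. subset_term a b s I S)"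
    by (rule sum.mono_neutral_right) (use I subset_term_string_proper[OF I h _ s] in auto)
  also have "\<dots> = subset_coeff a b (card I) (card I) * (\<Prod>i\<in>I. in_fac a (card I) (card I) (s i))"
    by (simp add: subset_term_def)
  also have "\<dots> = subset_rhs a b s I"
    unfolding re subset_rhs_def re[of "\<lambda>x. \<theta> (x / (b * q)) * \<theta> (b * x / q\<^sup>2)"]
    by (rule subset_term_string_full[OF a b])
  finally show ?thesis by (simp add: subset_diff_def)
qed

section \<open>From the string to arbitrary variables\<close>

lemma subset_diff_generic:
  assumes I: "finite I" and a: "a \<noteq> 0" and b: "b \<noteq> 0" and u: "\<And>i. i \<in> I \<Longrightarrow> u i \<noteq> 0"
    and dist: "\<And>i j. i \<in> I \<Longrightarrow> j \<in> I \<Longrightarrow> i \<noteq> j \<Longrightarrow> \<theta> (u i / u j) \<noteq> 0"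
    and IH: "\<And>J w. J \<subset> I \<Longrightarrow> (\<And>i. i \<in> J \<Longrightarrow> w i \<noteq> 0) \<Longrightarrow>
       (\<And>i j. i \<in> J \<Longrightarrow> j \<in> J \<Longrightarrow> i \<noteq> j \<Longrightarrow> \<theta> (w i / w j) \<noteq> 0) \<Longrightarrow> subset_diff a b w J = 0"
    and g1: "\<And>i k. i \<in> I \<Longrightarrow> \<theta> (u i / q powi k) \<noteq> 0"
    and g2: "\<And>i. i \<in> I \<Longrightarrow> \<theta> (u i / (a * q ^ (2 * card I + 1))) \<noteq> 0"
    and g3: "\<And>k. \<theta> (a * q powi k) \<noteq> 0"
  shows "subset_diff a b u I = 0"
proof -
  obtain h where "bij_betw h I {0..<card I}" using ex_bij_betw_finite_nat[OF I] by blast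
  then have h: "bij_betw h I {..<card I}" by (simp add: atLeast0LessThan)
  define e where "e i = 3 - int (card I) + 2 * int (h i)" for i
  define s where "s i = q powi e i" for i
  define \<alpha> where "\<alpha> = a * q ^ (2 * card I + 1)"
  define w where "w T i = (if i \<in> T then u i else s i)" for T i
  have \<alpha>: "\<alpha> \<noteq> 0" using a q_nz by (simp add: \<alpha>_def)
  have s0: "s i \<noteq> 0" for i using q_nz by (simp add: s_def)
  have w0: "w T i \<noteq> 0" if "i \<in> I" for T i using that s0 u by (simp add: w_def)
  have hij: "h i \<noteq> h j" if "i \<in> I" "j \<in> I" "i \<noteq> j" for i j
    using h that by (auto simp: bij_betw_def inj_on_def)
  have wd: "\<theta> (w T i / w T j) \<noteq> 0" if ij: "i \<in> I" "j \<in> I" "i \<noteq> j" for T i j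
  proof -
    have "e i - e j \<noteq> 0" using hij[OF ij] by (simp add: e_def)
    then have "\<theta> (s i / s j) \<noteq> 0" unfolding s_def powi_div by (rule q_generic)
    moreover have "\<theta> (u i / s j) \<noteq> 0" unfolding s_def by (rule g1[OF ij(1)])
    moreover have "\<theta> (s i / u j) \<noteq> 0"
      using th_swap_nz[OF u[OF ij(2)] s0] g1[OF ij(2), of "e i"] by (simp only: s_def not_False_eq_True)
    ultimately show ?thesis using dist[OF ij] by (simp only: w_def split: if_splits) simp
  qed
  have \<alpha>w: "\<theta> (\<alpha> / w T i) \<noteq> 0" if "i \<in> I" for T i
  proof -
    have "\<theta> (\<alpha> / u i) \<noteq> 0"
      using th_swap_nz[OF u[OF that] \<alpha>] g2[OF that] by (simp only: \<alpha>_def not_False_eq_True)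
    moreover have "\<alpha> / s i = a * q powi (int (2 * card I + 1) - e i)"
      unfolding powi_div[symmetric] s_def \<alpha>_def by (simp only: power_int_of_nat times_divide_eq_right)
    ultimately show ?thesis using g3 by (simp add: w_def)
  qed
  \<comment> \<open>\<open>w T\<close> has the given values on T and string values elsewhere. When t
    joins T, the previous stage provides the zero at \<open>s t\<close>, and
    \<open>subset_diff_special\<close> with the hypothesis for \<open>I - {t}\<close> provides the
    zero at \<alpha>. The conditions \<open>g1\<close>, \<open>g2\<close>, \<open>g3\<close> keep
    the nodes apart and \<open>\<alpha> * s t / q ^ 3\<close> away from the zeros of theta.\<close>
  have "subset_diff a b (w T) I = 0" if "finite T" "T \<subseteq> I" for T
    using that
  proof (induction T rule: finite_induct)
    case empty
    show ?case by (rule subset_diff_string[OF I h _ a b]) (simp add: w_def s_def e_def)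
  next
    case (insert t T)
    let ?J = "I - {t}"
    have t: "t \<in> I" using insert.prems by simp
    have J: "finite ?J" "t \<notin> ?J" "insert t ?J = I" using I t by auto
    have ws: "w T t = s t" using insert.hyps by (simp add: w_def)
    have upd: "w (insert t T) = (w T)(t := u t)" "w T = (w T)(t := s t)"
      using insert.hyps by (auto simp: w_def fun_eq_iff)
    have "subset_diff a b ((w T)(t := u t)) (insert t ?J) = 0"
    proof (rule subset_diff_vary[where ?s1.0 = \<alpha> and ?s2.0 = "s t", OF J(1,2) _ a b])
      show "\<theta> (\<alpha> / s t) \<noteq> 0" using \<alpha>w[OF t, of T] unfolding ws .
      have "\<alpha> * s t / q ^ 3 = a * (q powi int (2 * card I + 1) * q powi e t / q powi 3)"
        unfolding s_def \<alpha>_def power_int_of_nat power_int_numeral by simp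
      also have "\<dots> = a * q powi (int (2 * card I + 1) + e t - 3)"
        by (simp only: powi_mult powi_div)
      finally have "\<alpha> * s t / q ^ 3 = a * q powi (int (2 * card I + 1) + e t - 3)" .
      then show "\<theta> (\<alpha> * s t / q ^ 3) \<noteq> 0" using g3 by simp
      show "\<theta> (s t / w T i) \<noteq> 0" if "i \<in> ?J" for i
        using wd[OF t, of i T] that unfolding ws by auto
      show "\<theta> (u t / w T i) \<noteq> 0" if "i \<in> ?J" for i
        using wd[OF t, of i "insert t T"] that unfolding upd(1) by auto
      show "subset_diff a b ((w T)(t := s t)) (insert t ?J) = 0"
        unfolding upd(2)[symmetric] J(3) using insert by simp
      show "subset_diff a b ((w T)(t := \<alpha>)) (insert t ?J) = 0"
        unfolding J(3)
      proof (rule subset_diff_special[OF I t a])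
        show "subset_diff a b ((w T)(t := \<alpha>)) ?J = 0"
          by (rule IH) (use t w0 wd in auto)
      qed (use \<alpha> w0 \<alpha>w in \<open>auto simp: \<alpha>_def\<close>)
    qed (use wd w0 \<alpha> \<alpha>w s0 u t in auto)
    then show ?case unfolding upd(1) J(3) .
  qed
  from this[OF I] have "subset_diff a b (w I) I = 0" by simp
  moreover have "subset_diff a b (w I) I = subset_diff a b u I"
  proof -
    have eq: "w I i = u i" if "i \<in> I" for i using that by (simp add: w_def)
    have "subset_term a b (w I) I S = subset_term a b u I S" if "S \<in> Pow I" for S
    proof -
      have "S \<subseteq> I" using that by simp
      have "(\<Prod>i\<in>S. \<Prod>j\<in>I - S. vfac (w I i) (w I j)) = (\<Prod>i\<in>S. \<Prod>j\<in>I - S. vfac (u i) (u j))"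
        using \<open>S \<subseteq> I\<close> by (intro prod.cong refl) (auto simp: eq subset_iff)
      moreover have "(\<Prod>j\<in>I - S. out_fac (card S) (w I j)) = (\<Prod>j\<in>I - S. out_fac (card S) (u j))"
        by (intro prod.cong refl) (auto simp: eq)
      moreover have "(\<Prod>i\<in>S. in_fac a (card I) (card S) (w I i)) = (\<Prod>i\<in>S. in_fac a (card I) (card S) (u i))"
        using \<open>S \<subseteq> I\<close> by (intro prod.cong refl) (auto simp: eq subset_iff)
      ultimately show ?thesis by (simp add: subset_term_def)
    qed
    moreover have "subset_rhs a b (w I) I = subset_rhs a b u I"
      by (simp add: subset_rhs_def eq)
    ultimately show ?thesis by (simp add: subset_diff_def)
  qed
  ultimately show ?thesis by simp
qed

lemma countable_th_linear:
  assumes "c \<noteq> 0" shows "countable {t. \<theta> (c * t) = 0}"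
proof (rule countable_subset)
  show "{t. \<theta> (c * t) = 0} \<subseteq> (\<lambda>z. z / c) ` {z. \<theta> z = 0}"
    using assms by (auto intro!: image_eqI[of _ _ "c * _"])
qed (use countable_etheta_zeros[OF norm_p] in auto)

lemma countable_th_square:
  assumes "c \<noteq> 0" shows "countable {t. \<theta> (c * t\<^sup>2) = 0}"
proof (rule countable_subset)
  let ?Z = "{t. \<theta> (c * t) = 0}"
  show "{t. \<theta> (c * t\<^sup>2) = 0} \<subseteq> csqrt ` ?Z \<union> (\<lambda>z. - csqrt z) ` ?Z"
  proof
    fix t assume t: "t \<in> {t. \<theta> (c * t\<^sup>2) = 0}"
    have "(csqrt (t\<^sup>2))\<^sup>2 = t\<^sup>2" by simp
    then have "t = csqrt (t\<^sup>2) \<or> t = - csqrt (t\<^sup>2)" by (metis power2_eq_iff)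
    then show "t \<in> csqrt ` ?Z \<union> (\<lambda>z. - csqrt z) ` ?Z" using t by blast
  qed
qed (use countable_th_linear[OF assms] in auto)

text \<open>A common scaling of the u i leaves every \<open>vfac\<close> unchanged, so the theta
  functions in denominators are constant in t, and all other theta arguments stay nonzero.\<close>

lemma continuous_subset_diff:
  assumes I: "finite I" and a: "a \<noteq> 0" and b: "b \<noteq> 0" and u: "\<And>i. i \<in> I \<Longrightarrow> u i \<noteq> 0"
  shows "continuous_on (- {0}) (\<lambda>t. subset_diff (a * t) b (\<lambda>i. u i * t\<^sup>2) I)"
proof -
  have V: "vfac (x * t\<^sup>2) (y * t\<^sup>2) = vfac x y" if "t \<noteq> 0" for x y t
    using that by (simp add: vfac_def)
  have eq: "subset_diff (a * t) b (\<lambda>i. u i * t\<^sup>2) I =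
     (\<Sum>S\<in>Pow I. subset_coeff (a * t) b (card I) (card S) * (\<Prod>i\<in>S. \<Prod>j\<in>I - S. vfac (u i) (u j))
     * (\<Prod>j\<in>I - S. out_fac (card S) (u j * t\<^sup>2)) * (\<Prod>i\<in>S. in_fac (a * t) (card I) (card S) (u i * t\<^sup>2)))
     - subset_rhs (a * t) b (\<lambda>i. u i * t\<^sup>2) I" (is "_ = ?F t") if "t \<in> - {0}" for t
    using that by (simp add: subset_diff_def subset_term_def V)
  have S: "i \<in> I" if "i \<in> S" "S \<in> Pow I" for i S using that by auto
  have "continuous_on (- {0}) ?F"
    unfolding subset_coeff_def out_fac_def in_fac_def subset_rhs_def
    by (intro continuous_on_diff continuous_on_sum continuous_on_mult continuous_on_prod
        continuous_on_eshift[OF norm_p] continuous_on_etheta[OF norm_p] continuous_on_const)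
      (auto intro!: continuous_intros simp: a b q_nz u S)
  then show ?thesis
    by (rule continuous_on_eq[OF _ eq[symmetric]])
qed

text \<open>Under the weights 1 for a and 2 for the u i, the arguments u_i/q^k, u_i/(a q^(2N+1)) and
  a q^k acquire the factors t^2, t and t, so each generic condition excludes only countably many t;
  t = 1 is recovered by continuity. The induction is over all a and u at once because the hypothesis
  is applied at the scaled a.\<close>

theorem subset_identity:
  assumes "finite I" and "a \<noteq> 0" and b: "b \<noteq> 0" and "\<And>i. i \<in> I \<Longrightarrow> u i \<noteq> 0"
    and "\<And>i j. i \<in> I \<Longrightarrow> j \<in> I \<Longrightarrow> i \<noteq> j \<Longrightarrow> \<theta> (u i / u j) \<noteq> 0"
  shows "(\<Sum>S\<in>Pow I. subset_term a b u I S) = subset_rhs a b u I"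
proof -
  have "subset_diff a b u I = 0"
    using assms
  proof (induction I arbitrary: a u rule: finite_psubset_induct)
    case (psubset I a u)
    define B where "B = (\<Union>i\<in>I. \<Union>k::int. {t. \<theta> (u i / q powi k * t\<^sup>2) = 0})
      \<union> (\<Union>i\<in>I. {t. \<theta> (u i / (a * q ^ (2 * card I + 1)) * t) = 0}) \<union> (\<Union>k::int. {t. \<theta> (a * q powi k * t) = 0})"
    have "countable B"
      unfolding B_def using psubset.prems q_nz psubset.hyps
      by (intro countable_Un countable_UN countable_th_linear countable_th_square)
         (auto intro: countable_finite)
    moreover have "subset_diff (a * t) b (\<lambda>i. u i * t\<^sup>2) I = 0" if t: "t \<noteq> 0" "t \<notin> B" for t
    proof (rule subset_diff_generic[OF psubset.hyps _ b])
      show "subset_diff (a * t) b w J = 0" if "J \<subset> I" "\<And>i. i \<in> J \<Longrightarrow> w i \<noteq> 0"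
        "\<And>i j. i \<in> J \<Longrightarrow> j \<in> J \<Longrightarrow> i \<noteq> j \<Longrightarrow> \<theta> (w i / w j) \<noteq> 0" for J w
        by (rule psubset.IH[OF that(1) _ b that(2,3)]) (use t psubset.prems in auto)
      show "\<theta> (u i * t\<^sup>2 / q powi k) \<noteq> 0" if "i \<in> I" for i k
      proof -
        have "u i * t\<^sup>2 / q powi k = u i / q powi k * t\<^sup>2" by simp
        moreover have "\<theta> (u i / q powi k * t\<^sup>2) \<noteq> 0" using t that unfolding B_def by blast
        ultimately show ?thesis by (simp only: not_False_eq_True)
      qed
      show "\<theta> (u i * t\<^sup>2 / (a * t * q ^ (2 * card I + 1))) \<noteq> 0" if "i \<in> I" for i
      proof -
        have "u i * t\<^sup>2 / (a * t * q ^ (2 * card I + 1)) = u i / (a * q ^ (2 * card I + 1)) * t"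
          using t by (simp add: power2_eq_square)
        moreover have "\<theta> (u i / (a * q ^ (2 * card I + 1)) * t) \<noteq> 0" using t that unfolding B_def by blast
        ultimately show ?thesis by (simp only: not_False_eq_True)
      qed
      show "\<theta> (a * t * q powi k) \<noteq> 0" for k
      proof -
        have "a * t * q powi k = a * q powi k * t" by simp
        moreover have "\<theta> (a * q powi k * t) \<noteq> 0" using t unfolding B_def by blast
        ultimately show ?thesis by (simp only: not_False_eq_True)
      qed
      show "\<theta> (u i * t\<^sup>2 / (u j * t\<^sup>2)) \<noteq> 0" if "i \<in> I" "j \<in> I" "i \<noteq> j" for i j
        using psubset.prems(4)[OF that] t(1) by simp
    qed (use psubset.prems t in auto)
    ultimately have "subset_diff (a * 1) b (\<lambda>i. u i * 1\<^sup>2) I = 0"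
      using continuous_eq_0_off_countable[OF continuous_subset_diff[OF psubset.hyps psubset.prems(1) b psubset.prems(3)],
          where B = B and w = 1] by simp
    then show ?case by simp
  qed
  then show ?thesis by (simp add: subset_diff_def)
qed

section \<open>Reduction of the multiple sum to subsets\<close>

lemma mult_q_power: "x * q ^ m = x * q powi int m"
  by simp

lemma div_q_power: "x / q ^ m = x * q powi (- int m)"
  by (simp add: power_int_minus divide_inverse)

lemma mult_powi_powi: "x * q powi k * q powi l = x * q powi (k + l)"
  by (simp only: mult.assoc powi_mult)

lemmas q_monomial = mult_q_power div_q_power mult_powi_powi

lemma prod_powi: "(\<Prod>j<l. q powi (c + int j)) = q powi (int l * c + int (l choose 2))"
proof (induction l)
  case (Suc l)
  have "int l * c + int (l choose 2) + (c + int l) = int (Suc l) * c + int (Suc l choose 2)"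
    by (simp add: numeral_2_eq_2 algebra_simps)
  then show ?case using Suc by (simp only: prod.lessThan_Suc powi_mult)
qed (simp add: numeral_2_eq_2)

text \<open>Inversion \<theta>(1/x) = -\<theta>(x)/x in every factor reverses the direction of the
  exponents; reading the product backwards restores base q.\<close>

lemma eshift_reflect:
  assumes "D \<noteq> 0"
  shows "eshift (D * q powi (e - int k + 1)) q p k
    = eshift (q powi (- e) / D) q p k * (\<Prod>j<k. - (D * q powi (e - int j)))"
proof -
  have "eshift (D * q powi (e - int k + 1)) q p k = (\<Prod>j<k. \<theta> (D * q powi (e - int j)))"
    unfolding eshift_def
  proof (rule prod.reindex_bij_witness[of _ "\<lambda>j. k - Suc j" "\<lambda>j. k - Suc j"])
    fix j assume "j \<in> {..<k}"
    then have e: "e - int (k - Suc j) = e - int k + 1 + int j" by simp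
    show "\<theta> (D * q powi (e - int (k - Suc j))) = \<theta> (D * q powi (e - int k + 1) * q ^ j)"
      unfolding q_monomial e ..
  qed auto
  also have "\<dots> = (\<Prod>j<k. \<theta> (q powi (- e) / D * q ^ j) * - (D * q powi (e - int j)))"
  proof (rule prod.cong[OF refl])
    fix j
    have "q powi (- e) * q ^ j = q powi (- e + int j)"
      by (simp only: powi_mult[symmetric] power_int_of_nat)
    also have "- e + int j = - (e - int j)" by simp
    finally have "q powi (- e) / D * q ^ j = q powi (- (e - int j)) / D"
      by (metis times_divide_eq_left)
    then show "\<theta> (D * q powi (e - int j)) = \<theta> (q powi (- e) / D * q ^ j) * - (D * q powi (e - int j))"
      using th_mult_reflect[OF assms, of "e - int j"] by (simp only: mult.commute)
  qed
  finally show ?thesis by (simp only: prod.distrib eshift_def)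
qed

text \<open>The contribution of one index i, with D = d/(a x_i) and K = |k|, times its share of the
  common denominator. The shifted factorial of length 2n + K - k starting at D q^(-2n) is split in
  two ways: after 2n factors, or after K and K + 2(n - k) factors. The middle piece of the second
  splitting consists of the outside factors, and the reflected last piece cancels a denominator. The
  other shifted factorials, with the monomials of that reflection, yield the inside factors.\<close>

lemma single_factor:
  assumes D: "D \<noteq> 0" and a: "a \<noteq> 0" and k: "k \<le> n" "k \<le> K"
    and nz1: "eshift (D * q powi (- 2 * int n)) q p K \<noteq> 0"
    and nz2: "eshift (a * D) (q\<^sup>2) p (K - k) \<noteq> 0"
    and nz3: "eshift (q powi (int k - int K + 1) / D) q p k \<noteq> 0"
  shows "(eshift (a * q ^ (2 * N + 1) / D) (q\<^sup>2) p k * eshift (a * D) (q\<^sup>2) p K * eshift D q p (K - k))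
     / (eshift (D * q powi (- 2 * int n)) q p K * eshift (a * D) (q\<^sup>2) p (K - k)
        * eshift (q powi (int k - int K + 1) / D) q p k)
     * eshift (D * q powi (- 2 * int n)) q p (2 * n)
   = (-1) ^ k * q powi (int k * int K - 2 * int k - int (k choose 2))
     * ((\<Prod>m\<in>{k..<n}. out_fac K (D / q ^ (2 * m))) * (\<Prod>m<k. in_fac a N K (D / q ^ (2 * m))))"
proof -
  define Dn where "Dn = D * q powi (- 2 * int n)"
  define H1 where "H1 = (\<Prod>m<k. \<theta> (a * q ^ (2 * N + 1) / (D / q ^ (2 * m))))"
  define H2 where "H2 = (\<Prod>m<k. \<theta> (a * (D / q ^ (2 * m)) * q ^ (2 * K) / q\<^sup>2))"
  define M where "M = (\<Prod>j<k. - (D * q powi (int K - int k - 1 - int j)))"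
  have 1: "eshift (a * q ^ (2 * N + 1) / D) (q\<^sup>2) p k = H1"
    unfolding eshift_def H1_def by (simp add: power_mult)
  have 2: "eshift (a * D) (q\<^sup>2) p K = eshift (a * D) (q\<^sup>2) p (K - k) * H2"
  proof -
    have "eshift (a * D) (q\<^sup>2) p ((K - k) + k) = eshift (a * D) (q\<^sup>2) p (K - k) * eshift (a * D * (q\<^sup>2) ^ (K - k)) (q\<^sup>2) p k"
      by (rule eshift_add)
    moreover have "eshift (a * D * (q\<^sup>2) ^ (K - k)) (q\<^sup>2) p k = H2"
      unfolding eshift_def H2_def
    proof (rule prod.reindex_bij_witness[of _ "\<lambda>j. k - Suc j" "\<lambda>j. k - Suc j"])
      fix j assume j: "j \<in> {..<k}"
      have e: "int (2 * (K - k)) + int (2 * j) = - int (2 * (k - Suc j)) + int (2 * K) + - int 2"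
        using j k by simp
      have "a * D * (q\<^sup>2) ^ (K - k) * (q\<^sup>2) ^ j = a * D * q powi (int (2 * (K - k)) + int (2 * j))"
        unfolding power_mult[symmetric] q_monomial ..
      also have "\<dots> = a * D / q ^ (2 * (k - Suc j)) * q ^ (2 * K) / q ^ 2"
        unfolding q_monomial e ..
      finally show "\<theta> (a * (D / q ^ (2 * (k - Suc j))) * q ^ (2 * K) / q\<^sup>2) = \<theta> (a * D * (q\<^sup>2) ^ (K - k) * (q\<^sup>2) ^ j)"
        by simp
    qed auto
    ultimately show ?thesis using k by simp
  qed
  have out: "(\<Prod>m\<in>{k..<n}. out_fac K (D / q ^ (2 * m))) = eshift (Dn * q ^ K) q p (2 * (n - k))"
  proof -
    have "eshift (Dn * q ^ K) q p (2 * (n - k)) = (\<Prod>j<n - k. \<theta> (Dn * q ^ K * q ^ (2 * j)) * \<theta> (Dn * q ^ K * q ^ (2 * j + 1)))"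
      unfolding eshift_def by (rule prod_even_odd)
    also have "\<dots> = (\<Prod>m\<in>{k..<n}. out_fac K (D / q ^ (2 * m)))"
    proof (rule prod.reindex_bij_witness[of _ "\<lambda>m. n - Suc m" "\<lambda>j. n - Suc j"])
      fix j assume j: "j \<in> {..<n - k}"
      then have e: "- 2 * int n + int K + int (2 * j) = - int (2 * (n - Suc j)) + int K + - int 2"
        "- 2 * int n + int K + int (2 * j + 1) = - int (2 * (n - Suc j)) + int K + - int 1" by auto
      have "Dn * q ^ K * q ^ (2 * j) = D / q ^ (2 * (n - Suc j)) * q ^ K / q ^ 2"
        "Dn * q ^ K * q ^ (2 * j + 1) = D / q ^ (2 * (n - Suc j)) * q ^ K / q ^ 1"
        unfolding Dn_def q_monomial e by (rule refl)+
      then show "out_fac K (D / q ^ (2 * (n - Suc j))) = \<theta> (Dn * q ^ K * q ^ (2 * j)) * \<theta> (Dn * q ^ K * q ^ (2 * j + 1))"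
        by (simp only: out_fac_def power_one_right mult.commute)
    qed auto
    finally show ?thesis ..
  qed
  have 3: "eshift D q p (K - k) * eshift Dn q p (2 * n) =
      eshift Dn q p K * eshift (Dn * q ^ K) q p (2 * (n - k)) * eshift (D * q powi (int K - int k - 1 - int k + 1)) q p k"
  proof -
    have "eshift Dn q p (2 * n + (K - k)) = eshift Dn q p (2 * n) * eshift D q p (K - k)"
      unfolding eshift_add Dn_def q_monomial by simp
    moreover have "eshift Dn q p (K + 2 * (n - k) + k) =
      eshift Dn q p K * eshift (Dn * q ^ K) q p (2 * (n - k)) * eshift (D * q powi (int K - int k - 1 - int k + 1)) q p k"
    proof -
      have "- 2 * int n + int (K + 2 * (n - k)) = int K - int k - 1 - int k + 1" using k by simp
      then have "Dn * q ^ (K + 2 * (n - k)) = D * q powi (int K - int k - 1 - int k + 1)"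
        unfolding Dn_def q_monomial by simp
      then show ?thesis by (simp only: eshift_add)
    qed
    moreover have "2 * n + (K - k) = K + 2 * (n - k) + k" using k by simp
    ultimately show ?thesis by (simp only: mult.commute)
  qed
  have 4: "eshift (D * q powi (int K - int k - 1 - int k + 1)) q p k = eshift (q powi (int k - int K + 1) / D) q p k * M"
    using eshift_reflect[OF D, of "int K - int k - 1" k] by (simp add: M_def algebra_simps)
  have 5: "M = (-1) ^ k * q powi (int k * int K - 2 * int k - int (k choose 2)) * (\<Prod>m<k. D / q ^ (2 * m))"
  proof -
    have "- (D * q powi (int K - int k - 1 - int j)) = (-1) * q powi (int K - int k - 1 + int j) * (D / q ^ (2 * j))" for j
    proof -
      have "D / q ^ (2 * j) * q powi (int K - int k - 1 + int j) = D * q powi (int K - int k - 1 - int j)"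
        unfolding q_monomial by (simp add: algebra_simps)
      then show ?thesis by (simp add: mult_ac)
    qed
    then have "M = (-1) ^ k * (\<Prod>j<k. q powi (int K - int k - 1 + int j)) * (\<Prod>m<k. D / q ^ (2 * m))"
      unfolding M_def by (simp only: prod.distrib prod_constant card_lessThan)
    moreover have "int k * (int K - int k - 1) + int (k choose 2) = int k * int K - 2 * int k - int (k choose 2)"
      using two_choose_2[of k] by (simp add: algebra_simps)
    ultimately show ?thesis by (simp only: prod_powi)
  qed
  have inn: "(\<Prod>m<k. in_fac a N K (D / q ^ (2 * m))) = (\<Prod>m<k. D / q ^ (2 * m)) * H1 * H2"
    unfolding in_fac_def H1_def H2_def by (simp only: prod.distrib)
  have alg: "(H1 * (A3 * H2) * A4) / (A5 * A3 * A6) * B = s * w * (U * (P * H1 * H2))"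
    if "A4 * B = A5 * U * (A6 * (s * w * P))" "A3 \<noteq> 0" "A5 \<noteq> 0" "A6 \<noteq> 0" for A3 A4 A5 A6 B U P s w :: complex
  proof -
    have "(H1 * (A3 * H2) * A4) / (A5 * A3 * A6) * B = H1 * H2 * (A4 * B) / (A5 * A6)"
      using that(2) by simp
    also have "\<dots> = s * w * (U * (P * H1 * H2))"
      unfolding that(1) using that(3,4) by simp
    finally show ?thesis .
  qed
  show ?thesis
    unfolding 1 2 out inn Dn_def[symmetric]
    by (rule alg[OF _ nz2 _ nz3]) (use 3[unfolded 4 5] nz1 in \<open>simp_all only: Dn_def not_False_eq_True\<close>)
qed

text \<open>Reflection carries the factors of one side to those of the other. The monomials it
  produces multiply to 1 when those of index m in the first two products are grouped with those of
  2m and 2m + 1 in the third.\<close>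

lemma single_rhs:
  assumes D: "D \<noteq> 0" and b: "b \<noteq> 0"
  shows "(\<Prod>m<n. \<theta> (D / q ^ (2 * m) / (b * q)) * \<theta> (b * (D / q ^ (2 * m)) / q\<^sup>2)) * eshift (q / D) q p (2 * n)
    = eshift (b * q / D) (q\<^sup>2) p n * eshift (q\<^sup>2 / (b * D)) (q\<^sup>2) p n * eshift (D * q powi (- 2 * int n)) q p (2 * n)"
proof -
  have 1: "eshift (b * q / D) (q\<^sup>2) p n = (\<Prod>m<n. - (b * q * q ^ (2 * m) / D) * \<theta> (D / q ^ (2 * m) / (b * q)))"
    unfolding eshift_def q_square_power
  proof (rule prod.cong[OF refl])
    fix m
    have "\<theta> ((b * q * q ^ (2 * m)) / D) = - (b * q * q ^ (2 * m) / D) * \<theta> (D / (b * q * q ^ (2 * m)))"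
      using D b q_nz by (intro th_swap) auto
    then show "\<theta> (b * q / D * q ^ (2 * m)) = - (b * q * q ^ (2 * m) / D) * \<theta> (D / q ^ (2 * m) / (b * q))"
      by (simp add: mult.commute mult.left_commute)
  qed
  have 2: "eshift (q\<^sup>2 / (b * D)) (q\<^sup>2) p n = (\<Prod>m<n. - (q\<^sup>2 * q ^ (2 * m) / (b * D)) * \<theta> (b * (D / q ^ (2 * m)) / q\<^sup>2))"
    unfolding eshift_def q_square_power
  proof (rule prod.cong[OF refl])
    fix m
    have "\<theta> ((q\<^sup>2 * q ^ (2 * m)) / (b * D)) = - (q\<^sup>2 * q ^ (2 * m) / (b * D)) * \<theta> (b * D / (q\<^sup>2 * q ^ (2 * m)))"
      using D b q_nz by (intro th_swap) auto
    then show "\<theta> (q\<^sup>2 / (b * D) * q ^ (2 * m)) = - (q\<^sup>2 * q ^ (2 * m) / (b * D)) * \<theta> (b * (D / q ^ (2 * m)) / q\<^sup>2)"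
      by (simp add: mult.commute mult.left_commute)
  qed
  have 3: "eshift (D * q powi (- 2 * int n)) q p (2 * n) = eshift (q / D) q p (2 * n) * (\<Prod>j<2 * n. - (D * q powi (- 1 - int j)))"
    using eshift_reflect[OF D, of "-1" "2 * n"] by simp
  have 4: "(\<Prod>m<n. - (b * q * q ^ (2 * m) / D)) * (\<Prod>m<n. - (q\<^sup>2 * q ^ (2 * m) / (b * D))) * (\<Prod>j<2 * n. - (D * q powi (- 1 - int j))) = 1"
  proof -
    have "- (b * q * q ^ (2 * m) / D) * - (q\<^sup>2 * q ^ (2 * m) / (b * D)) * (- (D * q powi (- 1 - int (2 * m))) * - (D * q powi (- 1 - int (2 * m + 1)))) = 1" for m
    proof -
      have "q * q ^ (2 * m) * q powi (- 1 - int (2 * m)) = 1"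
        unfolding mult_q_power mult_powi_powi using q_nz by (simp add: power_int_diff power_int_minus)
      moreover have "q\<^sup>2 * q ^ (2 * m) * q powi (- 1 - int (2 * m + 1)) = 1"
      proof -
        have "q\<^sup>2 * q ^ (2 * m) * q powi (- 1 - int (2 * m + 1)) = q powi (int 2 + int (2 * m) + (- 1 - int (2 * m + 1)))"
          by (simp only: powi_mult[symmetric] power_int_of_nat)
        also have "int 2 + int (2 * m) + (- 1 - int (2 * m + 1)) = 0" by simp
        finally show ?thesis by simp
      qed
      moreover have "- (b * x / D) * - (y / (b * D)) * (- (D * x') * - (D * y')) = (x * x') * (y * y')" for x y x' y'
        using D b by simp
      ultimately show ?thesis by (simp only: mult.assoc) (simp only: mult_1_left mult.assoc[symmetric])
    qed
    then show ?thesis unfolding prod_even_odd prod.distrib[symmetric] by simp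
  qed
  have "eshift (b * q / D) (q\<^sup>2) p n * eshift (q\<^sup>2 / (b * D)) (q\<^sup>2) p n * eshift (D * q powi (- 2 * int n)) q p (2 * n) =
    (\<Prod>m<n. \<theta> (D / q ^ (2 * m) / (b * q)) * \<theta> (b * (D / q ^ (2 * m)) / q\<^sup>2)) * eshift (q / D) q p (2 * n) *
    ((\<Prod>m<n. - (b * q * q ^ (2 * m) / D)) * (\<Prod>m<n. - (q\<^sup>2 * q ^ (2 * m) / (b * D))) * (\<Prod>j<2 * n. - (D * q powi (- 1 - int j))))"
    unfolding 1 2 3 by (simp only: prod.distrib mult_ac)
  then show ?thesis unfolding 4 by simp
qed

lemma prod_powi_sum: "(\<Prod>i\<in>A. q powi f i) = q powi (\<Sum>i\<in>A. f i)"
  by (induction A rule: infinite_finite_induct) (simp_all add: powi_mult[symmetric])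

section \<open>Vandermonde products and double products of shifted factorials\<close>

lemma pochhammer_pair:
  assumes x: "x \<noteq> 0" and y: "y \<noteq> 0"
  shows "eshift (q powi (- 2 * int l) * x / y) (q\<^sup>2) p k * eshift (q powi (- 2 * int k) * y / x) (q\<^sup>2) p l
       * (y * q ^ (2 * l) * \<theta> (x * q ^ (2 * k) / (y * q ^ (2 * l))))
     = q powi (- 2 * int k * int l) * (eshift (q\<^sup>2 * x / y) (q\<^sup>2) p k * eshift (q\<^sup>2 * y / x) (q\<^sup>2) p l
       * (y * \<theta> (x / y)))"
proof -
  define X where "X = x / y"
  have X: "X \<noteq> 0" using x y by (simp add: X_def)
  define g where "g e = \<theta> (X * q powi (2 * e))" for e :: int
  have z1: "eshift (q powi (- 2 * int l) * x / y) (q\<^sup>2) p k = (\<Prod>m<k. g (int m - int l))"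
    unfolding eshift_def g_def q_square_power
  proof (rule prod.cong[OF refl])
    fix m
    have "q powi (- 2 * int l) * x / y * q ^ (2 * m) = X * q powi (- 2 * int l) * q ^ (2 * m)"
      by (simp add: X_def)
    also have "\<dots> = X * q powi (2 * (int m - int l))"
      unfolding q_monomial by (simp add: algebra_simps)
    finally show "\<theta> (q powi (- 2 * int l) * x / y * q ^ (2 * m)) = \<theta> (X * q powi (2 * (int m - int l)))" by simp
  qed
  have q1: "eshift (q\<^sup>2 * x / y) (q\<^sup>2) p k = (\<Prod>m<k. g (int m + 1))"
    unfolding eshift_def g_def q_square_power
  proof (rule prod.cong[OF refl])
    fix m
    have "q\<^sup>2 * x / y * q ^ (2 * m) = X * q ^ 2 * q ^ (2 * m)"
      by (simp add: X_def)
    also have "\<dots> = X * q powi (2 * (int m + 1))"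
      unfolding q_monomial by (simp add: algebra_simps)
    finally show "\<theta> (q\<^sup>2 * x / y * q ^ (2 * m)) = \<theta> (X * q powi (2 * (int m + 1)))" by simp
  qed
  have refl': "\<theta> (q powi (2 * e) * y / x) = - (q powi (2 * e) / X) * g (- e)" for e
  proof -
    have R: "1 / (X * q powi (2 * - e)) = q powi (2 * e) / X"
      by (simp add: power_int_minus field_simps)
    have "q powi (2 * e) * y / x = q powi (2 * e) / X" by (simp add: X_def)
    then have "\<theta> (q powi (2 * e) * y / x) = \<theta> (1 / (X * q powi (2 * - e)))" by (simp only: R)
    also have "\<dots> = - \<theta> (X * q powi (2 * - e)) / (X * q powi (2 * - e))"
      using X q_nz by (intro th_inverse) simp
    also have "\<dots> = - (1 / (X * q powi (2 * - e))) * g (- e)"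
      by (simp add: g_def)
    finally show ?thesis by (simp only: R)
  qed
  have z2: "eshift (q powi (- 2 * int k) * y / x) (q\<^sup>2) p l = (\<Prod>m<l. - (q powi (2 * (int m - int k)) / X)) * (\<Prod>m<l. g (int k - int m))"
    unfolding eshift_def q_square_power prod.distrib[symmetric]
  proof (rule prod.cong[OF refl])
    fix m
    have "q powi (- 2 * int k) * y / x * q ^ (2 * m) = y / x * q powi (- 2 * int k) * q ^ (2 * m)" by simp
    also have "\<dots> = q powi (2 * (int m - int k)) * y / x" unfolding q_monomial by (simp add: algebra_simps)
    finally show "\<theta> (q powi (- 2 * int k) * y / x * q ^ (2 * m)) = - (q powi (2 * (int m - int k)) / X) * g (int k - int m)"
      using refl'[of "int m - int k"] by (simp only: minus_diff_eq)
  qed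
  have q2: "eshift (q\<^sup>2 * y / x) (q\<^sup>2) p l = (\<Prod>m<l. - (q powi (2 * (int m + 1)) / X)) * (\<Prod>m<l. g (- (int m + 1)))"
    unfolding eshift_def q_square_power prod.distrib[symmetric]
  proof (rule prod.cong[OF refl])
    fix m
    have "q\<^sup>2 * y / x * q ^ (2 * m) = y / x * q ^ 2 * q ^ (2 * m)" by simp
    also have "\<dots> = q powi (2 * (int m + 1)) * y / x" unfolding q_monomial by (simp add: algebra_simps)
    finally show "\<theta> (q\<^sup>2 * y / x * q ^ (2 * m)) = - (q powi (2 * (int m + 1)) / X) * g (- (int m + 1))"
      using refl'[of "int m + 1"] by (simp only:)
  qed
  have d: "\<theta> (x * q ^ (2 * k) / (y * q ^ (2 * l))) = g (int k - int l)"
  proof -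
    have "x * q ^ (2 * k) / (y * q ^ (2 * l)) = X * q ^ (2 * k) / q ^ (2 * l)" by (simp add: X_def)
    also have "\<dots> = X * q powi (2 * (int k - int l))" unfolding q_monomial by (simp add: algebra_simps)
    finally show ?thesis by (simp add: g_def)
  qed
  have d0: "\<theta> (x / y) = g 0" by (simp add: g_def X_def)
  \<comment> \<open>Both sides are the product of \<open>g\<close> over the consecutive integers
    from -l to k, with the factor at k - l or the one at 0 singled out.\<close>
  have G: "(\<Prod>m<k. g (int m - int l)) * g (int k - int l) * (\<Prod>m<l. g (int k - int m)) =
      (\<Prod>m<l. g (- (int m + 1))) * g 0 * (\<Prod>m<k. g (int m + 1))"
  proof -
    have split: "(\<Prod>e<u + 1 + v. G e) = (\<Prod>e<u. G e) * G u * (\<Prod>e<v. G (u + 1 + e))" for u v and G :: "nat \<Rightarrow> complex"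
      by (induction v) (simp_all add: mult_ac)
    let ?G = "\<lambda>e. g (int e - int l)"
    have A: "(\<Prod>e<l. ?G (k + 1 + e)) = (\<Prod>m<l. g (int k - int m))"
      by (rule prod.reindex_bij_witness[of _ "\<lambda>m. l - Suc m" "\<lambda>m. l - Suc m"]) (auto intro!: arg_cong[of _ _ g])
    have B: "(\<Prod>e<l. ?G e) = (\<Prod>m<l. g (- (int m + 1)))"
      by (rule prod.reindex_bij_witness[of _ "\<lambda>m. l - Suc m" "\<lambda>m. l - Suc m"]) (auto intro!: arg_cong[of _ _ g])
    have C: "(\<Prod>e<k. ?G (l + 1 + e)) = (\<Prod>m<k. g (int m + 1))"
      by (rule prod.cong) (auto intro!: arg_cong[of _ _ g])
    have "k + 1 + l = l + 1 + k" by simp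
    then have "(\<Prod>e<k. ?G e) * ?G k * (\<Prod>e<l. ?G (k + 1 + e)) = (\<Prod>e<l. ?G e) * ?G l * (\<Prod>e<k. ?G (l + 1 + e))"
      by (simp only: split[of ?G k l, symmetric] split[of ?G l k, symmetric])
    then show ?thesis
      unfolding A B C by (simp only: diff_self)
  qed
  have mon: "(\<Prod>m<l. - (q powi (2 * (int m - int k)) / X)) * q ^ (2 * l) =
      q powi (- 2 * int k * int l) * (\<Prod>m<l. - (q powi (2 * (int m + 1)) / X))"
  proof -
    have "- (q powi (2 * (int m - int k)) / X) * q ^ 2 = q powi (- 2 * int k) * - (q powi (2 * (int m + 1)) / X)" for m
    proof -
      have "q powi (2 * (int m - int k)) * q ^ 2 = q powi (2 * (int m - int k) + int 2)"
        by (simp only: powi_mult[symmetric] power_int_of_nat)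
      also have "2 * (int m - int k) + int 2 = - 2 * int k + 2 * (int m + 1)" by simp
      also have "q powi \<dots> = q powi (- 2 * int k) * q powi (2 * (int m + 1))" by (simp only: powi_mult)
      finally show ?thesis by simp
    qed
    then have "(\<Prod>m<l. - (q powi (2 * (int m - int k)) / X)) * (\<Prod>m<l. q ^ 2) =
        (\<Prod>m<l. q powi (- 2 * int k)) * (\<Prod>m<l. - (q powi (2 * (int m + 1)) / X))"
      unfolding prod.distrib[symmetric] by (simp only:)
    moreover have "(\<Prod>m<l. q powi (- 2 * int k)) = q powi (- 2 * int k * int l)"
      unfolding prod_powi_sum by (simp add: mult.commute)
    ultimately show ?thesis by (simp add: power_mult)
  qed
  have "(\<Prod>m<k. g (int m - int l)) * ((\<Prod>m<l. - (q powi (2 * (int m - int k)) / X)) * (\<Prod>m<l. g (int k - int m)))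
       * (y * q ^ (2 * l) * g (int k - int l)) =
     ((\<Prod>m<l. - (q powi (2 * (int m - int k)) / X)) * q ^ (2 * l)) * y *
      ((\<Prod>m<k. g (int m - int l)) * g (int k - int l) * (\<Prod>m<l. g (int k - int m)))"
    by (simp only: mult_ac)
  also have "\<dots> = q powi (- 2 * int k * int l) * ((\<Prod>m<k. g (int m + 1)) *
       ((\<Prod>m<l. - (q powi (2 * (int m + 1)) / X)) * (\<Prod>m<l. g (- (int m + 1)))) * (y * g 0))"
    unfolding mon G by (simp only: mult_ac)
  finally show ?thesis
    unfolding z1 z2 q1 q2 d d0 .
qed

lemma pochhammer_diag:
  "eshift (q powi (- 2 * int k)) (q\<^sup>2) p k = (-1) ^ k * q powi (- (int k * (int k + 1))) * eshift (q\<^sup>2) (q\<^sup>2) p k"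
proof -
  have r: "\<theta> (q powi (- (2 * int m + 2))) = (-1) * q powi (- (2 * int m + 2)) * \<theta> (q\<^sup>2 * q ^ (2 * m))" for m
  proof -
    have "q\<^sup>2 * q ^ (2 * m) = q powi (int 2 + int (2 * m))"
      by (simp only: powi_mult[symmetric] power_int_of_nat)
    also have "int 2 + int (2 * m) = 2 * int m + 2" by simp
    finally have "q powi (2 * int m + 2) = q\<^sup>2 * q ^ (2 * m)" ..
    then have "q powi (- (2 * int m + 2)) = 1 / (q\<^sup>2 * q ^ (2 * m))"
      by (simp only: power_int_minus divide_inverse mult_1_left)
    then show ?thesis using th_inverse[of "q\<^sup>2 * q ^ (2 * m)"] q_nz by simp
  qed
  have "eshift (q powi (- 2 * int k)) (q\<^sup>2) p k = (\<Prod>m<k. \<theta> (q powi (- (2 * int m + 2))))"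
    unfolding eshift_def q_square_power
  proof (rule prod.reindex_bij_witness[of _ "\<lambda>m. k - Suc m" "\<lambda>m. k - Suc m"])
    fix m assume "m \<in> {..<k}"
    then have e: "- 2 * int k + int (2 * m) = - (2 * int (k - Suc m) + 2)" by auto
    have "q powi (- 2 * int k) * q ^ (2 * m) = q powi (- 2 * int k + int (2 * m))"
      by (simp only: powi_mult[symmetric] power_int_of_nat)
    then show "\<theta> (q powi (- (2 * int (k - Suc m) + 2))) = \<theta> (q powi (- 2 * int k) * q ^ (2 * m))"
      by (simp only: e)
  qed auto
  also have "\<dots> = (-1) ^ k * (\<Prod>m<k. q powi (- (2 * int m + 2))) * eshift (q\<^sup>2) (q\<^sup>2) p k"
    unfolding r eshift_def q_square_power prod.distrib by simp
  also have "(\<Prod>m<k. q powi (- (2 * int m + 2))) = q powi (- (int k * (int k + 1)))"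
  proof (induction k)
    case (Suc k)
    have "- (int k * (int k + 1)) + - (2 * int k + 2) = - (int (Suc k) * (int (Suc k) + 1))"
      by (simp add: algebra_simps)
    then show ?case using Suc by (simp only: prod.lessThan_Suc powi_mult)
  qed simp
  finally show ?thesis .
qed

text \<open>Each pair (i, j), (j, i) of off-diagonal entries absorbs one factor of the Vandermonde
  product, and the exponents combine through |k|^2 = sum of k_i^2 + 2 e2. The purpose is to trade
  the quotient of the two \<open>eDelta\<close> for the double product with k in place of n, which
  is the denominator that arises from the subsets.\<close>

lemma pochhammer_Delta:
  assumes x: "\<And>i. i \<in> {1..r} \<Longrightarrow> x i \<noteq> 0"
  shows "(\<Prod>i=1..r. \<Prod>j=1..r. eshift (q powi (- 2 * int (k j)) * x i / x j) (q\<^sup>2) p (k i))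
       * eDelta r (\<lambda>i. x i * q ^ (2 * k i)) p
     = (-1) ^ wt r k * q powi (- (int (wt r k) * int (wt r k)) - int (wt r k))
       * (\<Prod>i=1..r. \<Prod>j=1..r. eshift (q\<^sup>2 * x i / x j) (q\<^sup>2) p (k i)) * eDelta r x p"
proof -
  let ?Z = "\<lambda>i j. eshift (q powi (- 2 * int (k j)) * x i / x j) (q\<^sup>2) p (k i)"
  let ?Q = "\<lambda>i j. eshift (q\<^sup>2 * x i / x j) (q\<^sup>2) p (k i)"
  have diag: "(\<Prod>i=1..r. ?Z i i) = (-1) ^ wt r k * q powi (\<Sum>i=1..r. - (int (k i) * (int (k i) + 1))) * (\<Prod>i=1..r. ?Q i i)"
  proof -
    have "(\<Prod>i=1..r. ?Z i i) = (\<Prod>i=1..r. (-1) ^ k i * q powi (- (int (k i) * (int (k i) + 1))) * ?Q i i)"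
    proof (rule prod.cong[OF refl])
      fix i assume "i \<in> {1..r}"
      then have "q powi (- 2 * int (k i)) * x i / x i = q powi (- 2 * int (k i))" "q\<^sup>2 * x i / x i = q\<^sup>2"
        using x[of i] by simp_all
      then show "?Z i i = (-1) ^ k i * q powi (- (int (k i) * (int (k i) + 1))) * ?Q i i"
        by (simp only: pochhammer_diag)
    qed
    then show ?thesis by (simp add: prod.distrib prod_powi_sum wt_def power_sum)
  qed
  have off: "(\<Prod>i=1..r. \<Prod>j\<in>{i<..r}. ?Z i j * ?Z j i) * eDelta r (\<lambda>i. x i * q ^ (2 * k i)) p =
     q powi (\<Sum>i=1..r. \<Sum>j\<in>{i<..r}. - 2 * int (k i) * int (k j)) * ((\<Prod>i=1..r. \<Prod>j\<in>{i<..r}. ?Q i j * ?Q j i) * eDelta r x p)"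
    unfolding eDelta_def prod_powi_sum[symmetric] prod.distrib[symmetric]
    by (intro prod.cong refl pochhammer_pair) (use x in auto)
  have "(\<Sum>i=1..r. - (int (k i) * (int (k i) + 1))) + (\<Sum>i=1..r. \<Sum>j\<in>{i<..r}. - 2 * int (k i) * int (k j))
     = - (int (wt r k) * int (wt r k)) - int (wt r k)"
  proof -
    have "int (wt r k) * int (wt r k) = (\<Sum>i=1..r. int (k i) * int (k i)) + 2 * (\<Sum>i=1..r. \<Sum>j\<in>{i<..r}. int (k i) * int (k j))"
      using arg_cong[OF sum_square_pairs[of r k], of int] by (simp add: power2_eq_square e2_def)
    moreover have "(\<Sum>i=1..r. - (int (k i) * (int (k i) + 1))) = - (\<Sum>i=1..r. int (k i) * int (k i)) - int (wt r k)"
      by (simp add: wt_def algebra_simps sum.distrib sum_negf sum_subtractf)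
    moreover have "(\<Sum>i=1..r. \<Sum>j\<in>{i<..r}. - 2 * int (k i) * int (k j)) = - 2 * (\<Sum>i=1..r. \<Sum>j\<in>{i<..r}. int (k i) * int (k j))"
      by (simp add: sum_distrib_left mult.assoc sum_negf)
    ultimately show ?thesis by simp
  qed
  then have e: "q powi (\<Sum>i=1..r. - (int (k i) * (int (k i) + 1))) * q powi (\<Sum>i=1..r. \<Sum>j\<in>{i<..r}. - 2 * int (k i) * int (k j))
     = q powi (- (int (wt r k) * int (wt r k)) - int (wt r k))" by (simp only: powi_mult)
  have "(\<Prod>i=1..r. \<Prod>j=1..r. ?Z i j) * eDelta r (\<lambda>i. x i * q ^ (2 * k i)) p
     = (\<Prod>i=1..r. ?Z i i) * ((\<Prod>i=1..r. \<Prod>j\<in>{i<..r}. ?Z i j * ?Z j i) * eDelta r (\<lambda>i. x i * q ^ (2 * k i)) p)"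
    unfolding prod_square_pairs by (simp only: mult.assoc)
  also have "\<dots> = (-1) ^ wt r k * (q powi (\<Sum>i=1..r. - (int (k i) * (int (k i) + 1))) * q powi (\<Sum>i=1..r. \<Sum>j\<in>{i<..r}. - 2 * int (k i) * int (k j)))
     * ((\<Prod>i=1..r. ?Q i i) * (\<Prod>i=1..r. \<Prod>j\<in>{i<..r}. ?Q i j * ?Q j i)) * eDelta r x p"
    unfolding diag off by (simp only: mult_ac)
  finally show ?thesis
    unfolding e prod_square_pairs[of ?Q r] .
qed

text \<open>The pairs with a position m < k of string i inside and a position l \<le> m' < n of
  string j outside. Raising m' by 1 multiplies the quotient of the two variables by q^2, so the
  product over m' telescopes, and the ends m' = n and m' = l give the two shifted
  factorials.\<close>

lemma vfac_rectangle:
  assumes \<delta>: "\<delta> \<noteq> 0" and x: "xi \<noteq> 0" "xj \<noteq> 0" and l: "l \<le> n"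
    and nz: "\<And>m m'. m < k \<Longrightarrow> l \<le> m' \<Longrightarrow> m' \<le> n \<Longrightarrow> \<theta> (xj / xi * q powi (2 * (int m' - int m))) \<noteq> 0"
  shows "(\<Prod>m<k. \<Prod>m'\<in>{l..<n}. vfac (\<delta> / xi / q ^ (2 * m)) (\<delta> / xj / q ^ (2 * m')))
    = q powi (2 * (int n - int l) * int k) * (eshift (q powi (- 2 * int n) * xi / xj) (q\<^sup>2) p k
       / eshift (q powi (- 2 * int l) * xi / xj) (q\<^sup>2) p k)"
proof -
  define X where "X = xj / xi"
  have X: "X \<noteq> 0" using x by (simp add: X_def)
  have es: "eshift (q powi (- 2 * int e) * xi / xj) (q\<^sup>2) p k = (\<Prod>m<k. \<theta> (1 / (X * q powi (2 * (int e - int m)))))" for e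
    unfolding eshift_def q_square_power
  proof (rule prod.cong[OF refl])
    fix m
    have "q powi (- 2 * int e) * q ^ (2 * m) = q powi (- 2 * int e + int (2 * m))"
      by (simp only: powi_mult[symmetric] power_int_of_nat)
    also have "- 2 * int e + int (2 * m) = - (2 * (int e - int m))" by simp
    also have "q powi (- (2 * (int e - int m))) = 1 / q powi (2 * (int e - int m))"
      by (simp only: power_int_minus divide_inverse mult_1_left)
    finally have "q powi (- 2 * int e) * q ^ (2 * m) = 1 / q powi (2 * (int e - int m))" .
    then have "q powi (- 2 * int e) * xi / xj * q ^ (2 * m) = 1 / (X * q powi (2 * (int e - int m)))"
      using x by (simp add: X_def mult.commute mult.left_commute)
    then show "\<theta> (q powi (- 2 * int e) * xi / xj * q ^ (2 * m)) = \<theta> (1 / (X * q powi (2 * (int e - int m))))"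
      by (simp only:)
  qed
  have "(\<Prod>m'\<in>{l..<n}. vfac (\<delta> / xi / q ^ (2 * m)) (\<delta> / xj / q ^ (2 * m')))
      = q powi (2 * (int n - int l)) * (\<theta> (1 / (X * q powi (2 * (int n - int m)))) / \<theta> (1 / (X * q powi (2 * (int l - int m)))))"
    if m: "m < k" for m
  proof -
    define g where "g m' = \<theta> (X * q powi (2 * (int m' - int m)))" for m' :: nat
    have gnz: "g m' \<noteq> 0" if "l \<le> m'" "m' \<le> n" for m'
      using nz[OF m that] by (simp add: g_def X_def)
    have "vfac (\<delta> / xi / q ^ (2 * m)) (\<delta> / xj / q ^ (2 * m')) = g (Suc m') / g m'" for m'
    proof -
      have 1: "\<delta> / xi / q ^ (2 * m) / (\<delta> / xj / q ^ (2 * m')) = X * q powi (2 * (int m' - int m))"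
      proof -
        have "\<delta> / xi / q ^ (2 * m) / (\<delta> / xj / q ^ (2 * m')) = X * q ^ (2 * m') / q ^ (2 * m)"
          using \<delta> x by (simp add: X_def)
        also have "\<dots> = X * q powi (2 * (int m' - int m))" unfolding q_monomial by (simp add: algebra_simps)
        finally show ?thesis .
      qed
      have 2: "q\<^sup>2 * (\<delta> / xi / q ^ (2 * m)) / (\<delta> / xj / q ^ (2 * m')) = X * q powi (2 * (int (Suc m') - int m))"
      proof -
        have "q\<^sup>2 * (\<delta> / xi / q ^ (2 * m)) / (\<delta> / xj / q ^ (2 * m')) = X * q ^ (2 * m') / q ^ (2 * m) * q ^ 2"
          using \<delta> x by (simp add: X_def)
        also have "\<dots> = X * q powi (2 * (int (Suc m') - int m))" unfolding q_monomial by (simp add: algebra_simps)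
        finally show ?thesis .
      qed
      show ?thesis unfolding vfac_def 1 2 g_def ..
    qed
    then have "(\<Prod>m'\<in>{l..<n}. vfac (\<delta> / xi / q ^ (2 * m)) (\<delta> / xj / q ^ (2 * m'))) = g n / g l"
      using prod_telescope_interval[OF l gnz] by simp
    also have "\<dots> = q powi (2 * (int n - int l)) * (\<theta> (1 / (X * q powi (2 * (int n - int m)))) / \<theta> (1 / (X * q powi (2 * (int l - int m)))))"
    proof -
      have inv: "\<theta> (1 / (X * q powi (2 * (int e - int m)))) = - g e / (X * q powi (2 * (int e - int m)))" for e
        unfolding g_def using X q_nz by (intro th_inverse) simp
      have "2 * (int n - int m) = 2 * (int n - int l) + 2 * (int l - int m)" by simp
      then have "q powi (2 * (int n - int m)) = q powi (2 * (int n - int l)) * q powi (2 * (int l - int m))"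
        by (simp only: powi_mult)
      then show ?thesis
        unfolding inv using gnz[of l] l X q_nz by simp
    qed
    finally show ?thesis .
  qed
  then have "(\<Prod>m<k. \<Prod>m'\<in>{l..<n}. vfac (\<delta> / xi / q ^ (2 * m)) (\<delta> / xj / q ^ (2 * m'))) =
    (\<Prod>m<k. q powi (2 * (int n - int l)) * (\<theta> (1 / (X * q powi (2 * (int n - int m)))) / \<theta> (1 / (X * q powi (2 * (int l - int m))))))"
    by (intro prod.cong refl) simp
  also have "\<dots> = q powi (2 * (int n - int l) * int k) * (eshift (q powi (- 2 * int n) * xi / xj) (q\<^sup>2) p k
       / eshift (q powi (- 2 * int l) * xi / xj) (q\<^sup>2) p k)"
    unfolding es prod.distrib prod_dividef prod_powi_sum by (simp add: mult.commute)
  finally show ?thesis .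
qed

section \<open>Subsets of the strings and their initial segments\<close>

lemma subset_term_non_initial:
  fixes n :: "nat \<Rightarrow> nat"
  assumes T: "T \<subseteq> (SIGMA i:{1..r}. {..<n i})" and i: "(i, Suc m) \<in> T" "(i, m) \<notin> T" and D: "D i \<noteq> 0"
  shows "subset_term a b (\<lambda>(i, m). D i / q ^ (2 * m)) (SIGMA i:{1..r}. {..<n i}) T = 0"
proof -
  let ?I = "SIGMA i:{1..r}. {..<n i}" and ?u = "\<lambda>(i, m). D i / q ^ (2 * m)"
  have fin: "finite ?I" by (intro finite_SigmaI) auto
  then have finT: "finite T" using T finite_subset by blast
  have mI: "(i, m) \<in> ?I - T" using i T by auto
  \<comment> \<open>Along a string the variable is divided by q^2 at each position, so q^2 times the
    later entry is the earlier one and the numerator of \<open>vfac\<close> is \<theta>(1).\<close>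
  have "vfac (?u (i, Suc m)) (?u (i, m)) = 0"
    using D q_nz by (simp add: vfac_def power2_eq_square)
  then have "(\<Prod>z\<in>?I - T. vfac (?u (i, Suc m)) (?u z)) = 0"
    using mI fin by (meson finite_Diff prod_zero)
  then have "(\<Prod>y\<in>T. \<Prod>z\<in>?I - T. vfac (?u y) (?u z)) = 0"
    using i finT by (meson prod_zero)
  then show ?thesis by (simp add: subset_term_def)
qed

text \<open>A subset with nonzero term is closed under lowering the position within a string, hence
  determined by the number of its elements in each string. These numbers form the tuple k,
  restricted to {1..r} since \<open>kbox\<close> consists of extensional functions.\<close>

lemma sum_subset_term_kbox:
  assumes D: "\<And>i. i \<in> {1..r} \<Longrightarrow> D i \<noteq> 0"
  shows "(\<Sum>T\<in>Pow (SIGMA i:{1..r}. {..<n i}). subset_term a b (\<lambda>(i, m). D i / q ^ (2 * m)) (SIGMA i:{1..r}. {..<n i}) T)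
    = (\<Sum>k\<in>kbox r n. subset_term a b (\<lambda>(i, m). D i / q ^ (2 * m)) (SIGMA i:{1..r}. {..<n i}) (SIGMA i:{1..r}. {..<k i}))"
proof -
  let ?I = "SIGMA i:{1..r}. {..<n i}" and ?u = "\<lambda>(i, m). D i / q ^ (2 * m)"
  let ?S = "\<lambda>k. SIGMA i:{1..r}. {..<k i}"
  have inj: "inj_on ?S (kbox r n)"
  proof (rule inj_onI)
    fix k l assume kl: "k \<in> kbox r n" "l \<in> kbox r n" "?S k = ?S l"
    show "k = l"
    proof
      fix i
      show "k i = l i"
      proof (cases "i \<in> {1..r}")
        case True
        then have "(?S k) `` {i} = {..<k i}" "(?S l) `` {i} = {..<l i}" by auto
        then have "{..<k i} = {..<l i}" using kl(3) by simp
        then show ?thesis by (simp add: lessThan_eq_iff)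
      next
        case False
        then show ?thesis using kl(1,2) unfolding kbox_def by (metis PiE_arb)
      qed
    qed
  qed
  have sub: "?S ` kbox r n \<subseteq> Pow ?I"
  proof -
    have "k i \<le> n i" if "k \<in> kbox r n" "i \<in> {1..r}" for k i
      using PiE_mem[of k "{1..r}" "\<lambda>i. {0..n i}" i] that by (simp add: kbox_def)
    then have "{..<k i} \<subseteq> {..<n i}" if "k \<in> kbox r n" "i \<in> {1..r}" for k i
      using that by auto
    then show ?thesis by (intro image_subsetI PowI Sigma_mono order_refl)
  qed
  have "subset_term a b ?u ?I T = 0" if T: "T \<in> Pow ?I - ?S ` kbox r n" for T
  proof (rule ccontr)
    assume nz: "subset_term a b ?u ?I T \<noteq> 0"
    have TI: "T \<subseteq> ?I" using T by simp
    have down: "(i, m) \<in> T" if "(i, Suc m) \<in> T" for i m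
    proof (rule ccontr)
      assume "(i, m) \<notin> T"
      then have "subset_term a b ?u ?I T = 0"
        by (intro subset_term_non_initial[OF TI that]) (use TI that D in auto)
      then show False using nz by simp
    qed
    define A where "A i = {m. (i, m) \<in> T}" for i
    have Asub: "A i \<subseteq> {..<n i}" for i using TI by (auto simp: A_def)
    then have finA: "finite (A i)" for i using finite_subset by blast
    have A: "A i = {..<card (A i)}" for i
      by (rule down_closed_eq_lessThan[OF finA]) (use down in \<open>auto simp: A_def\<close>)
    define k where "k = restrict (\<lambda>i. card (A i)) {1..r}"
    have "k \<in> kbox r n"
      unfolding kbox_def k_def using card_mono[OF _ Asub] by auto
    moreover have "T = ?S k"
    proof -
      have "(i, m) \<in> T \<longleftrightarrow> (i, m) \<in> ?S k" for i m
      proof -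
        have "(i, m) \<in> T \<longleftrightarrow> i \<in> {1..r} \<and> m \<in> A i" using TI by (auto simp: A_def)
        also have "\<dots> \<longleftrightarrow> i \<in> {1..r} \<and> m < k i"
          using A[of i] by (auto simp: k_def)
        finally show ?thesis by auto
      qed
      then show ?thesis by auto
    qed
    ultimately show False using T by blast
  qed
  moreover have "finite (Pow ?I)" by (intro finite_Pow_iff[THEN iffD2] finite_SigmaI) auto
  ultimately have "(\<Sum>T\<in>Pow ?I. subset_term a b ?u ?I T) = (\<Sum>T\<in>?S ` kbox r n. subset_term a b ?u ?I T)"
    using sub by (intro sum.mono_neutral_right) auto
  then show ?thesis by (simp only: sum.reindex[OF inj] o_def)
qed

end

section \<open>Assembly of the multiple sum\<close>

lemma elliptic_nome_of_generic:
  assumes p: "norm p < 1" and q: "q \<noteq> 0"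
    and gen: "\<And>k::nat. k > 0 \<Longrightarrow> (if p = 0 then q ^ k \<noteq> 1 else \<forall>m::int. q ^ k \<noteq> p powi m)"
  shows "elliptic_nome p q"
proof
  fix k :: int assume k: "k \<noteq> 0"
  have pos: "etheta (q powi k) p \<noteq> 0" if "k > 0" for k
  proof
    assume "etheta (q powi k) p = 0"
    moreover have "q powi k = q ^ nat k" using that by (simp add: power_int_def)
    ultimately have "if p = 0 then q ^ nat k = 1 else \<exists>m::int. q ^ nat k = p powi m"
      using etheta_eq_0_iff[OF p, of "q ^ nat k"] q by simp
    then show False using gen[of "nat k"] that by (auto split: if_splits)
  qed
  show "etheta (q powi k) p \<noteq> 0"
  proof (cases "k > 0")
    case False
    then have "etheta (q powi (- k)) p \<noteq> 0" using pos[of "- k"] k by simp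
    moreover have "q powi k = 1 / q powi (- k)" by (simp add: power_int_minus field_simps)
    ultimately show ?thesis
      using etheta_inverse[OF p, of "q powi (- k)"] q by simp
  qed (rule pos)
qed (use p q in auto)

theorem theorem4p3:
  fixes p q a b c d :: complex and x :: "nat \<Rightarrow> complex"
    and r :: nat and n :: "nat \<Rightarrow> nat"
  assumes "norm p < 1" and "q \<noteq> 0"
    and "\<And>k::nat. k > 0 \<Longrightarrow> (if p = 0 then q ^ k \<noteq> 1 else \<forall>m::int. q ^ k \<noteq> p powi m)"
    and "r \<ge> 1"
    and "a \<noteq> 0" and "b \<noteq> 0" and "c \<noteq> 0" and "d \<noteq> 0"
    and "\<And>i. i \<in> {1..r} \<Longrightarrow> x i \<noteq> 0"
    and "a\<^sup>2 * q ^ (2 * wt r n + 1) = c * d"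
    and "eDelta r x p \<noteq> 0"
    and "etheta a p \<noteq> 0"
    and "\<And>k. k \<in> kbox r n \<Longrightarrow> eshift (a * q ^ (2 * wt r n + 1)) q p (wt r k) \<noteq> 0"
    and "\<And>k. k \<in> kbox r n \<Longrightarrow> eshifts [a * q\<^sup>2 / b, a * q * b] (q\<^sup>2) p (wt r k) \<noteq> 0"
    and "\<And>k i. k \<in> kbox r n \<Longrightarrow> i \<in> {1..r} \<Longrightarrow>
           eshift (a * q powi (2 * int (wt r n) - 2 * int (n i) + 1) / (c * x i)) q p (wt r k) \<noteq> 0"
    and "\<And>k i. k \<in> kbox r n \<Longrightarrow> i \<in> {1..r} \<Longrightarrow>
           eshift (d / x i) (q\<^sup>2) p (wt r k - k i) \<noteq> 0"
    and "\<And>k i. k \<in> kbox r n \<Longrightarrow> i \<in> {1..r} \<Longrightarrow>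
           eshift (a * x i * q powi (int (k i) - int (wt r k) + 1) / d) q p (k i) \<noteq> 0"
    and "\<And>k i j. k \<in> kbox r n \<Longrightarrow> i \<in> {1..r} \<Longrightarrow> j \<in> {1..r} \<Longrightarrow>
           eshift (q\<^sup>2 * x i / x j) (q\<^sup>2) p (k i) \<noteq> 0"
    and "eshifts [a * b * q, a * q\<^sup>2 / b] (q\<^sup>2) p (wt r n) \<noteq> 0"
    and "\<And>i. i \<in> {1..r} \<Longrightarrow> eshift (a * x i * q / d) q p (2 * n i) \<noteq> 0"
  shows
    "(\<Sum>k\<in>kbox r n.
        eDelta r (\<lambda>i. x i * q ^ (2 * k i)) p / eDelta r x p
        * (etheta (a * q ^ (3 * wt r k)) p / etheta a p)
        * (eshifts [a, b, q / b] q p (wt r k)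
            / (eshift (a * q ^ (2 * wt r n + 1)) q p (wt r k)
               * eshifts [a * q\<^sup>2 / b, a * q * b] (q\<^sup>2) p (wt r k)))
        * q powi (int (wt r k) - int (e2 r k))
        * (\<Prod>i=1..r.
             (eshift (c * x i) (q\<^sup>2) p (k i)
              * eshift (d / x i) (q\<^sup>2) p (wt r k)
              * eshift (d / (a * x i)) q p (wt r k - k i))
             / (eshift (a * q powi (2 * int (wt r n) - 2 * int (n i) + 1) / (c * x i)) q p (wt r k)
                * eshift (d / x i) (q\<^sup>2) p (wt r k - k i)
                * eshift (a * x i * q powi (int (k i) - int (wt r k) + 1) / d) q p (k i)))
        * (\<Prod>i=1..r. \<Prod>j=1..r.
             eshift (q powi (- 2 * int (n j)) * x i / x j) (q\<^sup>2) p (k i)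
             / eshift (q\<^sup>2 * x i / x j) (q\<^sup>2) p (k i)))
     = eshift (a * q) q p (2 * wt r n)
         / eshifts [a * b * q, a * q\<^sup>2 / b] (q\<^sup>2) p (wt r n)
       * (\<Prod>i=1..r.
            eshifts [a * b * x i * q / d, a * x i * q\<^sup>2 / (b * d)] (q\<^sup>2) p (n i)
            / eshift (a * x i * q / d) q p (2 * n i))"
proof -
  note p = assms(1) and q = assms(2) and a = assms(5) and b = assms(6) and c = assms(7) and d = assms(8)
    and x = assms(9) and cd = assms(10) and \<Delta> = assms(11) and \<theta>a = assms(12)
  interpret elliptic_nome p q by (rule elliptic_nome_of_generic[OF assms(1-3)])
  define N where "N = wt r n"
  define \<delta> where "\<delta> = d / a"
  define D where "D i = \<delta> / x i" for i
  define I where "I = (SIGMA i:{1..r}. {..<n i})"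
  \<comment> \<open>the variable \<open>x\<^sub>i\<close> with upper limit \<open>n\<^sub>i\<close> becomes the string \<open>x\<^sub>i q\<^bsup>2m\<^esup>\<close>, \<open>m < n\<^sub>i\<close>\<close>
  define u where "u = (\<lambda>(i::nat, m::nat). D i / q ^ (2 * m))"
  define S where "S k = (SIGMA i:{1..r}. {..<k i})" for k :: "nat \<Rightarrow> nat"
  have \<delta>: "\<delta> \<noteq> 0" using a d by (simp add: \<delta>_def)
  have D: "D i \<noteq> 0" if "i \<in> {1..r}" for i using that x \<delta> by (simp add: D_def)
  have kn: "k i \<le> n i" if "k \<in> kbox r n" "i \<in> {1..r}" for k i
    using PiE_mem[of k "{1..r}" "\<lambda>i. {0..n i}" i] that by (simp add: kbox_def)
  have kw: "k i \<le> wt r k" if "i \<in> {1..r}" for k i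
    unfolding wt_def using that by (intro member_le_sum) auto
  have wtN: "wt r k \<le> N" if "k \<in> kbox r n" for k
    unfolding N_def wt_def using kn[OF that] by (intro sum_mono) auto
  \<comment> \<open>The hypotheses speak of members of \<open>kbox\<close>, which are extensional,
    whereas n may have any values outside {1..r}; its restriction lets them be used at k =
    n.\<close>
  define nn where "nn = restrict n {1..r}"
  have nn: "nn \<in> kbox r n" "wt r nn = N" "\<And>i. i \<in> {1..r} \<Longrightarrow> nn i = n i"
    by (auto simp: nn_def kbox_def N_def wt_def)
  have cardS: "card (S k) = wt r k" for k
    by (simp add: S_def wt_def)
  have cardI: "card I = N"
    by (simp add: I_def N_def wt_def)
  have ISk: "I - S k = (SIGMA i:{1..r}. {k i..<n i})" for k
    by (auto simp: I_def S_def)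

  \<comment> \<open>Nonvanishing of the denominators at k = n covers the exponents from 1 to n i.
    Exponent 0 will come from the Vandermonde product in the denominator, and negative exponents by
    inversion.\<close>
  have x_pos: "\<theta> (x i / x j * q powi (2 * e)) \<noteq> 0" if ij: "i \<in> {1..r}" "j \<in> {1..r}" "e > 0" "e \<le> int (n i)" for i j e
  proof -
    have "eshift (q\<^sup>2 * x i / x j) (q\<^sup>2) p (n i) \<noteq> 0"
      using assms(18)[OF nn(1) ij(1,2)] nn(3)[OF ij(1)] by simp
    moreover have "nat e - 1 < n i" using ij by auto
    ultimately have "\<theta> (q\<^sup>2 * x i / x j * (q\<^sup>2) ^ (nat e - 1)) \<noteq> 0"
      by (auto simp: eshift_def)
    moreover have "q\<^sup>2 * x i / x j * (q\<^sup>2) ^ (nat e - 1) = x i / x j * (q\<^sup>2) ^ nat e"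
    proof -
      have "(q\<^sup>2) ^ nat e = q\<^sup>2 * (q\<^sup>2) ^ (nat e - 1)" using ij by (simp flip: power_Suc)
      then show ?thesis by simp
    qed
    moreover have "(q\<^sup>2) ^ nat e = q powi (2 * e)"
    proof -
      have "2 * e = int (2 * nat e)" using ij by simp
      then show ?thesis by (simp only: power_int_of_nat power_mult)
    qed
    ultimately show ?thesis by (simp only: not_False_eq_True)
  qed
  have x_zero: "\<theta> (x i / x j) \<noteq> 0" if ij: "i \<in> {1..r}" "j \<in> {1..r}" "i \<noteq> j" for i j
  proof -
    have "\<theta> (x i / x j) \<noteq> 0" if "i \<in> {1..r}" "j \<in> {1..r}" "i < j" for i j
    proof -
      have "(\<Prod>j\<in>{i<..r}. x j * \<theta> (x i / x j)) \<noteq> 0"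
        using \<Delta> that unfolding eDelta_def by (auto simp: prod_zero_iff)
      then show ?thesis using that by (auto simp: prod_zero_iff)
    qed
    then show ?thesis
      using ij th_swap_nz[OF x[OF ij(1)] x[OF ij(2)]] by (metis linorder_neqE_nat)
  qed
  have x_ne: "\<theta> (x j / x i * q powi (2 * e)) \<noteq> 0"
    if ij: "i \<in> {1..r}" "j \<in> {1..r}" "i \<noteq> j \<or> e \<noteq> 0" "- int (n i) \<le> e" "e \<le> int (n j)" for i j e
  proof -
    consider "e > 0" | "e = 0" | "e < 0" by linarith
    then show ?thesis
    proof cases
      case 3
      have "x j / x i * q powi (2 * e) = 1 / (x i / x j * q powi (2 * - e))"
        using x ij by (simp add: power_int_minus field_simps)
      moreover have "\<theta> (x i / x j * q powi (2 * - e)) \<noteq> 0"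
        using 3 ij by (intro x_pos) auto
      moreover have "x i / x j * q powi (2 * - e) \<noteq> 0" using x ij q by simp
      ultimately show ?thesis using th_inverse[of "x i / x j * q powi (2 * - e)"] by simp
    qed (use ij x_pos[of j i e] x_zero[of j i] in auto)
  qed

  have u_nz: "u z \<noteq> 0" if "z \<in> I" for z using that D q by (auto simp: u_def I_def)
  have u_dist: "\<theta> (u y / u z) \<noteq> 0" if yz: "y \<in> I" "z \<in> I" "y \<noteq> z" for y z
  proof -
    obtain i m j m' where e: "y = (i, m)" "z = (j, m')" by (cases y, cases z) auto
    have ij: "i \<in> {1..r}" "j \<in> {1..r}" "m < n i" "m' < n j" using yz e by (auto simp: I_def)
    have "u y / u z = x j / x i * q ^ (2 * m') / q ^ (2 * m)"
      using \<delta> x ij by (simp add: e u_def D_def)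
    also have "\<dots> = x j / x i * q powi (2 * (int m' - int m))"
      unfolding q_monomial by (simp add: algebra_simps)
    finally show ?thesis
      using x_ne[of i j "int m' - int m"] ij yz e by auto
  qed

  \<comment> \<open>The balancing condition enters here: it expresses c x_i through D i.\<close>
  have s1: "a * q ^ (2 * N + 1) / D i = c * x i" if "i \<in> {1..r}" for i
  proof -
    have "a * q ^ (2 * N + 1) / D i = (a\<^sup>2 * q ^ (2 * N + 1)) * x i / d"
      using a d x[OF that] by (simp add: D_def \<delta>_def power2_eq_square)
    then show ?thesis using cd d by (simp add: N_def)
  qed
  have s2: "a * q powi (2 * int N - 2 * int (n i) + 1) / (c * x i) = D i * q powi (- 2 * int (n i))" if "i \<in> {1..r}" for i
  proof -
    have "q powi (2 * int N - 2 * int (n i) + 1) = q ^ (2 * N + 1) * q powi (- 2 * int (n i))"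
      unfolding power_int_of_nat[symmetric] powi_mult by (rule arg_cong[of _ _ "\<lambda>k. q powi k"]) simp
    then show ?thesis
      unfolding s1[OF that, symmetric] using a q D[OF that] by simp
  qed
  have s3: "d / x i = a * D i" "d / (a * x i) = D i" "a * x i * y / d = y / D i"
     if "i \<in> {1..r}" for i y
    using a d x[OF that] by (simp_all add: D_def \<delta>_def)

  \<comment> \<open>The common denominator. \<open>C0\<close> extends the denominators that depend
    on |k| alone to length N; \<open>B\<close> takes 2 n_i factors for each i, two for every element
    of its string, as the outside factors require.\<close>
  define C0 where "C0 = \<theta> a * eshift (a * q ^ (2 * N + 1)) q p N
    * (eshift (a * q\<^sup>2 / b) (q\<^sup>2) p N * eshift (a * q * b) (q\<^sup>2) p N)"
  define B where "B = (\<Prod>i=1..r. eshift (D i * q powi (- 2 * int (n i))) q p (2 * n i))"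
  define T where "T k = eDelta r (\<lambda>i. x i * q ^ (2 * k i)) p / eDelta r x p
        * (etheta (a * q ^ (3 * wt r k)) p / etheta a p)
        * (eshifts [a, b, q / b] q p (wt r k)
            / (eshift (a * q ^ (2 * wt r n + 1)) q p (wt r k)
               * eshifts [a * q\<^sup>2 / b, a * q * b] (q\<^sup>2) p (wt r k)))
        * q powi (int (wt r k) - int (e2 r k))
        * (\<Prod>i=1..r.
             (eshift (c * x i) (q\<^sup>2) p (k i)
              * eshift (d / x i) (q\<^sup>2) p (wt r k)
              * eshift (d / (a * x i)) q p (wt r k - k i))
             / (eshift (a * q powi (2 * int (wt r n) - 2 * int (n i) + 1) / (c * x i)) q p (wt r k)
                * eshift (d / x i) (q\<^sup>2) p (wt r k - k i)
                * eshift (a * x i * q powi (int (k i) - int (wt r k) + 1) / d) q p (k i)))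
        * (\<Prod>i=1..r. \<Prod>j=1..r.
             eshift (q powi (- 2 * int (n j)) * x i / x j) (q\<^sup>2) p (k i)
             / eshift (q\<^sup>2 * x i / x j) (q\<^sup>2) p (k i))" for k

  have T_eq: "T k * (C0 * B) = subset_term a b u I (S k)" if k: "k \<in> kbox r n" for k
  proof -
    define K where "K = wt r k"
    have KN: "K \<le> N" using wtN[OF k] by (simp add: K_def)
    define Zn where "Zn = (\<Prod>i=1..r. \<Prod>j=1..r. eshift (q powi (- 2 * int (n j)) * x i / x j) (q\<^sup>2) p (k i))"
    define Z where "Z = (\<Prod>i=1..r. \<Prod>j=1..r. eshift (q powi (- 2 * int (k j)) * x i / x j) (q\<^sup>2) p (k i))"
    define Q where "Q = (\<Prod>i=1..r. \<Prod>j=1..r. eshift (q\<^sup>2 * x i / x j) (q\<^sup>2) p (k i))"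
    define O1 where "O1 = (\<Prod>i=1..r. \<Prod>m\<in>{k i..<n i}. out_fac K (D i / q ^ (2 * m)))"
    define H where "H = (\<Prod>i=1..r. \<Prod>m<k i. in_fac a N K (D i / q ^ (2 * m)))"
    define cc where "cc = eshift a q p K * eshift (a * q ^ (2 * N + 1 + K)) q p (N - K) * \<theta> (a * q ^ (3 * K))
     * eshift b q p K * eshift (q / b) q p K
     * eshift (a * q ^ (2 + 2 * K) / b) (q\<^sup>2) p (N - K) * eshift (a * b * q ^ (1 + 2 * K)) (q\<^sup>2) p (N - K)"
    define F where "F i =
             (eshift (c * x i) (q\<^sup>2) p (k i)
              * eshift (d / x i) (q\<^sup>2) p K
              * eshift (d / (a * x i)) q p (K - k i))
             / (eshift (a * q powi (2 * int N - 2 * int (n i) + 1) / (c * x i)) q p K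
                * eshift (d / x i) (q\<^sup>2) p (K - k i)
                * eshift (a * x i * q powi (int (k i) - int K + 1) / d) q p (k i))" for i
    define P where "P = (\<Prod>i=1..r. F i)"
    have Qnz: "Q \<noteq> 0"
      using assms(18)[OF k] by (simp add: Q_def)
    \<comment> \<open>\<open>Z\<close> arises from the rearrangement of the Vandermonde factors. Its
      arguments carry the exponents m - k_j with m < k_i, which are nonzero when i = j, so
      \<open>x_ne\<close> applies.\<close>
    have Znz: "Z \<noteq> 0"
    proof -
      have "\<theta> (q powi (- 2 * int (k j)) * x i / x j * (q\<^sup>2) ^ m) \<noteq> 0"
        if ij: "i \<in> {1..r}" "j \<in> {1..r}" "m < k i" for i j m
      proof -
        have "q powi (- 2 * int (k j)) * x i / x j * (q\<^sup>2) ^ m = x i / x j * q powi (- 2 * int (k j)) * q ^ (2 * m)"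
          by (simp add: power_mult)
        also have "\<dots> = x i / x j * q powi (2 * (int m - int (k j)))"
          unfolding q_monomial by (simp add: algebra_simps)
        finally have e: "q powi (- 2 * int (k j)) * x i / x j * (q\<^sup>2) ^ m = x i / x j * q powi (2 * (int m - int (k j)))" .
        show ?thesis
          unfolding e using ij kn[OF k, of i] kn[OF k, of j] by (intro x_ne) auto
      qed
      then show ?thesis by (auto simp: Z_def eshift_def prod_zero_iff)
    qed
    have coeff: "\<theta> (a * q ^ (3 * K)) / \<theta> a * (eshifts [a, b, q / b] q p K
            / (eshift (a * q ^ (2 * N + 1)) q p K * eshifts [a * q\<^sup>2 / b, a * q * b] (q\<^sup>2) p K)) * C0 = cc"
    proof -
      have KNK: "K + (N - K) = N" using KN by simp
      have f1: "eshift (a * q ^ (2 * N + 1)) q p N = eshift (a * q ^ (2 * N + 1)) q p K * eshift (a * q ^ (2 * N + 1 + K)) q p (N - K)"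
        using eshift_add[of "a * q ^ (2 * N + 1)" q p K "N - K"] unfolding KNK mult.assoc power_add[symmetric] .
      have f2: "eshift (a * q\<^sup>2 / b) (q\<^sup>2) p N = eshift (a * q\<^sup>2 / b) (q\<^sup>2) p K * eshift (a * q ^ (2 + 2 * K) / b) (q\<^sup>2) p (N - K)"
      proof -
        have e: "a * q\<^sup>2 / b * (q\<^sup>2) ^ K = a * q ^ (2 + 2 * K) / b" unfolding q_square_power power_add by simp
        show ?thesis using eshift_add[of "a * q\<^sup>2 / b" "q\<^sup>2" p K "N - K"] unfolding e KNK .
      qed
      have f3: "eshift (a * q * b) (q\<^sup>2) p N = eshift (a * q * b) (q\<^sup>2) p K * eshift (a * b * q ^ (1 + 2 * K)) (q\<^sup>2) p (N - K)"
      proof -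
        have e: "a * q * b * (q\<^sup>2) ^ K = a * b * q ^ (1 + 2 * K)" unfolding q_square_power power_add by simp
        show ?thesis using eshift_add[of "a * q * b" "q\<^sup>2" p K "N - K"] unfolding e KNK .
      qed
      have n1: "eshift (a * q ^ (2 * N + 1)) q p K \<noteq> 0" using assms(13)[OF k] by (simp add: N_def K_def)
      have n2: "eshift (a * q\<^sup>2 / b) (q\<^sup>2) p K \<noteq> 0" "eshift (a * q * b) (q\<^sup>2) p K \<noteq> 0"
        using assms(14)[OF k] by (simp_all add: eshifts_def K_def)
      have es: "eshifts [a, b, q / b] q p K = eshift a q p K * (eshift b q p K * eshift (q / b) q p K)"
        "eshifts [a * q\<^sup>2 / b, a * q * b] (q\<^sup>2) p K = eshift (a * q\<^sup>2 / b) (q\<^sup>2) p K * eshift (a * q * b) (q\<^sup>2) p K"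
        by (simp_all add: eshifts_def)
      have alg: "A / A0 * (E / (F1 * (F2 * F3))) * (A0 * (F1 * G1) * ((F2 * G2) * (F3 * G3))) = A * E * G1 * G2 * G3"
        if "A0 \<noteq> 0" "F1 \<noteq> 0" "F2 \<noteq> 0" "F3 \<noteq> 0" for A A0 E F1 F2 F3 G1 G2 G3 :: complex
        using that by simp
      show ?thesis
        unfolding C0_def f1 f2 f3 es alg[OF \<theta>a n1 n2] cc_def by (simp only: mult_ac)
    qed
    have prods: "P * B = (-1) ^ K * q powi (\<Sum>i=1..r. int (k i) * int K - 2 * int (k i) - int (k i choose 2)) * (O1 * H)"
    proof -
      have "P * B = (\<Prod>i=1..r. (-1) ^ k i * q powi (int (k i) * int K - 2 * int (k i) - int (k i choose 2))
        * ((\<Prod>m\<in>{k i..<n i}. out_fac K (D i / q ^ (2 * m))) * (\<Prod>m<k i. in_fac a N K (D i / q ^ (2 * m)))))"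
        unfolding P_def B_def prod.distrib[symmetric]
      proof (rule prod.cong[OF refl])
        fix i assume i: "i \<in> {1..r}"
        note n1 = assms(15)[OF k i, folded N_def K_def, unfolded s2[OF i]]
        note n2 = assms(16)[OF k i, folded K_def, unfolded s3(1)[OF i]]
        note n3 = assms(17)[OF k i, folded K_def, unfolded s3(3)[OF i]]
        show "F i
             * eshift (D i * q powi (- 2 * int (n i))) q p (2 * n i)
           = (-1) ^ k i * q powi (int (k i) * int K - 2 * int (k i) - int (k i choose 2))
        * ((\<Prod>m\<in>{k i..<n i}. out_fac K (D i / q ^ (2 * m))) * (\<Prod>m<k i. in_fac a N K (D i / q ^ (2 * m))))"
          unfolding F_def s2[OF i] s3[OF i]
          unfolding s1[OF i, symmetric]
          by (rule single_factor[OF D[OF i] a kn[OF k i] _ n1 n2 n3]) (simp add: K_def kw[OF i])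
      qed
      also have "\<dots> = (-1) ^ K * q powi (\<Sum>i=1..r. int (k i) * int K - 2 * int (k i) - int (k i choose 2)) * (O1 * H)"
        unfolding prod.distrib prod_powi_sum O1_def H_def by (simp add: K_def wt_def power_sum)
      finally show ?thesis .
    qed
    have vdm: "(\<Prod>y\<in>S k. \<Prod>z\<in>I - S k. vfac (u y) (u z)) = q powi (2 * int N * int K - 2 * int K * int K) * (Zn / Z)"
    proof -
      have "(\<Prod>y\<in>S k. \<Prod>z\<in>I - S k. vfac (u y) (u z)) =
        (\<Prod>i=1..r. \<Prod>m<k i. \<Prod>j=1..r. \<Prod>m'\<in>{k j..<n j}. vfac (\<delta> / x i / q ^ (2 * m)) (\<delta> / x j / q ^ (2 * m')))"
        unfolding ISk unfolding S_def by (simp add: prod_SigmaI u_def D_def)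
      also have "\<dots> = (\<Prod>i=1..r. \<Prod>j=1..r. \<Prod>m<k i. \<Prod>m'\<in>{k j..<n j}. vfac (\<delta> / x i / q ^ (2 * m)) (\<delta> / x j / q ^ (2 * m')))"
        by (intro prod.cong refl prod.swap)
      also have "\<dots> = (\<Prod>i=1..r. \<Prod>j=1..r. q powi (2 * (int (n j) - int (k j)) * int (k i)) *
         (eshift (q powi (- 2 * int (n j)) * x i / x j) (q\<^sup>2) p (k i) / eshift (q powi (- 2 * int (k j)) * x i / x j) (q\<^sup>2) p (k i)))"
      proof (intro prod.cong refl)
        fix i j assume ij: "i \<in> {1..r}" "j \<in> {1..r}"
        show "(\<Prod>m<k i. \<Prod>m'\<in>{k j..<n j}. vfac (\<delta> / x i / q ^ (2 * m)) (\<delta> / x j / q ^ (2 * m'))) =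
          q powi (2 * (int (n j) - int (k j)) * int (k i)) *
         (eshift (q powi (- 2 * int (n j)) * x i / x j) (q\<^sup>2) p (k i) / eshift (q powi (- 2 * int (k j)) * x i / x j) (q\<^sup>2) p (k i))"
        proof (rule vfac_rectangle[OF \<delta> x[OF ij(1)] x[OF ij(2)] kn[OF k ij(2)]])
          fix m m' assume "m < k i" "k j \<le> m'" "m' \<le> n j"
          then show "\<theta> (x j / x i * q powi (2 * (int m' - int m))) \<noteq> 0"
            using kn[OF k ij(1)] by (intro x_ne[OF ij]) auto
        qed
      qed
      also have "\<dots> = q powi (\<Sum>i=1..r. \<Sum>j=1..r. 2 * (int (n j) - int (k j)) * int (k i)) * (Zn / Z)"
        unfolding prod.distrib prod_powi_sum prod_dividef Zn_def Z_def ..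
      also have "(\<Sum>i=1..r. \<Sum>j=1..r. 2 * (int (n j) - int (k j)) * int (k i)) = 2 * int N * int K - 2 * int K * int K"
      proof -
        have "(\<Sum>i=1..r. \<Sum>j=1..r. 2 * (int (n j) - int (k j)) * int (k i)) = (\<Sum>i=1..r. 2 * (int N - int K) * int (k i))"
        proof (rule sum.cong[OF refl])
          fix i
          have "(\<Sum>j=1..r. 2 * (int (n j) - int (k j))) = 2 * (int N - int K)"
            by (simp add: N_def K_def wt_def sum_subtractf flip: sum_distrib_left)
          then show "(\<Sum>j=1..r. 2 * (int (n j) - int (k j)) * int (k i)) = 2 * (int N - int K) * int (k i)"
            by (simp only: sum_distrib_right[symmetric])
        qed
        also have "\<dots> = 2 * (int N - int K) * int K"
          by (simp add: K_def wt_def sum_distrib_left)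
        finally show ?thesis by (simp add: algebra_simps)
      qed
      finally show ?thesis .
    qed
    have st: "subset_term a b u I (S k) = q powi (3 * int (K choose 2) - 2 * int N * int K) * cc
      * (q powi (2 * int N * int K - 2 * int K * int K) * (Zn / Z)) * (O1 * H)"
    proof -
      have "(\<Prod>z\<in>I - S k. out_fac K (u z)) = O1"
        unfolding ISk O1_def by (simp add: prod_SigmaI u_def)
      moreover have "(\<Prod>z\<in>S k. in_fac a N K (u z)) = H"
        unfolding S_def H_def by (simp add: prod_SigmaI u_def)
      ultimately show ?thesis
        unfolding subset_term_def cardI cardS K_def[symmetric] vdm subset_coeff_def cc_def by (simp only: mult_ac)
    qed
    define \<Delta>' where "\<Delta>' = eDelta r (\<lambda>i. x i * q ^ (2 * k i)) p"
    \<comment> \<open>The quotient of the two Vandermonde products becomes Q / Z up to a sign and a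
      power of q. Then Q cancels a denominator of the summand, and 1 / Z is the one in
      \<open>vdm\<close>.\<close>
    have L: "\<Delta>' = (-1) ^ K * q powi (- (int K * int K) - int K) * Q * eDelta r x p / Z"
      using pochhammer_Delta[of r x k, OF x] Znz
      unfolding \<Delta>'_def Z_def[symmetric] Q_def[symmetric] K_def[symmetric] by (simp add: field_simps)
    have Tk: "T k = \<Delta>' / eDelta r x p * (\<theta> (a * q ^ (3 * K)) / \<theta> a * (eshifts [a, b, q / b] q p K
            / (eshift (a * q ^ (2 * N + 1)) q p K * eshifts [a * q\<^sup>2 / b, a * q * b] (q\<^sup>2) p K)))
            * q powi (int K - int (e2 r k)) * P * (Zn / Q)"
      unfolding T_def \<Delta>'_def P_def F_def Zn_def Q_def K_def N_def prod_dividef by (simp only: mult.assoc)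
    have "T k * (C0 * B) = \<Delta>' / eDelta r x p * cc * q powi (int K - int (e2 r k)) * (P * B) * (Zn / Q)"
      unfolding Tk coeff[symmetric] by (simp only: mult_ac)
    also have "\<dots> = ((-1) ^ K * (-1) ^ K) * (q powi (- (int K * int K) - int K) * q powi (int K - int (e2 r k))
        * q powi (\<Sum>i=1..r. int (k i) * int K - 2 * int (k i) - int (k i choose 2))) * cc * (Zn / Z) * (O1 * H)"
      unfolding prods L using Qnz \<Delta> by simp
    also have "(-1) ^ K * (-1) ^ K = (1::complex)"
      by (simp flip: power_add mult_2)
    \<comment> \<open>The exponents agree because e2 plus the sum of the (k_i choose 2) equals (K
      choose 2).\<close>
    also have "q powi (- (int K * int K) - int K) * q powi (int K - int (e2 r k))
        * q powi (\<Sum>i=1..r. int (k i) * int K - 2 * int (k i) - int (k i choose 2))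
      = q powi (3 * int (K choose 2) - 2 * int N * int K) * q powi (2 * int N * int K - 2 * int K * int K)"
    proof -
      have s: "(\<Sum>i=1..r. int (k i) * int K - 2 * int (k i) - int (k i choose 2)) =
          int K * int K - 2 * int K - (\<Sum>i=1..r. int (k i choose 2))"
      proof -
        have "(\<Sum>i=1..r. int (k i)) = int K" by (simp add: K_def wt_def)
        then show ?thesis
          by (simp only: sum_subtractf sum_distrib_right[symmetric] sum_distrib_left[symmetric])
      qed
      have "2 * (\<Sum>i=1..r. int (k i choose 2)) = (\<Sum>i=1..r. int (k i) * int (k i)) - int K"
        by (simp only: sum_distrib_left two_choose_2) (simp add: sum_subtractf K_def wt_def)
      moreover have "int K * int K = (\<Sum>i=1..r. int (k i) * int (k i)) + 2 * int (e2 r k)"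
        using arg_cong[OF sum_square_pairs[of r k], of int] by (simp add: power2_eq_square K_def)
      ultimately have "- (int K * int K) - int K + (int K - int (e2 r k))
          + (\<Sum>i=1..r. int (k i) * int K - 2 * int (k i) - int (k i choose 2))
        = 3 * int (K choose 2) - 2 * int N * int K + (2 * int N * int K - 2 * int K * int K)"
        using two_choose_2[of K] unfolding s by simp
      then show ?thesis by (simp only: powi_mult)
    qed
    finally show ?thesis unfolding st by (simp only: mult_1_left mult_ac)
  qed

  have "(\<Sum>k\<in>kbox r n. T k) * (C0 * B) = (\<Sum>k\<in>kbox r n. subset_term a b u I (S k))"
    unfolding sum_distrib_right by (rule sum.cong[OF refl T_eq])
  also have "\<dots> = (\<Sum>T\<in>Pow I. subset_term a b u I T)"
    unfolding I_def u_def S_def by (rule sum_subset_term_kbox[OF D, symmetric])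
  also have "\<dots> = subset_rhs a b u I"
    by (rule subset_identity[OF _ a b u_nz u_dist]) (simp_all add: I_def)
  also have "\<dots> = \<theta> a * eshift (a * q) q p (2 * N) * eshift (a * q ^ (2 * N + 1)) q p N
     * (\<Prod>i=1..r. \<Prod>m<n i. \<theta> (D i / q ^ (2 * m) / (b * q)) * \<theta> (b * (D i / q ^ (2 * m)) / q\<^sup>2))"
  proof -
    have "eshift a q p (1 + (2 * N + N)) = eshift a q p 1 * (eshift (a * q ^ 1) q p (2 * N) * eshift (a * q ^ 1 * q ^ (2 * N)) q p N)"
      by (simp only: eshift_add)
    moreover have "1 + (2 * N + N) = 3 * N + 1" "a * q ^ 1 * q ^ (2 * N) = a * q ^ (2 * N + 1)" by simp_all
    moreover have "eshift a q p 1 = \<theta> a" by (simp add: eshift_def)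
    ultimately have "eshift a q p (3 * N + 1) = \<theta> a * eshift (a * q) q p (2 * N) * eshift (a * q ^ (2 * N + 1)) q p N"
      by (simp only: power_one_right mult.assoc)
    moreover have "(\<Prod>z\<in>I. \<theta> (u z / (b * q)) * \<theta> (b * u z / q\<^sup>2)) =
       (\<Prod>i=1..r. \<Prod>m<n i. \<theta> (D i / q ^ (2 * m) / (b * q)) * \<theta> (b * (D i / q ^ (2 * m)) / q\<^sup>2))"
      unfolding I_def by (simp add: prod_SigmaI u_def)
    ultimately show ?thesis unfolding subset_rhs_def cardI by simp
  qed
  finally have main: "(\<Sum>k\<in>kbox r n. T k) * (C0 * B) = \<theta> a * eshift (a * q) q p (2 * N) * eshift (a * q ^ (2 * N + 1)) q p N
     * (\<Prod>i=1..r. \<Prod>m<n i. \<theta> (D i / q ^ (2 * m) / (b * q)) * \<theta> (b * (D i / q ^ (2 * m)) / q\<^sup>2))" .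
  define U where "U = (\<Prod>i=1..r. \<Prod>m<n i. \<theta> (D i / q ^ (2 * m) / (b * q)) * \<theta> (b * (D i / q ^ (2 * m)) / q\<^sup>2))"
  define W where "W = (\<Prod>i=1..r. eshifts [a * b * x i * q / d, a * x i * q\<^sup>2 / (b * d)] (q\<^sup>2) p (n i))"
  define Y where "Y = (\<Prod>i=1..r. eshift (a * x i * q / d) q p (2 * n i))"
  have Ynz: "Y \<noteq> 0" using assms(20) by (simp add: Y_def)
  have UY: "U * Y = W * B"
    unfolding U_def Y_def W_def B_def prod.distrib[symmetric]
  proof (rule prod.cong[OF refl])
    fix i assume i: "i \<in> {1..r}"
    have e: "a * b * x i * q / d = b * q / D i" "a * x i * q\<^sup>2 / (b * d) = q\<^sup>2 / (b * D i)" "a * x i * q / d = q / D i"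
      using a d b x[OF i] by (simp_all add: D_def \<delta>_def)
    show "(\<Prod>m<n i. \<theta> (D i / q ^ (2 * m) / (b * q)) * \<theta> (b * (D i / q ^ (2 * m)) / q\<^sup>2)) * eshift (a * x i * q / d) q p (2 * n i)
      = eshifts [a * b * x i * q / d, a * x i * q\<^sup>2 / (b * d)] (q\<^sup>2) p (n i) * eshift (D i * q powi (- 2 * int (n i))) q p (2 * n i)"
      unfolding e single_rhs[OF D[OF i] b] by (simp add: eshifts_def)
  qed
  \<comment> \<open>Reflection relates the factors of \<open>B\<close> to the shifted factorials of
    q / D i in the denominator of the right-hand side.\<close>
  have Bnz: "B \<noteq> 0"
  proof -
    have "eshift (D i * q powi (- 2 * int (n i))) q p (2 * n i) \<noteq> 0" if i: "i \<in> {1..r}" for i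
    proof -
      have "eshift (q / D i) q p (2 * n i) \<noteq> 0"
        using assms(20)[OF i] s3(3)[OF i, of q] by simp
      then show ?thesis
        using eshift_reflect[OF D[OF i], of "-1" "2 * n i"] D[OF i] q by simp
    qed
    then show ?thesis by (simp add: B_def)
  qed
  define G where "G = eshifts [a * b * q, a * q\<^sup>2 / b] (q\<^sup>2) p N"
  have Gnz: "G \<noteq> 0" using assms(19) by (simp add: G_def N_def)
  have Fnz: "eshift (a * q ^ (2 * N + 1)) q p N \<noteq> 0"
    using assms(13)[OF nn(1)] nn(2) by (simp add: N_def)
  have C0: "C0 = \<theta> a * eshift (a * q ^ (2 * N + 1)) q p N * G"
    by (simp add: C0_def G_def eshifts_def mult_ac)
  have "(\<Sum>k\<in>kbox r n. T k) = \<theta> a * eshift (a * q) q p (2 * N) * eshift (a * q ^ (2 * N + 1)) q p N * U / (C0 * B)"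
    using main C0 Bnz Gnz Fnz \<theta>a unfolding U_def[symmetric] by (simp add: field_simps)
  also have "\<dots> = eshift (a * q) q p (2 * N) / G * (U / B)"
    unfolding C0 using Fnz \<theta>a by simp
  also have "U / B = W / Y"
    using UY Bnz Ynz by (simp add: field_simps)
  finally show ?thesis
    unfolding T_def W_def Y_def G_def N_def prod_dividef .
qed

end
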